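(* Define, for $x\ge 1$, $w(x)=\max_{n\le x}\omega(d(n))$. Then, as $x\to\infty$, \[ w(x)=\frac{\sqrt{\log x}}{\log_2 x}\left(\sqrt{8}+O\!\left(\frac{\log_3 x}{\log_2 x}\right)\right). \]
   Context: $d(n)$ denotes the number of positive divisors of $n$, and $\omega(m)$ denotes the number of distinct prime factors of $m$. $\log_k x$ denotes the $k$-th iterate of the natural logarithm. The maximum is over positive integers $n\le x$. *)

theory Defs
  imports "HOL-Analysis.Analysis" "HOL-Computational_Algebra.Primes" "HOL-Library.Landau_Symbols"
begin

definition ndiv :: "nat \<Rightarrow> nat" where
  "ndiv n = card {k. k dvd n}"

definition omega :: "nat \<Rightarrow> nat" where
  "omega m = card (prime_factors m)"

definition w :: "real \<Rightarrow> nat" where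
  "w x = Max ((\<lambda>n. omega (ndiv n)) ` {1..nat \<lfloor>x\<rfloor>})"

end

theory Submission
  imports Defs "HOL-Complex_Analysis.Complex_Analysis" "HOL-Number_Theory.Prime_Powers" "HOL-Real_Asymp.Real_Asymp"
begin

text \<open>
  The cheapest way to make the \<open>k\<close> first primes \<open>q\<^sub>1 < \<dots> < q\<^sub>k\<close> divide \<open>d(n)\<close> is to use them as
  \<open>q = a + 1\<close> for distinct exponents \<open>a\<close> of \<open>n\<close>, which costs about
  \<open>(q\<^sub>1 + \<dots> + q\<^sub>k) ln k\<close> in \<open>ln n\<close>. Sharing an exponent between two primes larger than \<open>2 ln k\<close> does not
  help, and at most \<open>k / (ln k)\<^sup>2\<close> prime factors of \<open>n\<close> are small enough to be cheaper. So everything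
  depends on \<open>q\<^sub>1 + \<dots> + q\<^sub>k = k\<^sup>2 ln k / 2 + O(k\<^sup>2 ln ln k)\<close>.

  Since \<open>k y - (q\<^sub>1 + \<dots> + q\<^sub>k) \<le> A(y)\<close> with \<open>A(y) = (\<Sum>p \<le> y. y - p)\<close>, with equality for
  \<open>y = q\<^sub>k\<close>, that estimate follows by duality from \<open>A(y) = y\<^sup>2 / (2 ln y) (1 + O(ln ln y / ln y))\<close>.
  The latter is a smoothed prime number theorem with error term, so no unsmoothing is needed. It comes
  from Perron's formula for \<open>(\<Sum>n \<le> x. \<Lambda>(n) (1 - n / x))\<close> on the line \<open>Re s = 1 + 1 / ln x\<close>: one
  integration by parts gains the factor \<open>1 / ln x\<close>, provided the derivative of \<open>\<zeta>' / \<zeta>\<close> grows more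
  slowly than \<open>\<bar>Im s\<bar>\<close>. This in turn follows from a bound \<open>O(\<bar>Im s\<bar>\<^sup>\<eta>)\<close> with \<open>\<eta> = 1/20\<close> for \<open>\<zeta>\<close>
  slightly to the left of \<open>Re s = 1\<close>, Cauchy's inequalities and the \<open>3-4-1\<close> inequality.
\<close>

section \<open>The regularised zeta function\<close>

text \<open>The exponent \<open>1/20\<close> comes from a chain of exponents. Write \<tau> for 1 +
  |Im s| and \<eta> for the exponent in the bound of \<zeta>. Then (s - 1) \<zeta>(s) and its first
  two derivatives are O(\<tau>^(1 + \<eta>)). The 3-4-1 inequality at distance \<tau>^(-5 \<eta>)
  from the line balances against a horizontal move by that distance, which yields a lower bound of
  order \<tau>^(1 - 4 \<eta>). So the logarithmic derivative is O(\<tau>^(5 \<eta>)) and its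
  derivative O(\<tau>^(10 \<eta>)). After division by s (s + 1) this is integrable when 10 \<eta> <
  1, and \<eta> = 1/20 gives \<tau>^(-3/2). The regular part of the Perron integral is never moved
  across Re s = 1: on its line x^s has modulus e x, so bounds uniform as Re s decreases to 1 suffice
  and no zero-free region to the left enters. The constant sqrt 8 comes from solving k^2 (ln k)^2 /
  2 = ln x, where ln k is about half of ln ln x.\<close>

lemma norm_of_real_powr_complex:
  assumes "x > 0"
  shows "norm (complex_of_real x powr s) = x powr Re s"
  using assms by (simp add: norm_powr_real_powr)

lemma powr_minus_diff_bound:
  fixes s :: complex
  assumes "0 < a" "a \<le> b" "Re s \<ge> 0"
  shows "norm (complex_of_real b powr (-s) - complex_of_real a powr (-s))
           \<le> norm s * a powr (- Re s - 1) * (b - a)"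
proof -
  have "norm (complex_of_real b powr (-s) - complex_of_real a powr (-s))
      \<le> (norm s * a powr (- Re s - 1)) * norm (complex_of_real b - complex_of_real a)"
  proof (rule field_differentiable_bound[where S = "closed_segment (of_real a) (of_real b)"
        and f' = "\<lambda>z. -s * z powr (-s - 1)"])
    fix z assume "z \<in> closed_segment (complex_of_real a) (complex_of_real b)"
    then obtain r where r: "z = of_real r" "a \<le> r" "r \<le> b"
      using assms by (auto simp: closed_segment_of_real closed_segment_eq_real_ivl)
    show "((\<lambda>z. z powr (-s)) has_field_derivative -s * z powr (-s - 1))
        (at z within closed_segment (complex_of_real a) (complex_of_real b))"
      using r assms by (intro has_field_derivative_at_within[OF has_field_derivative_powr]) (auto simp: complex_nonpos_Reals_iff)
    have "norm (-s * z powr (-s - 1)) = norm s * r powr (- Re s - 1)"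
      using r assms by (simp add: norm_mult norm_powr_real_powr)
    also have "\<dots> \<le> norm s * a powr (- Re s - 1)"
      using r assms by (intro mult_left_mono powr_mono2') auto
    finally show "norm (-s * z powr (-s - 1)) \<le> norm s * a powr (- Re s - 1)" .
  qed auto
  also have "norm (complex_of_real b - complex_of_real a) = b - a"
    using assms by (simp flip: of_real_diff)
  finally show ?thesis by simp
qed

text \<open>With \<open>N = Suc n\<close> this is the integral over v from N to N + 1 of
  \<open>(s - 1) * (N powr (-s) - v powr (-s))\<close>, that is, \<open>s - 1\<close> times the
  error of replacing the integral of \<open>v powr (-s)\<close> by the value at the left
  endpoint.\<close>

definition zterm :: "nat \<Rightarrow> complex \<Rightarrow> complex" where
  "zterm n s = (s - 1) * of_real (Suc n) powr (-s) - of_real (Suc n) powr (1 - s)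
     + of_real (Suc (Suc n)) powr (1 - s)"

text \<open>The term is the increment of a primitive over an interval of length 1, so a bound of the
  derivative bounds it. \<open>M\<close> is left open because two different estimates of the
  difference of powers are to be inserted.\<close>

lemma zterm_bound_aux:
  assumes "Re s \<ge> 0" 
    and M: "\<And>v. real (Suc n) \<le> v \<Longrightarrow> v \<le> Suc (Suc n) \<Longrightarrow>
             norm (complex_of_real (Suc n) powr (-s) - complex_of_real v powr (-s)) \<le> M"
  shows "norm (zterm n s) \<le> norm (s - 1) * M"
proof -
  define \<phi> where "\<phi> = (\<lambda>z. (s - 1) * of_real (Suc n) powr (-s) * z + z powr (1 - s))"
  have "norm (\<phi> (of_real (Suc (Suc n))) - \<phi> (of_real (Suc n)))
      \<le> (norm (s - 1) * M) * norm (complex_of_real (Suc (Suc n)) - complex_of_real (Suc n))"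
  proof (rule field_differentiable_bound[where S = "closed_segment (of_real (Suc n)) (of_real (Suc (Suc n)))"
        and f' = "\<lambda>z. (s - 1) * (of_real (Suc n) powr (-s) - z powr (-s))"])
    fix z assume "z \<in> closed_segment (complex_of_real (Suc n)) (complex_of_real (Suc (Suc n)))"
    then obtain r where r: "z = of_real r" "real (Suc n) \<le> r" "r \<le> Suc (Suc n)"
      unfolding closed_segment_of_real closed_segment_eq_real_ivl by auto
    have "z \<notin> \<real>\<^sub>\<le>\<^sub>0" using r by (auto simp: complex_nonpos_Reals_iff)
    then have "((\<lambda>z. z powr (1 - s)) has_field_derivative (1 - s) * z powr (1 - s - 1))
        (at z within closed_segment (complex_of_real (Suc n)) (complex_of_real (Suc (Suc n))))"
      by (intro has_field_derivative_at_within[OF has_field_derivative_powr])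
    then show "(\<phi> has_field_derivative (s - 1) * (of_real (Suc n) powr (-s) - z powr (-s)))
        (at z within closed_segment (complex_of_real (Suc n)) (complex_of_real (Suc (Suc n))))"
      unfolding \<phi>_def using \<open>z \<notin> \<real>\<^sub>\<le>\<^sub>0\<close> by (auto intro!: derivative_eq_intros simp: algebra_simps)
    show "norm ((s - 1) * (of_real (Suc n) powr (-s) - z powr (-s))) \<le> norm (s - 1) * M"
      unfolding norm_mult using M[OF r(2,3)] r by (intro mult_left_mono) auto
  qed auto
  moreover have "\<phi> (of_real (Suc (Suc n))) - \<phi> (of_real (Suc n)) = zterm n s"
    by (simp add: \<phi>_def zterm_def algebra_simps)
  ultimately show ?thesis by simp
qed

text \<open>Interpolating between the trivial bound and the mean value bound gives convergence left of
  \<open>Re s = 1\<close> at the price of the small power \<open>norm s powr (1/20)\<close> only.\<close>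

lemma zterm_bound:
  assumes s: "Re s \<ge> 39/40"
  shows "norm (zterm n s) \<le> 2 * norm (s - 1) * norm s powr (1/20) * real (Suc n) powr (-41/40)"
proof -
  define N where "N = real (Suc n)"
  have N: "N \<ge> 1" by (simp add: N_def)
  have s0: "norm s > 0" using s by auto
  define P where "P = N powr (- Re s)"
  have "norm (zterm n s) \<le> norm (s - 1) * (2 * P * (norm s / N) powr (1/20))"
  proof (rule zterm_bound_aux)
    fix v assume v: "real (Suc n) \<le> v" "v \<le> real (Suc (Suc n))"
    let ?D = "norm (complex_of_real (Suc n) powr (-s) - complex_of_real v powr (-s))"
    show "?D \<le> 2 * P * (norm s / N) powr (1/20)"
    \<comment> \<open>If \<open>norm s \<ge> N\<close>, the interpolating factor is at least 1 and
      the triangle inequality suffices. Otherwise the mean value bound gives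
      \<open>norm s / N < 1\<close>, and lowering its exponent from 1 to 1/20 only enlarges
      it.\<close>
    proof (cases "norm s \<ge> N")
      case True
      have "?D \<le> N powr (- Re s) + v powr (- Re s)"
        using v N unfolding N_def
        by (intro order_trans[OF norm_triangle_ineq4] add_mono)
           (auto simp: norm_powr_real_powr)
      also have "\<dots> \<le> 2 * P"
        using powr_mono2'[of "- Re s" N v] v s N by (simp add: P_def N_def)
      also have "\<dots> \<le> 2 * P * (norm s / N) powr (1/20)"
        using True N by (simp add: P_def ge_one_powr_ge_zero mult_le_cancel_left1)
      finally show ?thesis .
    next
      case False
      have "?D \<le> norm s * N powr (- Re s - 1) * (v - N)"
        using powr_minus_diff_bound[of "real (Suc n)" v s] v s by (subst norm_minus_commute) (simp add: N_def)
      also have "\<dots> \<le> norm s * N powr (- Re s - 1) * 1"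
        using v by (intro mult_left_mono) (auto simp: N_def)
      also have "\<dots> = P * (norm s / N) powr 1"
        using N s0 by (simp add: P_def powr_diff)
      also have "\<dots> \<le> P * (norm s / N) powr (1/20)"
        using False N s0 by (intro mult_left_mono powr_mono') (auto simp: P_def)
      also have "\<dots> \<le> 2 * P * (norm s / N) powr (1/20)"
        using N by (simp add: P_def)
      finally show ?thesis .
    qed
  qed (use s in auto)
  also have "\<dots> = 2 * norm (s - 1) * norm s powr (1/20) * N powr (- Re s - 1/20)"
    using N s0 by (simp add: P_def powr_divide powr_diff)
  \<comment> \<open>The left boundary 39/40 leaves the summable exponent -39/40 - 1/20 =
    -41/40.\<close>
  also have "\<dots> \<le> 2 * norm (s - 1) * norm s powr (1/20) * N powr (-41/40)"
    using N s by (intro mult_left_mono powr_mono) auto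
  finally show ?thesis by (simp add: N_def)
qed

text \<open>This equals \<open>(s - 1) \<zeta>(s)\<close>: the terms \<open>n\<^sup>1\<^sup>-\<^sup>s\<close> in \<open>zterm\<close> telescope.\<close>

definition zeta_reg :: "complex \<Rightarrow> complex" where
  "zeta_reg s = 1 + (\<Sum>n. zterm n s)"

lemma summable_Suc_powr: "a < -1 \<Longrightarrow> summable (\<lambda>n. real (Suc n) powr a)"
  by (subst summable_Suc_iff) (simp add: summable_real_powr_iff)

lemma summable_zterm:
  assumes "Re s \<ge> 39/40"
  shows "summable (\<lambda>n. norm (zterm n s))"
  by (rule summable_comparison_test'[OF summable_mult[OF summable_Suc_powr[of "-41/40"]]])
     (use zterm_bound[OF assms] in auto)

text \<open>The factor \<open>norm (s - 1)\<close> is kept explicit: it gives both the growth far up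
  the line and the closeness to 1 near the former pole.\<close>

lemma norm_zeta_reg_minus_1_le:
  assumes s: "Re s \<ge> 39/40"
  shows "norm (zeta_reg s - 1) \<le> norm (s - 1) * norm s powr (1/20) * (2 * (\<Sum>n. real (Suc n) powr (-41/40)))"
proof -
  have sm: "summable (\<lambda>n. 2 * norm (s - 1) * norm s powr (1/20) * real (Suc n) powr (-41/40))"
    by (intro summable_mult summable_Suc_powr) auto
  have "norm (\<Sum>n. zterm n s) \<le> (\<Sum>n. norm (zterm n s))"
    by (rule summable_norm[OF summable_zterm[OF s]])
  also have "\<dots> \<le> (\<Sum>n. 2 * norm (s - 1) * norm s powr (1/20) * real (Suc n) powr (-41/40))"
    by (intro suminf_le summable_zterm s sm zterm_bound)
  also have "\<dots> = 2 * norm (s - 1) * norm s powr (1/20) * (\<Sum>n. real (Suc n) powr (-41/40))"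
    by (intro suminf_mult summable_Suc_powr) auto
  finally show ?thesis by (simp add: zeta_reg_def mult_ac)
qed

lemma holomorphic_zterm: "zterm n holomorphic_on A"
  unfolding zterm_def by (intro holomorphic_intros)

text \<open>Locally uniform domination allows termwise differentiation. The strip to the left of Re
  s = 1 makes room for Cauchy's inequalities on discs centred on that line.\<close>

lemma holomorphic_zeta_reg: "zeta_reg holomorphic_on {s. Re s > 39/40}"
proof -
  let ?S = "{s. Re s > 39/40}"
  have "\<exists>g. \<forall>x\<in>?S. ((\<lambda>n. zterm n x) sums g x) \<and> g field_differentiable (at x)"
  proof (rule series_differentiable_comparison_complex)
    show "open ?S" by (rule open_halfspace_Re_gt)
    show "zterm n field_differentiable at x" for n x
      using holomorphic_zterm[of n UNIV] by (simp add: holomorphic_on_open field_differentiable_def)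
    fix x assume "x \<in> ?S"
    define h :: "nat \<Rightarrow> complex" where "h = (\<lambda>n. complex_of_real (2 * (norm x + 2) * (norm x + 1) powr (1/20) * real (Suc n) powr (-41/40)))"
    have "summable h" unfolding h_def
      by (intro summable_of_real summable_mult summable_Suc_powr) auto
    moreover have "range h \<subseteq> \<real>\<^sub>\<ge>\<^sub>0" by (auto simp: h_def)
    moreover have "norm (zterm n y) \<le> norm (h n)" if "y \<in> ball x 1 \<inter> ?S" for n y
    proof -
      have y: "norm y \<le> norm x + 1"
        using that norm_triangle_ineq2[of y x] by (auto simp: dist_norm norm_minus_commute)
      then have "norm (y - 1) \<le> norm x + 2"
        using norm_triangle_ineq4[of y 1] by simp
      have "norm (zterm n y) \<le> 2 * norm (y - 1) * norm y powr (1/20) * real (Suc n) powr (-41/40)"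
        using that by (intro zterm_bound) auto
      also have "\<dots> \<le> 2 * (norm x + 2) * (norm x + 1) powr (1/20) * real (Suc n) powr (-41/40)"
        using y \<open>norm (y - 1) \<le> norm x + 2\<close>
        by (intro mult_right_mono mult_mono powr_mono2) auto
      also have "\<dots> = norm (h n)"
        unfolding h_def norm_of_real by (intro abs_of_nonneg[symmetric] mult_nonneg_nonneg) auto
      finally show ?thesis .
    qed
    ultimately show "\<exists>d (h::nat \<Rightarrow> complex). 0 < d \<and> summable h \<and> range h \<subseteq> \<real>\<^sub>\<ge>\<^sub>0 \<and>
        (\<forall>\<^sub>F n in sequentially. \<forall>y\<in>ball x d \<inter> ?S. norm (zterm n y) \<le> norm (h n))"
      by (intro exI[of _ 1] exI[of _ h]) auto
  qed auto
  then obtain g where g: "\<And>x. x \<in> ?S \<Longrightarrow> ((\<lambda>n. zterm n x) sums g x) \<and> g field_differentiable (at x)"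
    by blast
  have "g holomorphic_on ?S"
    using g by (simp add: field_differentiable_at_within holomorphic_on_def)
  then have "(\<lambda>s. 1 + g s) holomorphic_on ?S" by (intro holomorphic_intros)
  then show ?thesis
    by (rule holomorphic_transform) (use g in \<open>auto simp: zeta_reg_def sums_iff\<close>)
qed

section \<open>Dirichlet series and the 3-4-1 inequality\<close>

text \<open>The term at index 0 vanishes because \<open>0 powr (-s) = 0\<close>.\<close>

definition dirichlet :: "(nat \<Rightarrow> real) \<Rightarrow> complex \<Rightarrow> complex" where
  "dirichlet a s = (\<Sum>n. of_real (a n) * of_nat n powr (-s))"

lemma norm_dirichlet_term:
  "norm (complex_of_real a * of_nat n powr (-s)) = \<bar>a\<bar> * real n powr (- Re s)"
  by (cases "n = 0") (simp_all add: norm_mult norm_powr_real_powr)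

text \<open>The bound \<open>ln (real n) + 1\<close> covers all coefficients that occur: 1, ln n,
  \<open>mangoldt n\<close> and its quotient by ln n. Half of the distance of \<sigma> from 1 pays
  for the logarithm through ln n \<le> n^d / d.\<close>

lemma summable_dirichlet_real:
  assumes a: "\<And>n. \<bar>a n\<bar> \<le> ln (real n) + 1" and s: "\<sigma> > 1"
  shows "summable (\<lambda>n. \<bar>a n\<bar> * real n powr (-\<sigma>))"
proof -
  define d where "d = (\<sigma> - 1) / 2"
  have d: "d > 0" "d - \<sigma> < -1" using s by (auto simp: d_def field_simps)
  show ?thesis
  proof (rule summable_comparison_test'[of "\<lambda>n. (1/d) * real n powr (d - \<sigma>) + real n powr (-\<sigma>)" 1])
    show "summable (\<lambda>n. (1/d) * real n powr (d - \<sigma>) + real n powr (-\<sigma>))"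
      using d s by (intro summable_add summable_mult) (auto simp: summable_real_powr_iff)
    fix n :: nat assume n: "n \<ge> 1"
    have "\<bar>a n\<bar> * real n powr (-\<sigma>) \<le> (real n powr d / d + 1) * real n powr (-\<sigma>)"
      using a[of n] ln_powr_bound[of "real n" d] n d by (intro mult_right_mono) auto
    also have "\<dots> = (1/d) * real n powr (d - \<sigma>) + real n powr (-\<sigma>)"
      using n by (simp add: powr_diff powr_minus field_simps)
    finally show "norm (\<bar>a n\<bar> * real n powr (-\<sigma>)) \<le> \<dots>" by simp
  qed
qed

lemma summable_dirichlet:
  assumes "\<And>n. \<bar>a n\<bar> \<le> ln (real n) + 1" "Re s > 1"
  shows "summable (\<lambda>n. norm (of_real (a n) * (of_nat n :: complex) powr (-s)))"
  using summable_dirichlet_real[OF assms] by (simp only: norm_dirichlet_term)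

lemma dirichlet_sums:
  assumes "\<And>n. \<bar>a n\<bar> \<le> ln (real n) + 1" "Re s > 1"
  shows "(\<lambda>n. of_real (a n) * of_nat n powr (-s)) sums dirichlet a s"
  unfolding dirichlet_def using summable_norm_cancel[OF summable_dirichlet[OF assms]]
  by (simp add: summable_sums)

text \<open>The coefficients are bounded by 1 here, so that those of the derivative still satisfy
  the logarithmic bound required above.\<close>

lemma dirichlet_deriv:
  assumes a: "\<And>n. \<bar>a n\<bar> \<le> 1" and s: "Re s > 1"
  shows "(dirichlet a has_field_derivative - dirichlet (\<lambda>n. a n * ln (real n)) s) (at s)"
proof -
  let ?S = "{s. Re s > 1}"
  let ?f = "\<lambda>n s. complex_of_real (a n) * of_nat n powr (-s)"
  let ?f' = "\<lambda>n s. - (complex_of_real (a n * ln (real n)) * of_nat n powr (-s))"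
  have ln0: "ln (real n) \<ge> 0" for n by (cases "n = 0") auto
  have "\<exists>g g'. \<forall>x\<in>?S. ((\<lambda>n. ?f n x) sums g x) \<and> ((\<lambda>n. ?f' n x) sums g' x) \<and>
      (g has_field_derivative g' x) (at x)"
  proof (rule series_and_derivative_comparison_complex)
    show "open ?S" by (rule open_halfspace_Re_gt)
    show "(?f n has_field_derivative ?f' n x) (at x)" for n x
    proof (cases "n = 0")
      case False
      then have "((\<lambda>z. of_nat n powr z) has_field_derivative Ln (of_nat n) * of_nat n powr (-x)) (at (-x))"
        by (intro has_field_derivative_powr_right) auto
      then have "((\<lambda>s. of_nat n powr (-s)) has_field_derivative Ln (of_nat n) * of_nat n powr (-x) * (-1)) (at x)"
        by (rule DERIV_chain2) (auto intro!: derivative_eq_intros)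
      from DERIV_cmult[OF this, of "of_real (a n)"] False show ?thesis
        by (simp add: mult_ac)
    qed auto
    fix x assume x: "x \<in> ?S"
    define d where "d = (Re x - 1) / 2"
    define h :: "nat \<Rightarrow> complex" where "h = (\<lambda>n. of_real (real n powr (- (Re x - d))))"
    have d: "d > 0" using x by (simp add: d_def)
    have "summable h" unfolding h_def
      by (intro summable_of_real) (use x in \<open>auto simp: summable_real_powr_iff d_def field_simps\<close>)
    moreover have "range h \<subseteq> \<real>\<^sub>\<ge>\<^sub>0" by (auto simp: h_def)
    moreover have "norm (?f n y) \<le> norm (h n)" if y: "y \<in> ball x d \<inter> ?S" for n y
    proof (cases "n = 0")
      case False
      have "\<bar>Re x - Re y\<bar> \<le> norm (x - y)" using abs_Re_le_cmod[of "x - y"] by simp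
      then have "Re y \<ge> Re x - d" using y by (auto simp: dist_norm)
      then have "real n powr (- Re y) \<le> real n powr (- (Re x - d))"
        using False by (intro powr_mono) auto
      then show ?thesis unfolding norm_dirichlet_term h_def norm_of_real
        using mult_mono[OF a[of n], of "real n powr (- Re y)" "real n powr (- (Re x - d))"] by simp
    qed (simp add: h_def)
    ultimately show "\<exists>d (h::nat \<Rightarrow> complex). 0 < d \<and> summable h \<and> range h \<subseteq> \<real>\<^sub>\<ge>\<^sub>0 \<and>
        (\<forall>\<^sub>F n in sequentially. \<forall>y\<in>ball x d \<inter> ?S. norm (?f n y) \<le> norm (h n))"
      using d by (intro exI[of _ d] exI[of _ h]) auto
  qed
  then obtain g g' where g: "\<And>x. x \<in> ?S \<Longrightarrow> ((\<lambda>n. ?f n x) sums g x)"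
      "\<And>x. x \<in> ?S \<Longrightarrow> ((\<lambda>n. ?f' n x) sums g' x)"
      "\<And>x. x \<in> ?S \<Longrightarrow> (g has_field_derivative g' x) (at x)"
    by blast
  have "(dirichlet a has_field_derivative g' s) (at s)"
  proof (rule has_field_derivative_transform_within_open[OF g(3)])
    show "open ?S" by (rule open_halfspace_Re_gt)
    show "g x = dirichlet a x" if "x \<in> ?S" for x
      using g(1)[OF that] unfolding dirichlet_def by (rule sums_unique)
  qed (use s in auto)
  moreover have "g' s = - dirichlet (\<lambda>n. a n * ln (real n)) s"
  proof -
    have b: "\<bar>a n * ln (real n)\<bar> \<le> ln (real n) + 1" for n
      using mult_right_mono[OF a ln0, of n n] ln0[of n] by (simp add: abs_mult)
    show ?thesis using sums_unique2[OF g(2) sums_minus[OF dirichlet_sums[OF b s]]] s by auto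
  qed
  ultimately show ?thesis by simp
qed

section \<open>The series of zeta, of its logarithmic derivative and of its logarithm\<close>

abbreviation "unit_coeff \<equiv> (\<lambda>n::nat. if n = 0 then 0 else 1 :: real)"

definition zeta :: "complex \<Rightarrow> complex" where
  "zeta = dirichlet unit_coeff"

definition mangoldt_series :: "complex \<Rightarrow> complex" where
  "mangoldt_series = dirichlet mangoldt"

text \<open>The coefficients at 0 and 1 are 0, since there both \<open>mangoldt n\<close> and
  \<open>ln (real n)\<close> are 0 and \<open>0 / 0 = 0\<close>.\<close>

definition log_zeta :: "complex \<Rightarrow> complex" where
  "log_zeta = dirichlet (\<lambda>n. mangoldt n / ln (real n))"

lemma ln_nat_nonneg: "ln (real n) \<ge> 0"
  by (cases "n = 0") auto

lemma unit_coeff_bound: "\<bar>unit_coeff n\<bar> \<le> ln (real n) + 1"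
  using ln_nat_nonneg[of n] by auto

lemma mangoldt_bound: "\<bar>mangoldt n :: real\<bar> \<le> ln (real n) + 1"
  using mangoldt_le[of n] by (cases "n = 0") (auto simp: ln_nat_nonneg)

lemma mangoldt_div_ln_le: "\<bar>mangoldt n / ln (real n)\<bar> \<le> 1"
  using mangoldt_le[of n] mangoldt_nonneg[of n] ln_nat_nonneg[of n]
  by (cases "n = 0") (auto simp: divide_simps)

lemma mangoldt_div_ln_bound: "\<bar>mangoldt n / ln (real n)\<bar> \<le> ln (real n) + 1"
  using mangoldt_div_ln_le[of n] ln_nat_nonneg[of n] by linarith

text \<open>Unordered summation is the form in which a double series can be regrouped by divisors.
  Index 0 is removed because it has infinitely many divisors.\<close>

lemma has_sum_dirichlet:
  assumes "\<And>n. \<bar>a n\<bar> \<le> ln (real n) + 1" "Re s > 1"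
  shows "((\<lambda>n. of_real (a n) * of_nat n powr (-s)) has_sum dirichlet a s) {0<..}"
proof -
  have "((\<lambda>n. of_real (a n) * of_nat n powr (-s)) has_sum dirichlet a s) UNIV"
    by (intro norm_summable_imp_has_sum summable_dirichlet dirichlet_sums assms)
  then have "((\<lambda>n. of_real (a n) * of_nat n powr (-s)) has_sum dirichlet a s) (UNIV - {0})"
    using has_sum_cong_neutral[of "UNIV - {0}" UNIV "\<lambda>n. of_real (a n) * (of_nat n :: complex) powr (-s)"
        "\<lambda>n. of_real (a n) * of_nat n powr (-s)" "dirichlet a s"] by simp
  moreover have "UNIV - {0::nat} = {0<..}" by auto
  ultimately show ?thesis by (simp only:)
qed

lemma has_sum_product_Times:
  fixes f :: "'a \<Rightarrow> complex" and g :: "'b \<Rightarrow> complex"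
  assumes "(\<lambda>x. norm (f x)) summable_on A" "(\<lambda>x. norm (g x)) summable_on B"
    "(f has_sum a) A" "(g has_sum b) B"
  shows "((\<lambda>(x,y). f x * g y) has_sum (a * b)) (A \<times> B)"
proof (rule has_sum_SigmaI)
  show "((\<lambda>y. case (x, y) of (x, y) \<Rightarrow> f x * g y) has_sum f x * b) B" for x
    using has_sum_cmult_right[OF assms(4)] by simp
  show "((\<lambda>x. f x * b) has_sum a * b) A"
    using has_sum_cmult_left[OF assms(3)] by simp
  have "(\<lambda>x. norm ((\<lambda>(x,y). f x * g y) x)) summable_on A \<times> B"
    unfolding Infinite_Sum.abs_summable_on_Sigma_iff
    using assms(1,2) by (auto simp: norm_mult infsum_cmult_right' infsum_nonneg
        intro!: summable_on_cmult_right summable_on_cmult_left)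
  then show "(\<lambda>(x,y). f x * g y) summable_on A \<times> B"
    by (rule abs_summable_summable)
qed

text \<open>Grouping the absolutely convergent double series by the product n = d m turns it into a
  Dirichlet convolution, and the sum of \<open>mangoldt d\<close> over d dividing n is ln n.\<close>

lemma mangoldt_series_mult_zeta:
  assumes s: "Re s > 1"
  shows "mangoldt_series s * zeta s = dirichlet (\<lambda>n. ln (real n)) s"
proof -
  let ?A = "{0<..} :: nat set"
  let ?f = "\<lambda>n. of_real (mangoldt n) * (of_nat n :: complex) powr (-s)"
  let ?g = "\<lambda>n. of_real (unit_coeff n) * (of_nat n :: complex) powr (-s)"
  have abs: "(\<lambda>n. norm (of_real (a n) * (of_nat n :: complex) powr (-s))) summable_on ?A"
    if "\<And>n. \<bar>a n\<bar> \<le> ln (real n) + 1" for a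
    using summable_on_subset_banach[OF norm_summable_imp_summable_on, of "\<lambda>n. norm (of_real (a n) * (of_nat n :: complex) powr (-s))" ?A]
      summable_dirichlet[OF that s] by simp
  have 1: "((\<lambda>(d,m). ?f d * ?g m) has_sum (mangoldt_series s * zeta s)) (?A \<times> ?A)"
    unfolding mangoldt_series_def zeta_def
    by (intro has_sum_product_Times abs has_sum_dirichlet mangoldt_bound unit_coeff_bound s)
  have bij: "bij_betw (\<lambda>(n,d). (d, n div d)) (Sigma ?A (\<lambda>n. {d. d dvd n})) (?A \<times> ?A)"
    by (rule bij_betwI[where g = "\<lambda>(d,m). (d * m, d)"]) (auto intro!: Nat.gr0I)
  have 2: "((\<lambda>x. (\<lambda>(d,m). ?f d * ?g m) ((\<lambda>(n,d). (d, n div d)) x)) has_sum (mangoldt_series s * zeta s)) 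
     (Sigma ?A (\<lambda>n. {d. d dvd n}))"
    using 1 has_sum_reindex_bij_betw[OF bij] by blast
  have 3: "((\<lambda>n. of_real (ln (real n)) * of_nat n powr (-s)) has_sum (mangoldt_series s * zeta s)) ?A"
  proof (rule has_sum_Sigma'[OF 2])
    fix n assume n: "n \<in> ?A"
    have "(\<Sum>d | d dvd n. ?f d * ?g (n div d)) = (\<Sum>d | d dvd n. of_real (mangoldt d) * of_nat n powr (-s))"
    proof (rule sum.cong)
      fix d assume "d \<in> {d. d dvd n}"
      then obtain m where m: "n = d * m" by auto
      with n have "d > 0" "m > 0" by auto
      then show "?f d * ?g (n div d) = of_real (mangoldt d) * of_nat n powr (-s)"
        using powr_times_real[of "of_nat d" "of_nat m" "-s"] by (simp add: m)
    qed auto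
    also have "\<dots> = of_real (ln (real n)) * of_nat n powr (-s)"
      using mangoldt_sum[of n, where ?'a = complex] n
      by (simp flip: sum_distrib_right)
    finally show "((\<lambda>d. (\<lambda>(d,m). ?f d * ?g m) ((\<lambda>(n,d). (d, n div d)) (n, d))) has_sum
        of_real (ln (real n)) * of_nat n powr (-s)) {d. d dvd n}"
      using n by (intro has_sum_finiteI) auto
  qed
  have 4: "((\<lambda>n. of_real (ln (real n)) * of_nat n powr (-s)) has_sum dirichlet (\<lambda>n. ln (real n)) s) ?A"
    by (intro has_sum_dirichlet s) (simp add: ln_nat_nonneg)
  show ?thesis using has_sum_unique[OF 3 4] .
qed

lemma zeta_deriv:
  assumes s: "Re s > 1"
  shows "(zeta has_field_derivative - (mangoldt_series s * zeta s)) (at s)"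
proof -
  have "dirichlet (\<lambda>n. unit_coeff n * ln (real n)) s = dirichlet (\<lambda>n. ln (real n)) s"
    unfolding dirichlet_def by (intro suminf_cong) auto
  then show ?thesis
    using dirichlet_deriv[of unit_coeff s] s by (simp add: zeta_def mangoldt_series_mult_zeta[OF s, unfolded zeta_def])
qed

lemma log_zeta_deriv:
  assumes s: "Re s > 1"
  shows "(log_zeta has_field_derivative - mangoldt_series s) (at s)"
proof -
  have eq: "mangoldt n / ln (real n) * ln (real n) = mangoldt n" for n
  proof (cases "n \<le> 1")
    case True then have "n = 0 \<or> n = 1" by auto
    then show ?thesis by auto
  qed auto
  then have *: "dirichlet (\<lambda>n. mangoldt n / ln (real n) * ln (real n)) s = mangoldt_series s"
    unfolding mangoldt_series_def by (simp only:)
  then show ?thesis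
    using dirichlet_deriv[of "\<lambda>n. mangoldt n / ln (real n)", OF mangoldt_div_ln_le s]
    by (simp only: log_zeta_def *)
qed

text \<open>For n \<ge> 2 and \<sigma> \<ge> 2 one has n^(-\<sigma>) \<le> n^(-2) 2^(2 - \<sigma>),
  so everything beyond the first term decays exponentially in \<sigma>. The limit serves to fix a
  constant of integration.\<close>

lemma dirichlet_tendsto:
  assumes a: "\<And>n. \<bar>a n\<bar> \<le> 1" "a 0 = 0"
  shows "((\<lambda>\<sigma>. dirichlet a (of_real \<sigma>)) \<longlongrightarrow> of_real (a 1)) at_top"
proof -
  have a': "\<bar>a n\<bar> \<le> ln (real n) + 1" for n using a(1)[of n] ln_nat_nonneg[of n] by linarith
  define C where "C = (\<Sum>n. real (n+2) powr (-2))"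
  have sC: "summable (\<lambda>n. real (n+2) powr (-2))"
    by (subst summable_iff_shift) (simp add: summable_real_powr_iff)
  have bd: "norm (dirichlet a (of_real \<sigma>) - of_real (a 1)) \<le> C * 2 powr (2 - \<sigma>)" if \<sigma>: "\<sigma> \<ge> 2" for \<sigma>
  proof -
    let ?f = "\<lambda>n. of_real (a n) * (of_nat n :: complex) powr (- of_real \<sigma>)"
    have sm: "summable (\<lambda>n. norm (?f n))" using summable_dirichlet[OF a', of "of_real \<sigma>"] \<sigma> by simp
    have "dirichlet a (of_real \<sigma>) = (\<Sum>n. ?f (n+2)) + (\<Sum>i<2. ?f i)"
      unfolding dirichlet_def by (rule suminf_split_initial_segment[OF summable_norm_cancel[OF sm]])
    also have "(\<Sum>i<2. ?f i) = of_real (a 1)" using a(2) by (simp add: numeral_2_eq_2)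
    finally have "norm (dirichlet a (of_real \<sigma>) - of_real (a 1)) = norm (\<Sum>n. ?f (n+2))" by simp
    also have "\<dots> \<le> (\<Sum>n. norm (?f (n+2)))"
      by (rule summable_norm, rule summable_ignore_initial_segment[OF sm])
    also have "\<dots> \<le> (\<Sum>n. real (n+2) powr (-2) * 2 powr (2 - \<sigma>))"
    proof (intro suminf_le)
      fix n
      have "norm (?f (n+2)) \<le> 1 * real (n+2) powr (-\<sigma>)"
        unfolding norm_dirichlet_term using a by (intro mult_mono) auto
      also have "\<dots> = real (n+2) powr (-2) * real (n+2) powr (2-\<sigma>)"
        by (simp flip: powr_add)
      also have "\<dots> \<le> real (n+2) powr (-2) * 2 powr (2-\<sigma>)"
        using \<sigma> by (intro mult_left_mono powr_mono2') auto
      finally show "norm (?f (n+2)) \<le> \<dots>" .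
    qed (use summable_ignore_initial_segment[OF sm, of 2] summable_mult2[OF sC] in auto)
    also have "\<dots> = C * 2 powr (2 - \<sigma>)"
      unfolding C_def by (rule suminf_mult2[symmetric, OF sC])
    finally show ?thesis .
  qed
  have "((\<lambda>\<sigma>::real. 2 powr (2 - \<sigma>)) \<longlongrightarrow> 0) at_top" by real_asymp
  then have "((\<lambda>\<sigma>. C * 2 powr (2 - \<sigma>)) \<longlongrightarrow> 0) at_top" by (rule tendsto_mult_right_zero)
  then have "((\<lambda>\<sigma>. dirichlet a (of_real \<sigma>) - of_real (a 1)) \<longlongrightarrow> 0) at_top"
    by (rule Lim_null_comparison[rotated]) (use bd in \<open>auto intro: eventually_mono[OF eventually_ge_at_top[of "2::real"]]\<close>)
  then show ?thesis by (simp add: LIM_zero_iff)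
qed

text \<open>Both sides satisfy \<open>f' = - mangoldt_series * f\<close> and tend to 1 at \<open>+\<infinity>\<close>; this replaces the
  Euler product.\<close>

lemma zeta_eq_exp:
  assumes s: "Re s > 1"
  shows "zeta s = exp (log_zeta s)"
proof -
  let ?S = "{s. Re s > 1}"
  have "\<exists>c. \<forall>x\<in>?S. zeta x * exp (- log_zeta x) = c"
  proof (rule has_field_derivative_zero_constant)
    show "convex ?S" by (rule convex_halfspace_Re_gt)
    fix x assume x: "x \<in> ?S"
    show "((\<lambda>x. zeta x * exp (- log_zeta x)) has_field_derivative 0) (at x within ?S)"
    proof (rule has_field_derivative_at_within)
      have x: "Re x > 1" using x by simp
      have "((\<lambda>x. exp (- log_zeta x)) has_field_derivative exp (- log_zeta x) * (- (- mangoldt_series x))) (at x)"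
        using DERIV_chain2[OF DERIV_exp DERIV_minus[OF log_zeta_deriv[OF x]]] by simp
      from DERIV_mult[OF zeta_deriv[OF x] this]
      show "((\<lambda>x. zeta x * exp (- log_zeta x)) has_field_derivative 0) (at x)"
        by (simp add: algebra_simps)
    qed
  qed
  then obtain c where c: "\<And>x. Re x > 1 \<Longrightarrow> zeta x * exp (- log_zeta x) = c" by auto
  have "((\<lambda>\<sigma>. zeta (of_real \<sigma>)) \<longlongrightarrow> 1) at_top"
    using dirichlet_tendsto[of unit_coeff] by (simp add: zeta_def)
  moreover have "((\<lambda>\<sigma>. log_zeta (of_real \<sigma>)) \<longlongrightarrow> 0) at_top"
    using dirichlet_tendsto[of "\<lambda>n. mangoldt n / ln (real n)", OF mangoldt_div_ln_le] by (simp add: log_zeta_def)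
  ultimately have "((\<lambda>\<sigma>. zeta (of_real \<sigma>) * exp (- log_zeta (of_real \<sigma>))) \<longlongrightarrow> 1 * exp (-0)) at_top"
    by (intro tendsto_intros)
  then have L: "((\<lambda>\<sigma>. zeta (of_real \<sigma>) * exp (- log_zeta (of_real \<sigma>))) \<longlongrightarrow> 1) at_top" by simp
  have "eventually (\<lambda>\<sigma>. zeta (of_real \<sigma>) * exp (- log_zeta (of_real \<sigma>)) = c) at_top"
    using eventually_gt_at_top[of "1::real"] by eventually_elim (auto intro: c)
  then have "((\<lambda>\<sigma>. zeta (of_real \<sigma>) * exp (- log_zeta (of_real \<sigma>))) \<longlongrightarrow> c) at_top"
    by (rule tendsto_eventually)
  then have "c = 1" using L by (rule tendsto_unique[OF trivial_limit_at_top_linorder])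
  with c[OF s] show ?thesis by (simp add: exp_minus field_simps)
qed

text \<open>The logarithm of |\<zeta>| is the real part of \<open>log_zeta\<close>, whose
  coefficients are nonnegative, and 3 + 4 cos \<theta> + cos (2 \<theta>) = 2 (1 + cos
  \<theta>)^2.\<close>

lemma zeta_3_4_1:
  assumes "\<sigma> > 1"
  shows "norm (zeta (of_real \<sigma>)) ^ 3 * norm (zeta (Complex \<sigma> t)) ^ 4 * norm (zeta (Complex \<sigma> (2 * t))) \<ge> 1"
proof -
  let ?a = "\<lambda>n. mangoldt n / ln (real n)"
  have Re_sums: "(\<lambda>n. ?a n * real n powr (-\<sigma>) * cos (u * ln (real n))) sums Re (log_zeta (Complex \<sigma> u))" for u
  proof -
    have "(\<lambda>n. Re (of_real (?a n) * of_nat n powr (- Complex \<sigma> u))) sums Re (log_zeta (Complex \<sigma> u))"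
      unfolding log_zeta_def using assms by (intro sums_Re dirichlet_sums mangoldt_div_ln_bound) auto
    moreover have "Re (of_real (?a n) * of_nat n powr (- Complex \<sigma> u)) = ?a n * real n powr (-\<sigma>) * cos (u * ln (real n))" for n
    proof (cases "n = 0")
      case False
      have "complex_of_nat n powr (- Complex \<sigma> u) = exp (- Complex \<sigma> u * of_real (ln (real n)))"
        using False by (simp add: powr_def)
      then have "Re (complex_of_nat n powr (- Complex \<sigma> u)) = real n powr (-\<sigma>) * cos (u * ln (real n))"
        using False by (simp add: Re_exp powr_def)
      then show ?thesis by simp
    qed auto
    ultimately show ?thesis by (simp only:)
  qed
  have S: "(\<lambda>n. 3 * (?a n * real n powr (-\<sigma>) * cos (0 * ln (real n))) + 4 * (?a n * real n powr (-\<sigma>) * cos (t * ln (real n)))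
      + ?a n * real n powr (-\<sigma>) * cos (2 * t * ln (real n))) sums
      (3 * Re (log_zeta (Complex \<sigma> 0)) + 4 * Re (log_zeta (Complex \<sigma> t)) + Re (log_zeta (Complex \<sigma> (2*t))))"
    by (intro sums_add sums_mult Re_sums)
  have NN: "3 * (?a n * real n powr (-\<sigma>) * cos (0 * ln (real n))) + 4 * (?a n * real n powr (-\<sigma>) * cos (t * ln (real n)))
      + ?a n * real n powr (-\<sigma>) * cos (2 * t * ln (real n)) \<ge> 0" for n :: nat
  proof -
    have "cos (2 * t * ln (real n)) = 2 * cos (t * ln (real n)) ^ 2 - 1"
      using cos_double_cos[of "t * ln (real n)"] by (simp add: mult.assoc)
    moreover define A where "A = ?a n * real n powr (-\<sigma>)"
    ultimately have "3 * (?a n * real n powr (-\<sigma>) * cos (0 * ln (real n))) + 4 * (?a n * real n powr (-\<sigma>) * cos (t * ln (real n)))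
      + ?a n * real n powr (-\<sigma>) * cos (2 * t * ln (real n)) = 2 * (?a n * real n powr (-\<sigma>)) * (1 + cos (t * ln (real n)))\<^sup>2"
      unfolding A_def[symmetric] by (simp only:) (simp add: algebra_simps power2_eq_square)
    also have "\<dots> \<ge> 0" by (intro mult_nonneg_nonneg divide_nonneg_nonneg) (auto simp: mangoldt_nonneg ln_nat_nonneg)
    finally show ?thesis .
  qed
  have "3 * Re (log_zeta (Complex \<sigma> 0)) + 4 * Re (log_zeta (Complex \<sigma> t)) + Re (log_zeta (Complex \<sigma> (2*t))) \<ge> 0"
    by (rule sums_le[OF NN sums_zero S])
  moreover have "norm (zeta (Complex \<sigma> u)) = exp (Re (log_zeta (Complex \<sigma> u)))" for u
    using assms by (simp add: zeta_eq_exp norm_exp_eq_Re)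
  moreover have "complex_of_real \<sigma> = Complex \<sigma> 0" by (simp add: complex_of_real_def)
  ultimately show ?thesis
    by (simp add: exp_of_nat_mult[symmetric] exp_add[symmetric])
qed

lemma zeta_reg_eq:
  assumes s: "Re s > 1"
  shows "zeta_reg s = (s - 1) * zeta s"
proof -
  let ?p = "\<lambda>n. complex_of_real (real (Suc n)) powr (1 - s)"
  have "(\<lambda>n. of_real (unit_coeff n) * of_nat n powr (-s)) sums zeta s"
    unfolding zeta_def by (intro dirichlet_sums unit_coeff_bound s)
  then have "(\<lambda>n. of_real (unit_coeff (Suc n)) * of_nat (Suc n) powr (-s)) sums zeta s"
    by (subst sums_Suc_iff) simp
  then have 1: "(\<lambda>n. (s - 1) * of_real (real (Suc n)) powr (-s)) sums ((s - 1) * zeta s)"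
    by (intro sums_mult) simp
  have "?p \<longlonglongrightarrow> 0"
  proof (rule tendsto_norm_zero_cancel)
    have "(\<lambda>n. real (Suc n) powr (1 - Re s)) \<longlonglongrightarrow> 0" using s by real_asymp
    then show "(\<lambda>n. norm (?p n)) \<longlonglongrightarrow> 0" by (simp only: norm_of_real_powr_complex) simp
  qed
  then have 2: "(\<lambda>n. ?p (Suc n) - ?p n) sums (0 - ?p 0)" by (rule telescope_sums)
  have "(\<lambda>n. zterm n s) sums ((s - 1) * zeta s + (0 - ?p 0))"
    using sums_add[OF 1 2] by (simp add: zterm_def algebra_simps)
  then show ?thesis by (simp add: zeta_reg_def sums_iff)
qed

text \<open>This separates the pole, which will be integrated exactly, from the regular part, which
  only needs to be estimated. Nonvanishing follows from the exponential form of zeta.\<close>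

lemma zeta_reg_log_deriv:
  assumes s: "Re s > 1"
  shows "zeta_reg s \<noteq> 0" and "mangoldt_series s = 1 / (s - 1) - deriv zeta_reg s / zeta_reg s"
proof -
  have s1: "s - 1 \<noteq> 0" using s by auto
  show nz: "zeta_reg s \<noteq> 0" using s1 by (simp add: zeta_reg_eq[OF s] zeta_eq_exp[OF s])
  have "((\<lambda>s. (s - 1) * zeta s) has_field_derivative (zeta s - (s - 1) * (mangoldt_series s * zeta s))) (at s)"
    using DERIV_mult[OF DERIV_diff[OF DERIV_ident DERIV_const] zeta_deriv[OF s], of 1]
    by (simp add: algebra_simps)
  then have "(zeta_reg has_field_derivative (zeta s - (s - 1) * (mangoldt_series s * zeta s))) (at s)"
    by (rule has_field_derivative_transform_within_open[where S = "{s. Re s > 1}"])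
       (use s in \<open>auto simp: zeta_reg_eq open_halfspace_Re_gt\<close>)
  then have "deriv zeta_reg s = zeta s - (s - 1) * (mangoldt_series s * zeta s)" by (rule DERIV_imp_deriv)
  then show "mangoldt_series s = 1 / (s - 1) - deriv zeta_reg s / zeta_reg s"
    using nz s1 by (simp add: zeta_reg_eq[OF s] diff_divide_distrib)
qed

section \<open>Bounds near the line \<open>Re s = 1\<close>\<close>

text \<open>In the exponent, 1 comes from the factor \<open>s - 1\<close> and 1/20 from the
  interpolation.\<close>

lemma zeta_reg_growth:
  "\<exists>C>0. \<forall>s. 39/40 \<le> Re s \<and> Re s \<le> 3 \<longrightarrow> norm (zeta_reg s) \<le> C * (1 + \<bar>Im s\<bar>) powr (21/20)"
proof -
  define S where "S = 2 * (\<Sum>n. real (Suc n) powr (-41/40))"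
  have S: "S \<ge> 0" unfolding S_def by (intro mult_nonneg_nonneg suminf_nonneg summable_Suc_powr) auto
  have "norm (zeta_reg s) \<le> (1 + 12 * S) * (1 + \<bar>Im s\<bar>) powr (21/20)"
    if s: "39/40 \<le> Re s" "Re s \<le> 3" for s
  proof -
    define \<tau> where "\<tau> = 1 + \<bar>Im s\<bar>"
    have t: "\<tau> \<ge> 1" by (simp add: \<tau>_def)
    have n1: "norm s \<le> 4 * \<tau>" using cmod_le[of s] s by (simp add: \<tau>_def)
    have n2: "norm (s - 1) \<le> 3 * \<tau>" using cmod_le[of "s - 1"] s by (simp add: \<tau>_def)
    have "(4::real) powr (1/20) \<le> 4 powr 1" by (intro powr_mono) auto
    then have "(4 * \<tau>) powr (1/20) \<le> 4 * \<tau> powr (1/20)"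
      using t by (simp add: powr_mult mult_right_mono)
    then have n3: "norm s powr (1/20) \<le> 4 * \<tau> powr (1/20)"
      using powr_mono2[OF _ _ n1, of "1/20"] by simp
    have "norm (zeta_reg s) \<le> 1 + norm (zeta_reg s - 1)"
      using norm_triangle_ineq[of "zeta_reg s - 1" 1] by simp
    also have "\<dots> \<le> 1 + norm (s - 1) * norm s powr (1/20) * S"
      using norm_zeta_reg_minus_1_le[OF s(1)] by (simp add: S_def)
    also have "\<dots> \<le> 1 + (3 * \<tau>) * (4 * \<tau> powr (1/20)) * S"
      using n2 n3 S t by (intro add_left_mono mult_right_mono mult_mono) auto
    also have "\<dots> = 1 + 12 * S * \<tau> powr (21/20)"
      using t powr_mult_base[of \<tau> "1/20"] by (simp add: mult_ac)
    also have "\<dots> \<le> 1 * \<tau> powr (21/20) + 12 * S * \<tau> powr (21/20)"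
      using t by (simp add: ge_one_powr_ge_zero)
    finally show ?thesis by (simp add: algebra_simps \<tau>_def)
  qed
  then show ?thesis using S by (intro exI[of _ "1 + 12 * S"]) auto
qed

text \<open>Cauchy's inequality on discs of radius 1/80, which stay inside the strip of width 1/40,
  keeps the exponent. Orders up to 2 are needed because the derivative of the logarithmic derivative
  is to be bounded.\<close>

lemma zeta_reg_deriv_growth:
  "\<exists>C\<ge>1. \<forall>s j. 1 \<le> Re s \<and> Re s \<le> 2 \<and> j \<le> 2 \<longrightarrow>
     norm ((deriv ^^ j) zeta_reg s) \<le> C * (1 + \<bar>Im s\<bar>) powr (21/20)"
proof -
  obtain C where C: "C > 0" "\<And>s. 39/40 \<le> Re s \<Longrightarrow> Re s \<le> 3 \<Longrightarrow> norm (zeta_reg s) \<le> C * (1 + \<bar>Im s\<bar>) powr (21/20)"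
    using zeta_reg_growth by blast
  have "norm ((deriv ^^ j) zeta_reg s) \<le> (C * 51200 + 1) * (1 + \<bar>Im s\<bar>) powr (21/20)"
    if s: "1 \<le> Re s" "Re s \<le> 2" "j \<le> 2" for s j
  proof -
    define \<tau> where "\<tau> = 1 + \<bar>Im s\<bar>"
    have t: "\<tau> \<ge> 1" by (simp add: \<tau>_def)
    have sub: "cball s (1/80) \<subseteq> {s. Re s > 39/40}"
    proof
      fix z assume "z \<in> cball s (1/80)"
      then have "\<bar>Re s - Re z\<bar> \<le> 1/80"
        using abs_Re_le_cmod[of "s - z"] by (auto simp: dist_norm)
      then have "Re z > 39/40" using s(1) unfolding abs_le_iff by linarith
      then show "z \<in> {s. Re s > 39/40}" by simp
    qed
    have hol: "zeta_reg holomorphic_on cball s (1/80)"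
      using holomorphic_on_subset[OF holomorphic_zeta_reg sub] .
    have "norm ((deriv ^^ j) zeta_reg s) \<le> fact j * (C * (4 * \<tau> powr (21/20))) / (1/80) ^ j"
    proof (rule Cauchy_inequality)
      show "zeta_reg holomorphic_on ball s (1/80)"
        using hol by (rule holomorphic_on_subset) auto
      show "continuous_on (cball s (1/80)) zeta_reg"
        using hol by (rule holomorphic_on_imp_continuous_on)
      fix z assume z: "norm (s - z) = 1/80"
      have "\<bar>Re s - Re z\<bar> \<le> 1/80" using abs_Re_le_cmod[of "s - z"] z by simp
      then have Re: "39/40 \<le> Re z" "Re z \<le> 3" using s(1,2) by linarith+
      have "\<bar>Im s - Im z\<bar> \<le> 1/80" using abs_Im_le_cmod[of "s - z"] z by simp
      then have "1 + \<bar>Im z\<bar> \<le> 2 * \<tau>" unfolding \<tau>_def by (smt (verit) divide_le_eq_1_pos)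
      note * = Re this
      have "norm (zeta_reg z) \<le> C * (1 + \<bar>Im z\<bar>) powr (21/20)"
        using C(2) * by auto
      also have "\<dots> \<le> C * (2 * \<tau>) powr (21/20)"
        using C(1) * by (intro mult_left_mono powr_mono2) auto
      also have "(2 * \<tau>) powr (21/20) = 2 powr (21/20) * \<tau> powr (21/20)"
        using t by (simp add: powr_mult)
      also have "\<dots> \<le> 2 powr 2 * \<tau> powr (21/20)"
        by (intro mult_right_mono powr_mono) auto
      finally show "norm (zeta_reg z) \<le> C * (4 * \<tau> powr (21/20))" using C(1) by simp
    qed auto
    also have "\<dots> = (fact j * 80 ^ j * 4) * C * \<tau> powr (21/20)"
      by (simp add: power_divide)
    \<comment> \<open>The largest case is j = 2, with 2 * 80^2 * 4. The 4 bounds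
      \<open>2 powr (21/20)\<close>, which arises since |Im z| may exceed |Im s| on the
      circle.\<close>
    also have "fact j * 80 ^ j * 4 \<le> (51200::real)"
    proof -
      have "j = 0 \<or> j = 1 \<or> j = 2" using s(3) by auto
      then show ?thesis by (auto simp: fact_numeral)
    qed
    then have "(fact j * 80 ^ j * 4) * C * \<tau> powr (21/20) \<le> 51200 * C * \<tau> powr (21/20)"
      using C(1) by (intro mult_right_mono) auto
    also have "\<dots> \<le> (C * 51200 + 1) * \<tau> powr (21/20)" by (simp add: algebra_simps)
    finally show ?thesis by (simp add: \<tau>_def)
  qed
  then show ?thesis using C(1) by (intro exI[of _ "C * 51200 + 1"]) auto
qed

text \<open>The value at 1 is 1 and the deviation carries a factor \<open>norm (s - 1)\<close>. This
  covers small imaginary parts, where the bound from the 3-4-1 inequality degenerates.\<close>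

lemma zeta_reg_near_1: "\<exists>\<rho>>0. \<rho> \<le> 1 \<and> (\<forall>s. Re s \<ge> 1 \<and> norm (s - 1) \<le> \<rho> \<longrightarrow> norm (zeta_reg s) \<ge> 1/2)"
proof -
  define S where "S = 2 * (\<Sum>n. real (Suc n) powr (-41/40))"
  have S: "S \<ge> 0" unfolding S_def by (intro mult_nonneg_nonneg suminf_nonneg summable_Suc_powr) auto
  define \<rho> where "\<rho> = 1 / (4 * S + 1)"
  have r: "\<rho> > 0" "\<rho> \<le> 1" "4 * S * \<rho> \<le> 1" using S by (auto simp: \<rho>_def field_simps)
  have "norm (zeta_reg s) \<ge> 1/2" if s: "Re s \<ge> 1" "norm (s - 1) \<le> \<rho>" for s
  proof -
    have n: "norm s \<le> 2" using norm_triangle_ineq[of "s - 1" 1] s r by simp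
    have "norm s powr (1/20) \<le> 2 powr (1/20)" using n by (intro powr_mono2) auto
    also have "\<dots> \<le> 2 powr 1" by (intro powr_mono) auto
    finally have n2: "norm s powr (1/20) \<le> 2" by simp
    have "norm (zeta_reg s - 1) \<le> norm (s - 1) * norm s powr (1/20) * S"
      using norm_zeta_reg_minus_1_le[of s] s by (simp add: S_def)
    also have "\<dots> \<le> \<rho> * 2 * S" using s r S n2 by (intro mult_right_mono mult_mono) auto
    also have "\<dots> \<le> 1/2" using r by (simp add: field_simps)
    finally show ?thesis using norm_triangle_ineq2[of 1 "1 - zeta_reg s"]
      by (simp add: norm_minus_commute)
  qed
  then show ?thesis using r by blast
qed

text \<open>Each zeta value is multiplied by its \<open>s - 1\<close>: the real point contributes
  \<open>(\<sigma> - 1) ^ 3\<close>, the other two points at least |t| to the power 4 + 1.\<close>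

lemma zeta_reg_3_4_1:
  assumes "\<sigma> > 1"
  shows "(\<sigma> - 1) ^ 3 * \<bar>t\<bar> ^ 5 \<le>
     norm (zeta_reg (of_real \<sigma>)) ^ 3 * norm (zeta_reg (Complex \<sigma> t)) ^ 4 * norm (zeta_reg (Complex \<sigma> (2 * t)))"
proof -
  have n0: "norm (complex_of_real \<sigma> - 1) = \<sigma> - 1"
    using assms norm_of_real[of "\<sigma> - 1"] by simp
  have n1: "norm (Complex \<sigma> t - 1) \<ge> \<bar>t\<bar>" using abs_Im_le_cmod[of "Complex \<sigma> t - 1"] by simp
  have n2: "norm (Complex \<sigma> (2 * t) - 1) \<ge> \<bar>t\<bar>" using abs_Im_le_cmod[of "Complex \<sigma> (2 * t) - 1"] by simp
  let ?Z = "norm (zeta (of_real \<sigma>)) ^ 3 * norm (zeta (Complex \<sigma> t)) ^ 4 * norm (zeta (Complex \<sigma> (2 * t)))"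
  have "(\<sigma> - 1) ^ 3 * \<bar>t\<bar> ^ 5 = (\<sigma> - 1) ^ 3 * \<bar>t\<bar> ^ 4 * \<bar>t\<bar> * 1"
    by (simp add: power_numeral_reduce)
  also have "\<dots> \<le> (\<sigma> - 1) ^ 3 * norm (Complex \<sigma> t - 1) ^ 4 * norm (Complex \<sigma> (2 * t) - 1) * ?Z"
    using zeta_3_4_1[OF assms, of t] n1 n2 assms
    by (intro mult_mono power_mono mult_nonneg_nonneg) auto
  also have "\<dots> = norm (zeta_reg (of_real \<sigma>)) ^ 3 * norm (zeta_reg (Complex \<sigma> t)) ^ 4 * norm (zeta_reg (Complex \<sigma> (2 * t)))"
    using assms by (simp add: zeta_reg_eq norm_mult power_mult_distrib n0 mult_ac)
  finally show ?thesis .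
qed

section \<open>Lower bound to the right of the line Re s = 1\<close>

lemma has_field_derivative_zeta_reg:
  "Re s > 39/40 \<Longrightarrow> (zeta_reg has_field_derivative deriv zeta_reg s) (at s)"
  by (rule holomorphic_derivI[OF holomorphic_zeta_reg open_halfspace_Re_gt]) simp

lemma has_field_derivative_deriv_zeta_reg:
  "Re s > 39/40 \<Longrightarrow> (deriv zeta_reg has_field_derivative deriv (deriv zeta_reg) s) (at s)"
  by (rule holomorphic_derivI[OF holomorphic_deriv[OF holomorphic_zeta_reg open_halfspace_Re_gt] open_halfspace_Re_gt]) simp

text \<open>The 3-4-1 inequality is used at distance at least \<open>\<kappa> * \<tau> powr (-1/4)\<close> from the line
  \<open>Re s = 1\<close>; closer to it, the derivative bound transports the estimate horizontally.\<close>

lemma zeta_reg_lower_bound: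
  "\<exists>c>0. \<exists>r>0. r \<le> 1 \<and> (\<forall>s. 1 < Re s \<and> Re s \<le> 1 + r \<longrightarrow> norm (zeta_reg s) \<ge> c * (1 + \<bar>Im s\<bar>) powr (4/5))"
proof -
  obtain C where C: "C \<ge> 1" "\<And>s j. 1 \<le> Re s \<Longrightarrow> Re s \<le> 2 \<Longrightarrow> j \<le> 2 \<Longrightarrow>
      norm ((deriv ^^ j) zeta_reg s) \<le> C * (1 + \<bar>Im s\<bar>) powr (21/20)"
    using zeta_reg_deriv_growth by blast
  obtain \<rho> where \<rho>: "\<rho> > 0" "\<rho> \<le> 1" "\<And>s. Re s \<ge> 1 \<Longrightarrow> norm (s - 1) \<le> \<rho> \<Longrightarrow> norm (zeta_reg s) \<ge> 1/2"
    using zeta_reg_near_1 by blast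
  define r where "r = \<rho> / 2"
  have r: "r > 0" "r \<le> 1" using \<rho> by (auto simp: r_def)
  \<comment> \<open>For |t| \<ge> r one has |t| \<ge> k \<tau>, and the 3-4-1 inequality then reads
    |\<open>zeta_reg\<close>|^4 \<ge> c1 (\<sigma> - 1)^3 \<tau>^(79/20).\<close>
  define k where "k = r / (1 + r)"
  have k: "k > 0" "k \<le> 1" using r by (auto simp: k_def)
  define c1 where "c1 = k ^ 5 / (4 * C ^ 4)"
  have c1: "c1 > 0" using k C(1) by (simp add: c1_def)
  \<comment> \<open>Chosen so that \<open>2 * C * \<kappa> \<le> m\<close> for the \<open>m\<close>
    below; raised to the fourth power this is \<open>16 * C ^ 4 * \<kappa> \<le> c1\<close>.\<close>
  define \<kappa> where "\<kappa> = min r (c1 / (16 * C ^ 4))"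
  have \<kappa>: "\<kappa> > 0" "\<kappa> \<le> r" "\<kappa> \<le> c1 / (16 * C ^ 4)" using r c1 C(1) by (auto simp: \<kappa>_def)
  define m where "m = root 4 (c1 * \<kappa> ^ 3)"
  have m: "m > 0" "m ^ 4 = c1 * \<kappa> ^ 3" using c1 \<kappa> by (auto simp: m_def)
  have m2: "2 * C * \<kappa> \<le> m"
  proof (rule power_le_imp_le_base[of _ 3])
    have "\<kappa> * (16 * C ^ 4) \<le> c1" using \<kappa>(3) C(1) by (simp add: field_simps)
    then have "\<kappa> ^ 3 * (\<kappa> * (16 * C ^ 4)) \<le> \<kappa> ^ 3 * c1" using \<kappa>(1) by (intro mult_left_mono) auto
    then show "(2 * C * \<kappa>) ^ Suc 3 \<le> m ^ Suc 3"
      using m(2) by (simp add: power_mult_distrib mult_ac power_numeral_reduce)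
  qed (use m in auto)
  have far: "m * \<tau> powr (4/5) \<le> norm (zeta_reg (Complex \<sigma> t))"
    if \<sigma>: "\<sigma> \<le> 2" and t: "\<bar>t\<bar> \<ge> r" and \<tau>: "\<tau> = 1 + \<bar>t\<bar>" and \<delta>: "\<kappa> * \<tau> powr (-1/4) \<le> \<sigma> - 1" for \<sigma> t \<tau>
  proof (rule power_le_imp_le_base[of _ 3])
    have \<tau>1: "\<tau> \<ge> 1" using \<tau> by simp
    have "\<kappa> * \<tau> powr (-1/4) > 0" using \<kappa> \<tau>1 by simp
    then have \<sigma>1: "\<sigma> > 1" using \<delta> by linarith
    have kt: "k * \<tau> \<le> \<bar>t\<bar>" using t r unfolding k_def \<tau> by (simp add: field_simps)
    have B0: "norm (zeta_reg (of_real \<sigma>)) \<le> C" using C(2)[of "of_real \<sigma>" 0] \<sigma> \<sigma>1 by simp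
    have "norm (zeta_reg (Complex \<sigma> (2 * t))) \<le> C * (1 + \<bar>2 * t\<bar>) powr (21/20)"
      using C(2)[of "Complex \<sigma> (2 * t)" 0] \<sigma> \<sigma>1 by simp
    also have "\<dots> \<le> C * (2 * \<tau>) powr (21/20)"
      using C(1) by (intro mult_left_mono powr_mono2) (auto simp: \<tau>)
    also have "(2 * \<tau>) powr (21/20) = 2 powr (21/20) * \<tau> powr (21/20)"
      using \<tau>1 by (simp add: powr_mult)
    also have "\<dots> \<le> 2 powr 2 * \<tau> powr (21/20)" by (intro mult_right_mono powr_mono) auto
    finally have B2: "norm (zeta_reg (Complex \<sigma> (2 * t))) \<le> C * (4 * \<tau> powr (21/20))" using C(1) by simp
    have "(m * \<tau> powr (4/5)) ^ 4 = c1 * \<kappa> ^ 3 * \<tau> powr (16/5)"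
      using m(2) \<tau>1 by (simp add: power_mult_distrib powr_realpow[symmetric] powr_powr)
    \<comment> \<open>Here 16/5 = 79/20 - 3/4, and 79/20 = 5 - 21/20 comes from |t|^5 against the
      growth of the factor at 2 t.\<close>
    also have "\<dots> = c1 * (\<kappa> * \<tau> powr (-1/4)) ^ 3 * \<tau> powr (79/20)"
      using \<tau>1 by (simp add: power_mult_distrib powr_realpow[symmetric] powr_powr flip: powr_add)
    also have "\<dots> \<le> c1 * (\<sigma> - 1) ^ 3 * \<tau> powr (79/20)"
      using c1 \<delta> \<kappa>(1) by (intro mult_right_mono mult_left_mono power_mono) auto
    also have "\<dots> \<le> norm (zeta_reg (Complex \<sigma> t)) ^ 4"
    proof -
      have "(\<sigma> - 1) ^ 3 * (k * \<tau>) ^ 5 \<le> (\<sigma> - 1) ^ 3 * \<bar>t\<bar> ^ 5"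
        using kt k(1) \<tau>1 \<sigma>1 by (intro mult_left_mono power_mono) auto
      also have "\<dots> \<le> norm (zeta_reg (of_real \<sigma>)) ^ 3 * norm (zeta_reg (Complex \<sigma> t)) ^ 4 * norm (zeta_reg (Complex \<sigma> (2 * t)))"
        by (rule zeta_reg_3_4_1[OF \<sigma>1])
      also have "\<dots> \<le> C ^ 3 * norm (zeta_reg (Complex \<sigma> t)) ^ 4 * (C * (4 * \<tau> powr (21/20)))"
        using B0 B2 C(1) by (intro mult_mono power_mono mult_nonneg_nonneg) auto
      also have "\<dots> = norm (zeta_reg (Complex \<sigma> t)) ^ 4 * (4 * C ^ 4) * \<tau> powr (21/20)"
        by (simp add: power_numeral_reduce)
      finally have "(\<sigma> - 1) ^ 3 * k ^ 5 * \<tau> ^ 5 \<le> norm (zeta_reg (Complex \<sigma> t)) ^ 4 * (4 * C ^ 4) * \<tau> powr (21/20)"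
        by (simp add: power_mult_distrib mult_ac)
      moreover have "\<tau> ^ 5 = \<tau> powr (79/20) * \<tau> powr (21/20)"
        using \<tau>1 powr_realpow[of \<tau> 5] powr_add[of \<tau> "79/20" "21/20"] by simp
      ultimately have "(\<sigma> - 1) ^ 3 * k ^ 5 * \<tau> powr (79/20) * \<tau> powr (21/20) \<le> norm (zeta_reg (Complex \<sigma> t)) ^ 4 * (4 * C ^ 4) * \<tau> powr (21/20)"
        by (simp add: mult_ac)
      then have "(\<sigma> - 1) ^ 3 * k ^ 5 * \<tau> powr (79/20) \<le> norm (zeta_reg (Complex \<sigma> t)) ^ 4 * (4 * C ^ 4)"
        using \<tau>1 by (subst (asm) mult_le_cancel_right_pos) auto
      then show ?thesis using C(1) by (simp add: c1_def field_simps)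
    qed
    finally show "(m * \<tau> powr (4/5)) ^ Suc 3 \<le> norm (zeta_reg (Complex \<sigma> t)) ^ Suc 3" by simp
  qed auto
  define c where "c = min (1/4) (m/2)"
  have c: "c > 0" "c \<le> 1/4" "c \<le> m / 2" using m by (auto simp: c_def)
  have "c * (1 + \<bar>Im s\<bar>) powr (4/5) \<le> norm (zeta_reg s)" if s: "1 < Re s" "Re s \<le> 1 + r" for s
  proof (cases "\<bar>Im s\<bar> \<le> r")
    case True
    have "norm (s - 1) \<le> \<rho>" using cmod_le[of "s - 1"] s True by (simp add: r_def)
    then have "norm (zeta_reg s) \<ge> 1/2" using \<rho>(3) s by simp
    moreover have "(1 + \<bar>Im s\<bar>) powr (4/5) \<le> 2 powr 1"
      using True r by (intro order_trans[OF powr_mono2[of _ _ 2] powr_mono]) auto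
    then have "c * (1 + \<bar>Im s\<bar>) powr (4/5) \<le> (1/4) * 2 powr 1"
      using c by (intro mult_mono) auto
    ultimately show ?thesis by simp
  next
    case False
    define \<sigma> t where "\<sigma> = Re s" and "t = Im s"
    define \<tau> where "\<tau> = 1 + \<bar>t\<bar>"
    have \<tau>1: "\<tau> \<ge> 1" by (simp add: \<tau>_def)
    have s_eq: "s = Complex \<sigma> t" by (simp add: \<sigma>_def t_def complex_eq_iff)
    define \<delta> where "\<delta> = \<kappa> * \<tau> powr (-1/4)"
    have "\<tau> powr (-1/4) \<le> 1" using \<tau>1 powr_mono[of "-1/4" 0 \<tau>] by simp
    then have \<delta>: "\<delta> > 0" "\<delta> \<le> r" 
      using \<kappa> \<tau>1 mult_mono[of \<kappa> r "\<tau> powr (-1/4)" 1] by (auto simp: \<delta>_def)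
    have "(m / 2) * \<tau> powr (4/5) \<le> norm (zeta_reg s)"
    proof (cases "\<sigma> - 1 \<ge> \<delta>")
      case True
      have "m * \<tau> powr (4/5) \<le> norm (zeta_reg s)"
        unfolding s_eq using True False r s
        by (intro far) (auto simp: \<tau>_def \<delta>_def t_def \<sigma>_def)
      moreover have "(m / 2) * \<tau> powr (4/5) \<le> m * \<tau> powr (4/5)" using m by (intro mult_right_mono) auto
      ultimately show ?thesis by linarith
    next
      case near: False
      let ?s' = "Complex (1 + \<delta>) t"
      have A: "m * \<tau> powr (4/5) \<le> norm (zeta_reg ?s')"
        using False r \<delta> by (intro far) (auto simp: \<tau>_def \<delta>_def t_def \<sigma>_def)
      have "norm (zeta_reg ?s' - zeta_reg s) \<le> (C * \<tau> powr (21/20)) * norm (?s' - s)"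
      proof (rule field_differentiable_bound[where S = "closed_segment s ?s'" and f' = "deriv zeta_reg"])
        fix z assume z: "z \<in> closed_segment s ?s'"
        then obtain u where u: "z = (1 - u) *\<^sub>R s + u *\<^sub>R ?s'" "0 \<le> u" "u \<le> 1"
          by (auto simp: closed_segment_def)
        have Rez: "Re z = (1 - u) * \<sigma> + u * (1 + \<delta>)" and Imz: "Im z = t"
          unfolding u(1) s_eq by (auto simp: algebra_simps)
        have "(1 - u) * \<sigma> + u * (1 + \<delta>) \<ge> (1 - u) * 1 + u * 1"
          using u \<delta> s by (intro add_mono mult_left_mono) (auto simp: \<sigma>_def)
        moreover have "(1 - u) * \<sigma> + u * (1 + \<delta>) \<le> (1 - u) * 2 + u * 2"
          using u \<delta> s r by (intro add_mono mult_left_mono) (auto simp: \<sigma>_def)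
        ultimately have Re: "Re z \<ge> 1" "Re z \<le> 2" unfolding Rez by (auto simp: algebra_simps)
        show "(zeta_reg has_field_derivative deriv zeta_reg z) (at z within closed_segment s ?s')"
          using Re has_field_derivative_at_within[OF has_field_derivative_zeta_reg] by simp
        show "norm (deriv zeta_reg z) \<le> C * \<tau> powr (21/20)"
          using C(2)[of z 1] Re Imz by (simp add: \<tau>_def)
      qed auto
      also have "?s' - s = of_real (1 + \<delta> - \<sigma>)" by (simp add: s_eq complex_eq_iff)
      also have "norm (complex_of_real (1 + \<delta> - \<sigma>)) \<le> \<delta>"
        unfolding norm_of_real using near s by (auto simp: \<sigma>_def)
      \<comment> \<open>Since 21/20 - 1/4 = 4/5, the horizontal move costs the same order as the
        bound at \<open>?s'\<close>, and the choice of \<kappa> keeps the loss to at most half of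
        it.\<close>
      also have "(C * \<tau> powr (21/20)) * \<delta> = C * \<kappa> * \<tau> powr (4/5)"
        by (simp add: \<delta>_def flip: powr_add)
      also have "\<dots> \<le> (m / 2) * \<tau> powr (4/5)"
        using m2 by (intro mult_right_mono) auto
      finally have "norm (zeta_reg ?s' - zeta_reg s) \<le> (m / 2) * \<tau> powr (4/5)"
        using C(1) by (auto simp: mult_left_mono)
      with A norm_triangle_ineq2[of "zeta_reg ?s'" "zeta_reg s"] show ?thesis
        by (simp add: field_simps)
    qed
    moreover have "c * \<tau> powr (4/5) \<le> (m / 2) * \<tau> powr (4/5)" using c by (intro mult_right_mono) auto
    ultimately show ?thesis by (simp add: \<tau>_def t_def)
  qed
  then show ?thesis using c r by blast
qed

text \<open>This is what remains of the Perron integrand, apart from x^s, once the pole of the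
  logarithmic derivative at 1 is split off. The factor 1 / (s (s + 1)) belongs to the weight 1 - n /
  x.\<close>

definition pnt_kernel :: "complex \<Rightarrow> complex" where
  "pnt_kernel s = - (deriv zeta_reg s / zeta_reg s) / (s * (s + 1))"

text \<open>Quotients of derivatives by \<open>zeta_reg\<close> have exponent 21/20 - 4/5 = 1/4; the
  square in the derivative of the logarithmic derivative doubles it to 1/2, and 1 / (s (s + 1))
  contributes -2.\<close>

lemma pnt_kernel_bounds:
  "\<exists>C>0. \<exists>r>0. r \<le> 1 \<and> (\<forall>s. 1 < Re s \<and> Re s \<le> 1 + r \<longrightarrow>
     norm (pnt_kernel s) \<le> C * (1 + \<bar>Im s\<bar>) powr (-3/2) \<and>
     norm (deriv pnt_kernel s) \<le> C * (1 + \<bar>Im s\<bar>) powr (-3/2))"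
proof -
  obtain C where C: "C \<ge> 1" "\<And>s j. 1 \<le> Re s \<Longrightarrow> Re s \<le> 2 \<Longrightarrow> j \<le> 2 \<Longrightarrow>
      norm ((deriv ^^ j) zeta_reg s) \<le> C * (1 + \<bar>Im s\<bar>) powr (21/20)"
    using zeta_reg_deriv_growth by blast
  obtain c r where c: "c > 0" and r: "r > 0" "r \<le> 1" and
    lower: "\<And>s. 1 < Re s \<Longrightarrow> Re s \<le> 1 + r \<Longrightarrow> norm (zeta_reg s) \<ge> c * (1 + \<bar>Im s\<bar>) powr (4/5)"
    using zeta_reg_lower_bound by blast
  define D where "D = C / c"
  have D: "D > 0" using C(1) c by (simp add: D_def)
  have "norm (pnt_kernel s) \<le> (16 * D + 16 * D\<^sup>2) * (1 + \<bar>Im s\<bar>) powr (-3/2) \<and>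
     norm (deriv pnt_kernel s) \<le> (16 * D + 16 * D\<^sup>2) * (1 + \<bar>Im s\<bar>) powr (-3/2)"
    if s: "1 < Re s" "Re s \<le> 1 + r" for s
  proof -
    define \<tau> where "\<tau> = 1 + \<bar>Im s\<bar>"
    have \<tau>1: "\<tau> \<ge> 1" by (simp add: \<tau>_def)
    let ?B = "zeta_reg s" and ?B1 = "deriv zeta_reg s" and ?B2 = "deriv (deriv zeta_reg) s"
    have nz: "?B \<noteq> 0" using zeta_reg_log_deriv(1) s by simp
    have s0: "s \<noteq> 0" "s + 1 \<noteq> 0" using s by (auto simp: complex_eq_iff)
    have quot: "norm (b / ?B) \<le> D * \<tau> powr (1/4)" if "norm b \<le> C * \<tau> powr (21/20)" for b
    proof -
      have "norm (b / ?B) \<le> (C * \<tau> powr (21/20)) / (c * \<tau> powr (4/5))"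
        unfolding norm_divide using that lower[OF s] c \<tau>1 C(1) by (intro frac_le) (auto simp: \<tau>_def)
      also have "\<dots> = D * (\<tau> powr (21/20) / \<tau> powr (4/5))" by (simp add: D_def)
      also have "\<tau> powr (21/20) / \<tau> powr (4/5) = \<tau> powr (1/4)" by (simp flip: powr_diff)
      finally show ?thesis .
    qed
    have q1: "norm (?B1 / ?B) \<le> D * \<tau> powr (1/4)"
      using C(2)[of s 1] s r by (intro quot) (auto simp: \<tau>_def)
    have q2: "norm (?B2 / ?B) \<le> D * \<tau> powr (1/4)"
      using C(2)[of s 2] s r by (intro quot) (auto simp: \<tau>_def numeral_2_eq_2)
    have ns: "norm s \<ge> \<tau> / 2" using abs_Im_le_cmod[of s] complex_Re_le_cmod[of s] s by (simp add: \<tau>_def)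
    have ns1: "norm (s + 1) \<ge> \<tau> / 2" using abs_Im_le_cmod[of "s+1"] complex_Re_le_cmod[of "s+1"] s by (simp add: \<tau>_def)
    have ns2: "norm (s + 1) \<ge> 1" using complex_Re_le_cmod[of "s+1"] s by simp
    have inv: "1 / norm (s * (s + 1)) \<le> 4 * \<tau> powr (-2)"
    proof -
      have "(\<tau> / 2) * (\<tau> / 2) \<le> norm (s * (s + 1))"
        unfolding norm_mult using ns ns1 \<tau>1 by (intro mult_mono) auto
      then have "1 / norm (s * (s + 1)) \<le> 1 / ((\<tau> / 2) * (\<tau> / 2))"
        using \<tau>1 by (intro frac_le) auto
      then show ?thesis using \<tau>1 by (simp add: powr_minus powr_realpow power2_eq_square field_simps)
    qed
    have inv2: "norm ((2 * s + 1) / (s * (s + 1))\<^sup>2) \<le> 12 * \<tau> powr (-2)"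
    proof -
      have "norm (2 * s + 1) = norm (2 * (s + 1) - 1)" by (simp add: algebra_simps)
      also have "\<dots> \<le> 3 * norm (s + 1)"
        using norm_triangle_ineq4[of "2 * (s + 1)" 1] ns2 by (simp only: norm_mult norm_one norm_numeral)
      finally have "norm ((2 * s + 1) / (s * (s + 1))\<^sup>2) \<le> 3 * norm (s + 1) / (norm s * norm (s + 1))\<^sup>2"
        unfolding norm_divide norm_power norm_mult by (intro divide_right_mono) auto
      also have "\<dots> = 3 / ((norm s)\<^sup>2 * norm (s + 1))"
        using s0 by (simp add: power2_eq_square field_simps)
      also have "\<dots> \<le> 3 / ((\<tau> / 2)\<^sup>2 * 1)"
        using ns ns2 \<tau>1 by (intro frac_le mult_mono power_mono) auto
      finally show ?thesis using \<tau>1 by (simp add: powr_minus powr_realpow power2_eq_square field_simps)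
    qed
    \<comment> \<open>Weakening 1/4 to 1/2, the exponent of the squared quotient, gives all terms
      the common exponent 1/2 - 2 = -3/2.\<close>
    have p12: "\<tau> powr (1/4) \<le> \<tau> powr (1/2)" using \<tau>1 by (intro powr_mono) auto
    have p32: "\<tau> powr (1/2) * \<tau> powr (-2) = \<tau> powr (-3/2)" by (simp flip: powr_add)
    have q1': "norm (?B1 / ?B) \<le> D * \<tau> powr (1/2)"
      using q1 mult_left_mono[OF p12, of D] D by linarith
    have "norm (pnt_kernel s) = norm (?B1 / ?B) * (1 / norm (s * (s + 1)))"
      by (simp add: pnt_kernel_def norm_divide norm_mult)
    also have "\<dots> \<le> (D * \<tau> powr (1/2)) * (4 * \<tau> powr (-2))"
      using D by (intro mult_mono[OF q1' inv]) auto
    also have "\<dots> = 4 * D * \<tau> powr (-3/2)" unfolding p32[symmetric] by simp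
    also have "\<dots> \<le> (16 * D + 16 * D\<^sup>2) * \<tau> powr (-3/2)" using D by (intro mult_right_mono) auto
    finally have R1: "norm (pnt_kernel s) \<le> (16 * D + 16 * D\<^sup>2) * \<tau> powr (-3/2)" .
    let ?K' = "(- (?B2 / ?B) + (?B1 / ?B)\<^sup>2) / (s * (s + 1)) + (?B1 / ?B) * ((2 * s + 1) / (s * (s + 1))\<^sup>2)"
    have "(pnt_kernel has_field_derivative ?K') (at s)"
    proof -
      have d1: "((\<lambda>s. deriv zeta_reg s / zeta_reg s) has_field_derivative
          (?B2 * ?B - ?B1 * ?B1) / (?B * ?B)) (at s)"
        using s by (intro DERIV_divide has_field_derivative_zeta_reg has_field_derivative_deriv_zeta_reg nz) auto
      have d2: "((\<lambda>s. s * (s + 1)) has_field_derivative (2 * s + 1)) (at s)"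
        by (auto intro!: derivative_eq_intros)
      have "(pnt_kernel has_field_derivative (- ((?B2 * ?B - ?B1 * ?B1) / (?B * ?B)) * (s * (s + 1)) -
         (- (?B1 / ?B)) * (2 * s + 1)) / ((s * (s + 1)) * (s * (s + 1)))) (at s)"
        unfolding pnt_kernel_def[abs_def] using s0 by (intro DERIV_divide DERIV_minus d1 d2) auto
      moreover have "(- ((?B2 * ?B - ?B1 * ?B1) / (?B * ?B)) * (s * (s + 1)) -
         (- (?B1 / ?B)) * (2 * s + 1)) / ((s * (s + 1)) * (s * (s + 1))) = ?K'"
      proof -
        have G: "(- (u - v) * P - (- q) * m) / (P * P) = (- u + v) / P + q * (m / P\<^sup>2)" if "P \<noteq> 0" for u v q P m :: complex
          using that by (simp add: field_simps power2_eq_square)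
        have E: "(?B2 * ?B - ?B1 * ?B1) / (?B * ?B) = ?B2 / ?B - (?B1 / ?B)\<^sup>2"
          using nz by (simp add: field_simps power2_eq_square)
        have "s * (s + 1) \<noteq> 0" using s0 by simp
        then show ?thesis unfolding E by (rule G)
      qed
      ultimately show ?thesis by simp
    qed
    then have "deriv pnt_kernel s = ?K'" by (rule DERIV_imp_deriv)
    then have "norm (deriv pnt_kernel s) \<le> norm (- (?B2 / ?B) + (?B1 / ?B)\<^sup>2) * (1 / norm (s * (s + 1)))
        + norm (?B1 / ?B) * norm ((2 * s + 1) / (s * (s + 1))\<^sup>2)"
      by (simp only:) (rule order_trans[OF norm_triangle_ineq], simp add: norm_divide norm_mult)
    also have "\<dots> \<le> (D * \<tau> powr (1/2) + D\<^sup>2 * \<tau> powr (1/2)) * (4 * \<tau> powr (-2)) + (D * \<tau> powr (1/2)) * (12 * \<tau> powr (-2))"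
    proof (intro add_mono mult_mono inv inv2 q1')
      have "norm (- (?B2 / ?B) + (?B1 / ?B)\<^sup>2) \<le> norm (?B2 / ?B) + (norm (?B1 / ?B))\<^sup>2"
        by (rule order_trans[OF norm_triangle_ineq]) (simp add: norm_power)
      also have "\<dots> \<le> D * \<tau> powr (1/4) + (D * \<tau> powr (1/4))\<^sup>2"
        using q1 q2 by (intro add_mono power_mono) auto
      also have "(D * \<tau> powr (1/4))\<^sup>2 = D\<^sup>2 * \<tau> powr (1/2)"
        using \<tau>1 by (simp add: power_mult_distrib power2_eq_square flip: powr_add)
      also have "D * \<tau> powr (1/4) \<le> D * \<tau> powr (1/2)" using p12 D by simp
      finally show "norm (- (?B2 / ?B) + (?B1 / ?B)\<^sup>2) \<le> D * \<tau> powr (1/2) + D\<^sup>2 * \<tau> powr (1/2)" by simp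
    qed (use D in auto)
    also have "\<dots> = (16 * D + 4 * D\<^sup>2) * \<tau> powr (-3/2)" unfolding p32[symmetric] by (simp add: algebra_simps)
    also have "\<dots> \<le> (16 * D + 16 * D\<^sup>2) * \<tau> powr (-3/2)" by (intro mult_right_mono) auto
    finally show ?thesis using R1 by (simp add: \<tau>_def)
  qed
  moreover have "16 * D + 16 * D\<^sup>2 > 0" using D by (simp add: add_pos_pos)
  ultimately show ?thesis using r by blast
qed

lemma holomorphic_pnt_kernel: "pnt_kernel holomorphic_on {s. Re s > 1}"
proof -
  have "zeta_reg holomorphic_on {s. Re s > 1}" "deriv zeta_reg holomorphic_on {s. Re s > 1}"
    using holomorphic_zeta_reg holomorphic_deriv[OF holomorphic_zeta_reg open_halfspace_Re_gt]
    by (auto elim!: holomorphic_on_subset)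
  moreover have "s * (s + 1) \<noteq> 0" if "Re s > 1" for s
  proof -
    have "s \<noteq> 0" "s + 1 \<noteq> 0" using that by (auto simp: complex_eq_iff)
    then show ?thesis by simp
  qed
  ultimately show ?thesis unfolding pnt_kernel_def[abs_def]
    by (intro holomorphic_on_divide holomorphic_on_minus holomorphic_intros)
       (auto simp: zeta_reg_log_deriv open_halfspace_Re_gt)
qed

section \<open>Perron's formula and the smoothed prime number theorem\<close>

abbreviation vline :: "real \<Rightarrow> real \<Rightarrow> real \<Rightarrow> complex" where
  "vline c R \<equiv> linepath (Complex c (-R)) (Complex c R)"

lemma path_image_vline:
  assumes "R \<ge> 0"
  shows "path_image (vline c R) = {s. Re s = c \<and> \<bar>Im s\<bar> \<le> R}"
proof -
  have "closed_segment (Complex c (-R)) (Complex c R) = {s. Re s = c \<and> \<bar>Im s\<bar> \<le> R}"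
    using assms by (subst closed_segment_same_Re) (auto simp: closed_segment_eq_real_ivl)
  then show ?thesis by simp
qed

lemma contour_integral_rectpath_sides:
  assumes "continuous_on (path_image (rectpath a1 a3)) f"
  defines "a2 \<equiv> Complex (Re a3) (Im a1)" and "a4 \<equiv> Complex (Re a1) (Im a3)"
  shows "contour_integral (rectpath a1 a3) f = contour_integral (linepath a1 a2) f +
     contour_integral (linepath a2 a3) f + contour_integral (linepath a3 a4) f + contour_integral (linepath a4 a1) f"
    and "f contour_integrable_on linepath a1 a2" "f contour_integrable_on linepath a2 a3"
      "f contour_integrable_on linepath a3 a4" "f contour_integrable_on linepath a4 a1"
proof -
  have pi: "path_image (rectpath a1 a3) = closed_segment a1 a2 \<union> closed_segment a2 a3 \<union>
      closed_segment a3 a4 \<union> closed_segment a4 a1"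
    by (simp add: rectpath_def Let_def a2_def a4_def path_image_join Un_assoc)
  show i: "f contour_integrable_on linepath a1 a2" "f contour_integrable_on linepath a2 a3"
      "f contour_integrable_on linepath a3 a4" "f contour_integrable_on linepath a4 a1"
    using assms(1) unfolding pi by (auto intro!: contour_integrable_continuous_linepath elim: continuous_on_subset)
  show "contour_integral (rectpath a1 a3) f = contour_integral (linepath a1 a2) f +
     contour_integral (linepath a2 a3) f + contour_integral (linepath a3 a4) f + contour_integral (linepath a4 a1) f"
    using i unfolding rectpath_def Let_def a2_def[symmetric] a4_def[symmetric]
    by (simp add: contour_integral_join contour_integrable_joinI valid_path_join)
qed

text \<open>The rectangle has width R and height 2 R, so the three sides other than the segment have
  total length 4 R.\<close>

lemma vline_integral_shift_left:
  assumes R: "R \<ge> 0" and M: "M \<ge> 0"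
    and V: "(f has_contour_integral V) (rectpath (Complex (c - R) (-R)) (Complex c R))"
    and cont: "continuous_on (path_image (rectpath (Complex (c - R) (-R)) (Complex c R))) f"
    and bd: "\<And>s. Re s \<le> c \<Longrightarrow> \<bar>Im s\<bar> = R \<or> Re s = c - R \<Longrightarrow> norm (f s) \<le> M"
  shows "norm (contour_integral (vline c R) f - V) \<le> M * (4 * R)"
proof -
  let ?a1 = "Complex (c - R) (-R)" and ?a2 = "Complex c (-R)" and ?a3 = "Complex c R" and ?a4 = "Complex (c - R) R"
  note sides = contour_integral_rectpath_sides[OF cont, simplified]
  have V': "V = contour_integral (linepath ?a1 ?a2) f + contour_integral (vline c R) f +
      contour_integral (linepath ?a3 ?a4) f + contour_integral (linepath ?a4 ?a1) f"
    using contour_integral_unique[OF V] sides(1) by simp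
  have n1: "norm (contour_integral (linepath ?a1 ?a2) f) \<le> M * norm (?a2 - ?a1)"
    using R by (intro contour_integral_bound_linepath sides M bd)
      (auto simp: closed_segment_same_Im closed_segment_eq_real_ivl)
  have n2: "norm (contour_integral (linepath ?a3 ?a4) f) \<le> M * norm (?a4 - ?a3)"
    using R by (intro contour_integral_bound_linepath sides M bd)
      (auto simp: closed_segment_same_Im closed_segment_eq_real_ivl split: if_splits)
  have n3: "norm (contour_integral (linepath ?a4 ?a1) f) \<le> M * norm (?a1 - ?a4)"
    using R by (intro contour_integral_bound_linepath sides M bd)
      (auto simp: closed_segment_same_Re closed_segment_eq_real_ivl split: if_splits)
  have "norm (?a2 - ?a1) = R" "norm (?a4 - ?a3) = R" "norm (?a1 - ?a4) = 2 * R"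
    using R by (auto simp: cmod_def real_sqrt_mult)
  with n1 n2 n3 have "norm (contour_integral (linepath ?a1 ?a2) f) \<le> M * R"
    "norm (contour_integral (linepath ?a3 ?a4) f) \<le> M * R"
    "norm (contour_integral (linepath ?a4 ?a1) f) \<le> M * (2 * R)" by simp_all
  moreover have "norm (contour_integral (vline c R) f - V) \<le> norm (contour_integral (linepath ?a1 ?a2) f) +
      norm (contour_integral (linepath ?a3 ?a4) f) + norm (contour_integral (linepath ?a4 ?a1) f)"
  proof -
    have "contour_integral (vline c R) f - V = - (contour_integral (linepath ?a1 ?a2) f +
      contour_integral (linepath ?a3 ?a4) f + contour_integral (linepath ?a4 ?a1) f)"
      unfolding V' by simp
    then show ?thesis
      by (simp only: norm_minus_cancel) (rule order_trans[OF norm_triangle_ineq add_right_mono[OF norm_triangle_ineq]])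
  qed
  ultimately show ?thesis by (simp add: algebra_simps)
qed

lemma vline_integral_shift_right:
  assumes R: "R \<ge> 0" and M: "M \<ge> 0"
    and V: "(f has_contour_integral 0) (rectpath (Complex c (-R)) (Complex (c + R) R))"
    and cont: "continuous_on (path_image (rectpath (Complex c (-R)) (Complex (c + R) R))) f"
    and bd: "\<And>s. Re s \<ge> c \<Longrightarrow> \<bar>Im s\<bar> = R \<or> Re s = c + R \<Longrightarrow> norm (f s) \<le> M"
  shows "norm (contour_integral (vline c R) f) \<le> M * (4 * R)"
proof -
  let ?a1 = "Complex c (-R)" and ?a2 = "Complex (c + R) (-R)" and ?a3 = "Complex (c + R) R" and ?a4 = "Complex c R"
  note sides = contour_integral_rectpath_sides[OF cont, simplified]
  have rev: "contour_integral (linepath ?a4 ?a1) f = - contour_integral (vline c R) f"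
    using contour_integral_reversepath[of "vline c R" f] by simp
  have V': "contour_integral (vline c R) f = contour_integral (linepath ?a1 ?a2) f +
      contour_integral (linepath ?a2 ?a3) f + contour_integral (linepath ?a3 ?a4) f"
    using contour_integral_unique[OF V] sides(1) rev by simp
  have n1: "norm (contour_integral (linepath ?a1 ?a2) f) \<le> M * norm (?a2 - ?a1)"
    using R by (intro contour_integral_bound_linepath sides M bd)
      (auto simp: closed_segment_same_Im closed_segment_eq_real_ivl)
  have n2: "norm (contour_integral (linepath ?a2 ?a3) f) \<le> M * norm (?a3 - ?a2)"
    using R by (intro contour_integral_bound_linepath sides M bd)
      (auto simp: closed_segment_same_Re closed_segment_eq_real_ivl split: if_splits)
  have n3: "norm (contour_integral (linepath ?a3 ?a4) f) \<le> M * norm (?a4 - ?a3)"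
    using R by (intro contour_integral_bound_linepath sides M bd)
      (auto simp: closed_segment_same_Im closed_segment_eq_real_ivl split: if_splits)
  have "norm (?a2 - ?a1) = R" "norm (?a3 - ?a2) = 2 * R" "norm (?a4 - ?a3) = R"
    using R by (auto simp: cmod_def real_sqrt_mult)
  with n1 n2 n3 have "norm (contour_integral (linepath ?a1 ?a2) f) \<le> M * R"
    "norm (contour_integral (linepath ?a2 ?a3) f) \<le> M * (2 * R)"
    "norm (contour_integral (linepath ?a3 ?a4) f) \<le> M * R" by simp_all
  moreover have "norm (contour_integral (vline c R) f) \<le> norm (contour_integral (linepath ?a1 ?a2) f) +
      norm (contour_integral (linepath ?a2 ?a3) f) + norm (contour_integral (linepath ?a3 ?a4) f)"
    unfolding V' by (rule order_trans[OF norm_triangle_ineq add_right_mono[OF norm_triangle_ineq]])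
  ultimately show ?thesis by (simp add: algebra_simps)
qed

text \<open>The value is the sum of the residues at 1, 0 and -1; for u \<ge> 0 the exponential stays
  bounded to the left. The assumed decay of order R^(-2) holds for both kernels below because their
  three residues at \<open>u = 0\<close> add up to 0, and against a length of 4 R it leaves O(1 /
  R).\<close>

lemma partial_fraction_vline_integral:
  fixes \<alpha> \<beta> \<gamma> :: complex
  assumes c: "1 < c" "c \<le> 2" and R: "R \<ge> 6" and u: "u \<ge> 0"
    and h: "h = (\<lambda>s. \<alpha> / (s - 1) + \<beta> / s + \<gamma> / (s + 1))"
    and bd: "\<And>s. norm (s - 1) \<ge> R / 2 \<Longrightarrow> norm s \<ge> R / 2 \<Longrightarrow> norm (s + 1) \<ge> R / 2 \<Longrightarrow> norm (h s) \<le> 4 / R\<^sup>2"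
  shows "norm (contour_integral (vline c R) (\<lambda>s. exp (of_real u * s) * h s)
           - 2 * of_real pi * \<i> * (\<alpha> * of_real (exp u) + \<beta> + \<gamma> * of_real (exp (-u)))) \<le> 16 * exp (u * c) / R"
proof -
  let ?f = "\<lambda>s. exp (of_real u * s) * h s"
  let ?p = "rectpath (Complex (c - R) (-R)) (Complex c R)"
  have pi: "path_image ?p \<subseteq> UNIV - {z}" if "z \<in> {-1, 0, 1}" for z
    using that c R by (subst path_image_rectpath) (auto simp: complex_eq_iff)
  have cauchy: "((\<lambda>w. exp (of_real u * w) / (w - z)) has_contour_integral (2 * of_real pi * \<i> * exp (of_real u * z))) ?p"
    if z: "z \<in> {-1, 0, 1}" for z :: complex
  proof -
    have hol: "(\<lambda>w. exp (of_real u * w)) holomorphic_on UNIV" by (intro holomorphic_intros)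
    have "winding_number ?p z = 1"
      using z c R by (intro winding_number_rectpath) (auto simp: in_box_complex_iff)
    moreover have "((\<lambda>w. exp (of_real u * w) / (w - z)) has_contour_integral
        (2 * of_real pi * \<i> * winding_number ?p z * exp (of_real u * z))) ?p"
      using Cauchy_integral_formula_convex_simple[of UNIV "\<lambda>w. exp (of_real u * w)" z ?p] pi[OF z] hol by simp
    ultimately show ?thesis by simp
  qed
  have "((\<lambda>s. \<alpha> * (exp (of_real u * s) / (s - 1)) + \<beta> * (exp (of_real u * s) / (s - 0)) + \<gamma> * (exp (of_real u * s) / (s - (-1))))
     has_contour_integral (\<alpha> * (2 * of_real pi * \<i> * exp (of_real u * 1)) + \<beta> * (2 * of_real pi * \<i> * exp (of_real u * 0))
       + \<gamma> * (2 * of_real pi * \<i> * exp (of_real u * (-1))))) ?p"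
    by (intro has_contour_integral_add has_contour_integral_lmul cauchy) auto
  also have "(\<lambda>s. \<alpha> * (exp (of_real u * s) / (s - 1)) + \<beta> * (exp (of_real u * s) / (s - 0)) + \<gamma> * (exp (of_real u * s) / (s - (-1)))) = ?f"
    by (simp add: h fun_eq_iff algebra_simps)
  also have "\<alpha> * (2 * of_real pi * \<i> * exp (of_real u * 1)) + \<beta> * (2 * of_real pi * \<i> * exp (of_real u * 0))
       + \<gamma> * (2 * of_real pi * \<i> * exp (of_real u * (-1))) =
      2 * of_real pi * \<i> * (\<alpha> * of_real (exp u) + \<beta> + \<gamma> * of_real (exp (-u)))"
    by (simp add: algebra_simps exp_of_real[symmetric] flip: of_real_minus)
  finally have V: "(?f has_contour_integral 2 * of_real pi * \<i> * (\<alpha> * of_real (exp u) + \<beta> + \<gamma> * of_real (exp (-u)))) ?p" .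
  have cont: "continuous_on (path_image ?p) ?f"
    unfolding h using pi[of "-1"] pi[of 0] pi[of 1]
    by (intro continuous_intros) (auto simp: eq_neg_iff_add_eq_0[symmetric])
  have "norm (contour_integral (vline c R) ?f - 2 * of_real pi * \<i> * (\<alpha> * of_real (exp u) + \<beta> + \<gamma> * of_real (exp (-u))))
      \<le> (exp (u * c) * (4 / R\<^sup>2)) * (4 * R)"
  proof (rule vline_integral_shift_left[OF _ _ V cont])
    fix s assume s: "Re s \<le> c" "\<bar>Im s\<bar> = R \<or> Re s = c - R"
    have "norm (h s) \<le> 4 / R\<^sup>2"
    proof (rule bd)
      \<comment> \<open>On the left side the nearest pole is -1, at horizontal distance R - c - 1,
        which is at least R / 2 because c \<le> 2 and R \<ge> 6.\<close>
      have *: "\<bar>Im s\<bar> = R \<or> (\<bar>Re (s - 1)\<bar> \<ge> R / 2 \<and> \<bar>Re s\<bar> \<ge> R / 2 \<and> \<bar>Re (s + 1)\<bar> \<ge> R / 2)" 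
        using s(2) c R by auto
      show "norm (s - 1) \<ge> R / 2" using * R abs_Re_le_cmod[of "s - 1"] abs_Im_le_cmod[of "s - 1"] by auto
      show "norm s \<ge> R / 2" using * R abs_Re_le_cmod[of s] abs_Im_le_cmod[of s] by auto
      show "norm (s + 1) \<ge> R / 2" using * R abs_Re_le_cmod[of "s + 1"] abs_Im_le_cmod[of "s + 1"] by auto
    qed
    moreover have "norm (exp (of_real u * s)) \<le> exp (u * c)"
      using s(1) u by (simp add: norm_exp_eq_Re mult_left_mono)
    ultimately show "norm (exp (of_real u * s) * h s) \<le> exp (u * c) * (4 / R\<^sup>2)"
      unfolding norm_mult by (intro mult_mono) auto
  qed (use R in auto)
  also have "\<dots> = 16 * exp (u * c) / R" using R by (simp add: power2_eq_square)
  finally show ?thesis .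
qed

text \<open>The kernel is 1 / s - 1 / (s + 1). For u = ln (x / n) its residue sum 1 - exp (-u) is
  the weight 1 - n / x.\<close>

lemma perron_kernel_pos:
  assumes c: "1 < c" "c \<le> 2" and R: "R \<ge> 6" and u: "u \<ge> 0"
  shows "norm (contour_integral (vline c R) (\<lambda>s. exp (of_real u * s) / (s * (s + 1)))
           - 2 * of_real pi * \<i> * of_real (1 - exp (-u))) \<le> 16 * exp (u * c) / R"
proof -
  define h :: "complex \<Rightarrow> complex" where "h = (\<lambda>s. 0 / (s - 1) + 1 / s + (-1) / (s + 1))"
  have h: "h s = 1 / (s * (s + 1))" if "s \<noteq> 0" "s + 1 \<noteq> 0" for s
    using that unfolding h_def by (simp add: divide_simps)
  have *: "norm (h s) \<le> 4 / R\<^sup>2" if s: "norm s \<ge> R / 2" "norm (s + 1) \<ge> R / 2" for s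
  proof -
    have "s \<noteq> 0" "s + 1 \<noteq> 0" using s R by auto
    then have "norm (h s) = 1 / (norm s * norm (s + 1))" using h[of s] by (simp add: norm_divide norm_mult)
    also have "\<dots> \<le> 1 / ((R / 2) * (R / 2))"
      using s R by (intro divide_left_mono mult_mono) (auto intro!: mult_pos_pos)
    finally show ?thesis by (simp add: power2_eq_square)
  qed
  have "norm (contour_integral (vline c R) (\<lambda>s. exp (of_real u * s) * h s)
           - 2 * of_real pi * \<i> * (0 * of_real (exp u) + 1 + (-1) * of_real (exp (-u)))) \<le> 16 * exp (u * c) / R"
    by (rule partial_fraction_vline_integral[OF c R u h_def *])
  also have "contour_integral (vline c R) (\<lambda>s. exp (of_real u * s) * h s) =
      contour_integral (vline c R) (\<lambda>s. exp (of_real u * s) / (s * (s + 1)))"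
  proof (rule contour_integral_cong)
    fix s assume "s \<in> path_image (vline c R)"
    then have "Re s = c" using R by (subst (asm) path_image_vline) auto
    then have "s \<noteq> 0" "s + 1 \<noteq> 0" using c by (auto simp: complex_eq_iff)
    then show "exp (of_real u * s) * h s = exp (of_real u * s) / (s * (s + 1))" using h[of s] by simp
  qed auto
  finally show ?thesis by simp
qed

text \<open>For u \<le> 0 the contour closes to the right, where there is no pole; this produces the
  cutoff at n \<le> x.\<close>

lemma perron_kernel_neg:
  assumes c: "1 < c" "c \<le> 2" and R: "R \<ge> 6" and u: "u \<le> 0"
  shows "norm (contour_integral (vline c R) (\<lambda>s. exp (of_real u * s) / (s * (s + 1)))) \<le> 16 * exp (u * c) / R"
proof -
  let ?f = "\<lambda>s. exp (of_real u * s) / (s * (s + 1))"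
  let ?p = "rectpath (Complex c (-R)) (Complex (c + R) R)"
  have sub: "path_image ?p \<subseteq> {s. Re s > 0}"
    using c R by (subst path_image_rectpath) auto
  have hol: "?f holomorphic_on {s. Re s > 0}"
  proof (intro holomorphic_intros)
    fix s :: complex assume "s \<in> {s. Re s > 0}"
    then have "s \<noteq> 0" "s + 1 \<noteq> 0" by (auto simp: complex_eq_iff)
    then show "s * (s + 1) \<noteq> 0" by simp
  qed
  have "norm (contour_integral (vline c R) ?f) \<le> (exp (u * c) * (4 / R\<^sup>2)) * (4 * R)"
  proof (rule vline_integral_shift_right)
    show "(?f has_contour_integral 0) ?p"
      by (rule Cauchy_theorem_convex_simple[OF hol convex_halfspace_Re_gt _ sub]) auto
    show "continuous_on (path_image ?p) ?f"
      using holomorphic_on_imp_continuous_on[OF holomorphic_on_subset[OF hol sub]] .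
    fix s assume s: "Re s \<ge> c" "\<bar>Im s\<bar> = R \<or> Re s = c + R"
    have *: "\<bar>Im s\<bar> = R \<or> (\<bar>Re s\<bar> \<ge> R / 2 \<and> \<bar>Re (s + 1)\<bar> \<ge> R / 2)" 
      using s(2) c R by auto
    have n: "norm s \<ge> R / 2" using * R abs_Re_le_cmod[of s] abs_Im_le_cmod[of s] by auto
    have n1: "norm (s + 1) \<ge> R / 2" using * R abs_Re_le_cmod[of "s + 1"] abs_Im_le_cmod[of "s + 1"] by auto
    have "norm (?f s) = norm (exp (of_real u * s)) * (1 / (norm s * norm (s + 1)))"
      by (simp add: norm_divide norm_mult)
    also have "\<dots> \<le> exp (u * c) * (1 / ((R / 2) * (R / 2)))"
    proof (intro mult_mono)
      show "norm (exp (of_real u * s)) \<le> exp (u * c)"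
        using s(1) u by (simp add: norm_exp_eq_Re mult_left_mono_neg)
      show "1 / (norm s * norm (s + 1)) \<le> 1 / ((R / 2) * (R / 2))"
        using n n1 R by (intro divide_left_mono mult_mono) (auto intro!: mult_pos_pos)
    qed auto
    finally show "norm (?f s) \<le> exp (u * c) * (4 / R\<^sup>2)" by (simp add: power2_eq_square)
  qed (use R in auto)
  also have "\<dots> = 16 * exp (u * c) / R" using R by (simp add: power2_eq_square)
  finally show ?thesis .
qed

text \<open>The residues at 1, 0 and -1 carry the coefficients 1/2, -1 and 1/2. With u = ln x this
  is the main term x / 2 - 1 + 1 / (2 x).\<close>

lemma pole_kernel_integral:
  assumes c: "1 < c" "c \<le> 2" and R: "R \<ge> 6" and u: "u \<ge> 0"
  shows "norm (contour_integral (vline c R) (\<lambda>s. exp (of_real u * s) / ((s - 1) * s * (s + 1)))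
           - 2 * of_real pi * \<i> * of_real (exp u / 2 - 1 + exp (-u) / 2)) \<le> 16 * exp (u * c) / R"
proof -
  define h :: "complex \<Rightarrow> complex" where "h = (\<lambda>s. (1/2) / (s - 1) + (-1) / s + (1/2) / (s + 1))"
  have h: "h s = 1 / ((s - 1) * s * (s + 1))" if "s - 1 \<noteq> 0" "s \<noteq> 0" "s + 1 \<noteq> 0" for s
  proof -
    have G: "(A + B + C) * (p * q * r) = A * p * (q * r) + B * q * (p * r) + C * r * (p * q)" for A B C p q r :: complex
      by (simp add: algebra_simps)
    have D: "a / p * p = a" if "p \<noteq> 0" for a p :: complex using that by simp
    have "h s * ((s - 1) * s * (s + 1)) = (1/2) / (s - 1) * (s - 1) * (s * (s + 1)) + (-1) / s * s * ((s - 1) * (s + 1))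
        + (1/2) / (s + 1) * (s + 1) * ((s - 1) * s)"
      unfolding h_def by (rule G)
    also have "\<dots> = (1/2) * (s * (s + 1)) + (-1) * ((s - 1) * (s + 1)) + (1/2) * ((s - 1) * s)"
      by (simp only: D[OF that(1)] D[OF that(2)] D[OF that(3)])
    also have "\<dots> = 1" by (simp add: field_simps)
    finally show ?thesis using that by (simp add: nonzero_eq_divide_eq)
  qed
  have *: "norm (h s) \<le> 4 / R\<^sup>2" if s: "norm (s - 1) \<ge> R / 2" "norm s \<ge> R / 2" "norm (s + 1) \<ge> R / 2" for s
  proof -
    have "s - 1 \<noteq> 0" "s \<noteq> 0" "s + 1 \<noteq> 0" using s R by auto
    then have "norm (h s) = 1 / (norm (s - 1) * norm s * norm (s + 1))" using h[of s] by (simp add: norm_divide norm_mult)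
    \<comment> \<open>One of the three factors is bounded below only by 1, which already gives the
      required R^(-2).\<close>
    also have "\<dots> \<le> 1 / (1 * (R / 2) * (R / 2))"
      using s R by (intro divide_left_mono mult_mono) (auto intro!: mult_pos_pos)
    finally show ?thesis by (simp add: power2_eq_square)
  qed
  have "norm (contour_integral (vline c R) (\<lambda>s. exp (of_real u * s) * h s)
           - 2 * of_real pi * \<i> * (1/2 * of_real (exp u) + (-1) + 1/2 * of_real (exp (-u)))) \<le> 16 * exp (u * c) / R"
    by (rule partial_fraction_vline_integral[OF c R u h_def *])
  also have "contour_integral (vline c R) (\<lambda>s. exp (of_real u * s) * h s) =
      contour_integral (vline c R) (\<lambda>s. exp (of_real u * s) / ((s - 1) * s * (s + 1)))"
  proof (rule contour_integral_cong)
    fix s assume "s \<in> path_image (vline c R)"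
    then have "Re s = c" using R by (subst (asm) path_image_vline) auto
    then have "s - 1 \<noteq> 0" "s \<noteq> 0" "s + 1 \<noteq> 0" using c by (auto simp: complex_eq_iff)
    then show "exp (of_real u * s) * h s = exp (of_real u * s) / ((s - 1) * s * (s + 1))" using h[of s] by simp
  qed auto
  finally show ?thesis by simp
qed

text \<open>Since c > 1, the series converges uniformly on the segment and can be integrated term by
  term, with u = ln (x / n) in the n-th Perron integral. Only the factor 1 / R of the error matters,
  as R will tend to infinity with x fixed.\<close>

lemma perron_mangoldt:
  assumes c: "1 < c" "c \<le> 2" and R: "R \<ge> 6" and x: "x > 0"
  shows "norm (contour_integral (vline c R) (\<lambda>s. mangoldt_series s * exp (of_real (ln x) * s) / (s * (s + 1)))
     - 2 * of_real pi * \<i> * of_real (\<Sum>n\<le>nat \<lfloor>x\<rfloor>. mangoldt n * (1 - real n / x)))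
    \<le> 16 * x powr c * (\<Sum>n. \<bar>mangoldt n\<bar> * real n powr (-c)) / R"
proof -
  define \<Psi> where "\<Psi> = (\<Sum>n\<le>nat \<lfloor>x\<rfloor>. mangoldt n * (1 - real n / x))"
  define f :: "nat \<Rightarrow> complex \<Rightarrow> complex" where "f = (\<lambda>n s. of_real (mangoldt n) * (exp (of_real (ln (x / real n)) * s) / (s * (s + 1))))"
  define M where "M = (\<lambda>n. \<bar>mangoldt n\<bar> * real n powr (-c))"
  have sM: "summable M" unfolding M_def
    by (rule summable_dirichlet_real[OF mangoldt_bound c(1)])
  have M0: "M n \<ge> 0" for n by (simp add: M_def mangoldt_nonneg)
  have pi: "path_image (vline c R) = {s. Re s = c \<and> \<bar>Im s\<bar> \<le> R}" using R by (intro path_image_vline) auto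
  have seg: "Re s = c" if "s \<in> closed_segment (Complex c (-R)) (Complex c R)" for s
    using that unfolding path_image_linepath[symmetric] pi by simp
  have nz: "s \<noteq> 0" "s + 1 \<noteq> 0" if "Re s = c" for s using that c by (auto simp: complex_eq_iff)
  have exp_n: "exp (c * ln (x / real n)) = x powr c * real n powr (-c)" if "n > 0" for n
    using that x by (simp add: powr_def ln_div exp_diff exp_minus field_simps exp_add)
  have f_bound: "norm (f n s) \<le> x powr c * M n" if s: "s \<in> path_image (vline c R)" for n s
  proof (cases "n = 0")
    case False
    have Re: "Re s = c" using s unfolding pi by simp
    have "norm s \<ge> 1" "norm (s + 1) \<ge> 1" using complex_Re_le_cmod[of s] complex_Re_le_cmod[of "s+1"] Re c by auto
    then have "norm s * norm (s + 1) \<ge> 1 * 1" by (intro mult_mono) auto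
    then have "norm (exp (of_real (ln (x / real n)) * s) / (s * (s + 1))) \<le> norm (exp (of_real (ln (x / real n)) * s)) / 1"
      unfolding norm_divide norm_mult[of s] by (intro divide_left_mono) auto
    also have "\<dots> = x powr c * real n powr (-c)"
      using exp_n[of n] False Re by (simp add: norm_exp_eq_Re mult.commute)
    finally show ?thesis unfolding f_def M_def norm_mult norm_of_real
      using mult_left_mono[OF _ mangoldt_nonneg, of _ _ n] by (simp add: mult.left_commute)
  qed (simp add: f_def M_def)
  have f_int: "f n contour_integrable_on (vline c R)" for n
  proof (rule contour_integrable_continuous_linepath)
    show "continuous_on (closed_segment (Complex c (- R)) (Complex c R)) (f n)"
      unfolding f_def by (intro continuous_intros) (use seg nz in auto)
  qed
  have sums: "(\<Sum>n. f n s) = mangoldt_series s * exp (of_real (ln x) * s) / (s * (s + 1))"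
    if s: "s \<in> path_image (vline c R)" for s
  proof -
    have Re: "Re s > 1" using s c unfolding pi by simp
    have "(\<lambda>n. of_real (mangoldt n) * of_nat n powr (-s) * (exp (of_real (ln x) * s) / (s * (s + 1)))) sums
        (mangoldt_series s * (exp (of_real (ln x) * s) / (s * (s + 1))))"
      unfolding mangoldt_series_def by (intro sums_mult2 dirichlet_sums mangoldt_bound Re)
    moreover have "of_real (mangoldt n) * of_nat n powr (-s) * (exp (of_real (ln x) * s) / (s * (s + 1))) = f n s" for n
    proof (cases "n = 0")
      case False
      have "of_nat n powr (-s) * exp (of_real (ln x) * s) = exp (of_real (ln (x / real n)) * s)"
        using False x by (simp add: powr_def ln_div exp_add[symmetric] algebra_simps)
      then show ?thesis unfolding f_def by (metis (no_types, lifting) mult.assoc times_divide_eq_right)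
    qed (simp add: f_def)
    ultimately show ?thesis by (simp add: sums_iff)
  qed
  have ul: "uniform_limit (path_image (vline c R)) (\<lambda>N s. \<Sum>n<N. f n s)
      (\<lambda>s. \<Sum>n. f n s) sequentially"
    by (rule Weierstrass_m_test[where M = "\<lambda>n. x powr c * M n"]) (use f_bound sM in \<open>auto intro: summable_mult\<close>)
  have lim: "(\<lambda>N. contour_integral (vline c R) (\<lambda>s. \<Sum>n<N. f n s)) \<longlonglongrightarrow> contour_integral (vline c R) (\<lambda>s. \<Sum>n. f n s)"
  proof (rule contour_integral_uniform_limit(2)[OF _ ul])
    show "\<forall>\<^sub>F N in sequentially. (\<lambda>s. \<Sum>n<N. f n s) contour_integrable_on vline c R"
      by (intro always_eventually allI contour_integrable_sum) (auto simp: f_int)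
    show "norm (vector_derivative (vline c R) (at t)) \<le> norm (Complex c R - Complex c (-R))" for t by simp
  qed auto
  have eq: "contour_integral (vline c R) (\<lambda>s. \<Sum>n. f n s) =
      contour_integral (vline c R) (\<lambda>s. mangoldt_series s * exp (of_real (ln x) * s) / (s * (s + 1)))"
    by (rule contour_integral_cong) (auto simp: sums)
  have term_bound: "norm (contour_integral (vline c R) (f n) - 2 * of_real pi * \<i> * of_real (if real n \<le> x then mangoldt n * (1 - real n / x) else 0))
      \<le> 16 * x powr c / R * M n" for n
  proof (cases "n = 0")
    case False
    let ?u = "ln (x / real n)"
    let ?I = "contour_integral (vline c R) (\<lambda>s. exp (of_real ?u * s) / (s * (s + 1)))"
    let ?v = "if real n \<le> x then 1 - real n / x else 0"
    have "norm (?I - 2 * of_real pi * \<i> * of_real ?v) \<le> 16 * exp (?u * c) / R"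
    proof (cases "real n \<le> x")
      case True
      have "exp (- ?u) = real n / x" using False x by (simp add: exp_minus)
      then show ?thesis using perron_kernel_pos[OF c R, of ?u] True False by simp
    next
      case n: False
      have "?u \<le> 0" using n x by (subst ln_le_zero_iff) (auto simp: field_simps)
      then show ?thesis using perron_kernel_neg[OF c R, of ?u] n by simp
    qed
    also have "exp (?u * c) = x powr c * real n powr (-c)" using exp_n[of n] False by (simp add: mult.commute)
    finally have b: "norm (?I - 2 * of_real pi * \<i> * of_real ?v) \<le> 16 * (x powr c * real n powr (-c)) / R" .
    have "(\<lambda>s. exp (of_real ?u * s) / (s * (s + 1))) contour_integrable_on (vline c R)"
    proof (rule contour_integrable_continuous_linepath)
      show "continuous_on (closed_segment (Complex c (- R)) (Complex c R)) (\<lambda>s. exp (of_real ?u * s) / (s * (s + 1)))"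
        by (intro continuous_intros) (use seg nz in auto)
    qed
    then have "contour_integral (vline c R) (f n) = of_real (mangoldt n) * ?I"
      unfolding f_def by (rule contour_integral_lmul)
    then have "contour_integral (vline c R) (f n) - 2 * of_real pi * \<i> * of_real (if real n \<le> x then mangoldt n * (1 - real n / x) else 0)
       = of_real (mangoldt n) * (?I - 2 * of_real pi * \<i> * of_real ?v)"
      by (simp add: algebra_simps)
    also have "norm \<dots> \<le> \<bar>mangoldt n\<bar> * (16 * (x powr c * real n powr (-c)) / R)"
      unfolding norm_mult norm_of_real using b by (intro mult_left_mono) (auto simp: mangoldt_nonneg)
    finally show ?thesis by (simp add: M_def mult_ac)
  qed (simp add: f_def M_def)
  have partial: "norm (contour_integral (vline c R) (\<lambda>s. \<Sum>n<N. f n s) - 2 * of_real pi * \<i> * of_real \<Psi>)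
      \<le> 16 * x powr c / R * (\<Sum>n. M n)" if N: "N > nat \<lfloor>x\<rfloor>" for N
  proof -
    have "\<Psi> = (\<Sum>n<N. if real n \<le> x then mangoldt n * (1 - real n / x) else 0)"
      unfolding \<Psi>_def
    proof (rule sum.mono_neutral_cong_left)
      show "mangoldt n * (1 - real n / x) = (if real n \<le> x then mangoldt n * (1 - real n / x) else 0)"
        if "n \<in> {..nat \<lfloor>x\<rfloor>}" for n
      proof -
        have "real n \<le> x" using that x by (simp add: le_nat_iff le_floor_iff)
        then show ?thesis by simp
      qed
      show "\<forall>n\<in>{..<N} - {..nat \<lfloor>x\<rfloor>}. (if real n \<le> x then mangoldt n * (1 - real n / x) else 0) = 0"
        using x by (auto simp: not_le le_nat_floor leD)
    qed (use N in auto)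
    then have "contour_integral (vline c R) (\<lambda>s. \<Sum>n<N. f n s) - 2 * of_real pi * \<i> * of_real \<Psi> =
       (\<Sum>n<N. contour_integral (vline c R) (f n) - 2 * of_real pi * \<i> * of_real (if real n \<le> x then mangoldt n * (1 - real n / x) else 0))"
      by (simp add: contour_integral_sum f_int sum_subtractf flip: sum_distrib_left of_real_sum)
    also have "norm \<dots> \<le> (\<Sum>n<N. 16 * x powr c / R * M n)"
      by (intro sum_norm_le term_bound)
    also have "\<dots> = 16 * x powr c / R * (\<Sum>n<N. M n)" by (simp add: sum_distrib_left)
    also have "\<dots> \<le> 16 * x powr c / R * (\<Sum>n. M n)"
      using R sM M0 by (intro mult_left_mono sum_le_suminf) auto
    finally show ?thesis .
  qed
  have "norm (contour_integral (vline c R) (\<lambda>s. \<Sum>n. f n s) - 2 * of_real pi * \<i> * of_real \<Psi>)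
      \<le> 16 * x powr c / R * (\<Sum>n. M n)"
  proof (rule tendsto_upperbound)
    show "(\<lambda>N. norm (contour_integral (vline c R) (\<lambda>s. \<Sum>n<N. f n s) - 2 * of_real pi * \<i> * of_real \<Psi>)) \<longlonglongrightarrow>
       norm (contour_integral (vline c R) (\<lambda>s. \<Sum>n. f n s) - 2 * of_real pi * \<i> * of_real \<Psi>)"
      by (intro tendsto_intros lim)
    show "\<forall>\<^sub>F N in sequentially. norm (contour_integral (vline c R) (\<lambda>s. \<Sum>n<N. f n s) - 2 * of_real pi * \<i> * of_real \<Psi>)
      \<le> 16 * x powr c / R * (\<Sum>n. M n)"
      using eventually_gt_at_top[of "nat \<lfloor>x\<rfloor>"] by eventually_elim (rule partial)
  qed auto
  then show ?thesis unfolding eq \<Psi>_def M_def by simp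
qed

section \<open>The regular part and the smoothed sum of the Mangoldt function\<close>

lemma has_integral_inverse_three_halves:
  assumes "R \<ge> (0::real)"
  shows "((\<lambda>t. (1 + \<bar>t\<bar>) powr (-3/2)) has_integral (4 - 4 * (1 + R) powr (-1/2))) {-R..R}"
proof -
  have p: "((\<lambda>t. (1 + \<bar>t\<bar>) powr (-3/2)) has_integral (- 2 * (1 + R) powr (-1/2) - (- 2 * (1 + 0) powr (-1/2)))) {0..R}"
  proof (rule fundamental_theorem_of_calculus[OF assms])
    fix t assume t: "t \<in> {0..R}"
    have "((\<lambda>t. - 2 * (1 + t) powr (-1/2)) has_real_derivative (1 + \<bar>t\<bar>) powr (-3/2)) (at t within {0..R})"
      using t by (auto intro!: derivative_eq_intros simp: powr_divide field_simps)
    then show "((\<lambda>t. - 2 * (1 + t) powr (-1/2)) has_vector_derivative (1 + \<bar>t\<bar>) powr (-3/2)) (at t within {0..R})"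
      by (simp add: has_real_derivative_iff_has_vector_derivative)
  qed
  have n: "((\<lambda>t. (1 + \<bar>t\<bar>) powr (-3/2)) has_integral (2 * (1 - 0) powr (-1/2) - 2 * (1 - (-R)) powr (-1/2))) {-R..0}"
  proof (rule fundamental_theorem_of_calculus)
    fix t assume t: "t \<in> {-R..0}"
    have "((\<lambda>t. 2 * (1 - t) powr (-1/2)) has_real_derivative (1 + \<bar>t\<bar>) powr (-3/2)) (at t within {-R..0})"
      using t by (auto intro!: derivative_eq_intros simp: powr_divide field_simps)
    then show "((\<lambda>t. 2 * (1 - t) powr (-1/2)) has_vector_derivative (1 + \<bar>t\<bar>) powr (-3/2)) (at t within {-R..0})"
      by (simp add: has_real_derivative_iff_has_vector_derivative)
  qed (use assms in auto)
  have "-R \<le> (0::real)" "0 \<le> R" using assms by auto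
  from has_integral_combine[OF this n p] show ?thesis by simp
qed


text \<open>Integration by parts gains 1 / L. The two boundary values contribute 2 C and the
  integral of the derivative at most 4 C, uniformly in R.\<close>

lemma pnt_kernel_vline_bound:
  assumes C: "C > 0" and c: "c > 1" and R: "R > 0" and L: "L > 0"
    and K: "\<And>s. Re s = c \<Longrightarrow> norm (pnt_kernel s) \<le> C * (1 + \<bar>Im s\<bar>) powr (-3/2)"
    and K': "\<And>s. Re s = c \<Longrightarrow> norm (deriv pnt_kernel s) \<le> C * (1 + \<bar>Im s\<bar>) powr (-3/2)"
  shows "norm (contour_integral (vline c R) (\<lambda>s. pnt_kernel s * exp (of_real L * s))) \<le> 6 * C * exp (L * c) / L"
proof -
  let ?E = "\<lambda>s. exp (complex_of_real L * s)"
  let ?S = "{s. Re s > 1}"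
  have nE: "norm (?E s) = exp (L * c)" if "Re s = c" for s using that by (simp add: norm_exp_eq_Re)
  have pi: "path_image (vline c R) = {s. Re s = c \<and> \<bar>Im s\<bar> \<le> R}" using R by (intro path_image_vline) auto
  have sub: "closed_segment (Complex c (-R)) (Complex c R) \<subseteq> ?S" using pi c by auto
  have dK: "(pnt_kernel has_field_derivative deriv pnt_kernel s) (at s)" if "Re s > 1" for s
    using that by (intro holomorphic_derivI[OF holomorphic_pnt_kernel open_halfspace_Re_gt]) auto
  have hK': "deriv pnt_kernel holomorphic_on ?S"
    by (rule holomorphic_deriv[OF holomorphic_pnt_kernel open_halfspace_Re_gt])
  have i1: "(\<lambda>s. pnt_kernel s * ?E s) contour_integrable_on (vline c R)"
    by (intro contour_integrable_continuous_linepath holomorphic_on_imp_continuous_on[OF holomorphic_on_subset[OF _ sub]]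
        holomorphic_intros holomorphic_pnt_kernel)
  have i2: "(\<lambda>s. deriv pnt_kernel s * ?E s) contour_integrable_on (vline c R)"
    by (intro contour_integrable_continuous_linepath holomorphic_on_imp_continuous_on[OF holomorphic_on_subset[OF _ sub]]
        holomorphic_intros hK')
  let ?P = "\<lambda>s. pnt_kernel s * ?E s"
  have "((\<lambda>s. deriv pnt_kernel s * ?E s + of_real L * (pnt_kernel s * ?E s)) has_contour_integral
      (?P (pathfinish (vline c R)) - ?P (pathstart (vline c R)))) (vline c R)"
  proof (rule contour_integral_primitive[where S = ?S])
    fix s assume s: "s \<in> ?S"
    have "(?E has_field_derivative ?E s * of_real L) (at s)"
      by (auto intro!: derivative_eq_intros)
    from DERIV_mult[OF dK this] s
    have "(?P has_field_derivative (deriv pnt_kernel s * ?E s + of_real L * (pnt_kernel s * ?E s))) (at s)"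
      by (simp add: mult_ac add.commute)
    then show "(?P has_field_derivative (deriv pnt_kernel s * ?E s + of_real L * (pnt_kernel s * ?E s))) (at s within ?S)"
      by (rule has_field_derivative_at_within)
  qed (use sub in auto)
  then have e1: "contour_integral (vline c R) (\<lambda>s. deriv pnt_kernel s * ?E s + of_real L * (pnt_kernel s * ?E s)) =
      ?P (Complex c R) - ?P (Complex c (-R))"
    by (simp add: contour_integral_unique)
  have e2: "contour_integral (vline c R) (\<lambda>s. deriv pnt_kernel s * ?E s + of_real L * (pnt_kernel s * ?E s)) =
      contour_integral (vline c R) (\<lambda>s. deriv pnt_kernel s * ?E s) + contour_integral (vline c R) (\<lambda>s. of_real L * ?P s)"
    by (rule contour_integral_add[OF i2 contour_integrable_lmul[OF i1]])
  have e3: "contour_integral (vline c R) (\<lambda>s. of_real L * ?P s) = of_real L * contour_integral (vline c R) ?P"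
    by (rule contour_integral_lmul[OF i1])
  have parts: "of_real L * contour_integral (vline c R) ?P = ?P (Complex c R) - ?P (Complex c (-R))
      - contour_integral (vline c R) (\<lambda>s. deriv pnt_kernel s * ?E s)"
    unfolding e1[symmetric] e2 e3 by (rule add_diff_cancel_left'[symmetric])
  have ends: "norm (?P (Complex c y)) \<le> C * exp (L * c)" for y
  proof -
    have "norm (pnt_kernel (Complex c y)) \<le> C * (1 + \<bar>y\<bar>) powr (-3/2)" using K[of "Complex c y"] by simp
    also have "\<dots> \<le> C * (1 + \<bar>y\<bar>) powr 0" using C by (intro mult_left_mono powr_mono) auto
    also have "(1 + \<bar>y\<bar>) powr 0 = 1" using abs_ge_zero[of y] by simp
    finally have "norm (pnt_kernel (Complex c y)) \<le> C" by simp
    then show ?thesis unfolding norm_mult using nE[of "Complex c y"] C by (simp add: mult_right_mono)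
  qed
  have int: "norm (contour_integral (vline c R) (\<lambda>s. deriv pnt_kernel s * ?E s)) \<le> 4 * C * exp (L * c)"
  proof -
    let ?g = "\<lambda>t. deriv pnt_kernel (Complex c t) * ?E (Complex c t)"
    have eq: "contour_integral (vline c R) (\<lambda>s. deriv pnt_kernel s * ?E s) = \<i> * integral {-R..R} ?g"
      using R by (intro contour_integral_linepath_same_Re) auto
    have "((\<lambda>s. deriv pnt_kernel s * ?E s) has_contour_integral contour_integral (vline c R) (\<lambda>s. deriv pnt_kernel s * ?E s)) (vline c R)"
      using i2 by (rule has_contour_integral_integral)
    then have "?g integrable_on {-R..R}"
      using R by (subst (asm) has_contour_integral_linepath_same_Re_iff[where c = c and a = "-R" and b = R]) auto
    moreover have hi: "((\<lambda>t. C * exp (L * c) * (1 + \<bar>t\<bar>) powr (-3/2)) has_integral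
        C * exp (L * c) * (4 - 4 * (1 + R) powr (-1/2))) {-R..R}"
      using R by (intro has_integral_mult_right has_integral_inverse_three_halves) auto
    ultimately have "norm (integral {-R..R} ?g) \<le> integral {-R..R} (\<lambda>t. C * exp (L * c) * (1 + \<bar>t\<bar>) powr (-3/2))"
    proof (intro integral_norm_bound_integral)
      fix t assume "t \<in> {-R..R}"
      have "norm (?g t) = norm (deriv pnt_kernel (Complex c t)) * exp (L * c)"
        using nE[of "Complex c t"] by (simp add: norm_mult)
      also have "\<dots> \<le> (C * (1 + \<bar>t\<bar>) powr (-3/2)) * exp (L * c)"
        using K'[of "Complex c t"] by (intro mult_right_mono) auto
      finally show "norm (?g t) \<le> C * exp (L * c) * (1 + \<bar>t\<bar>) powr (-3/2)" by (simp add: mult_ac)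
    qed auto
    also have "\<dots> = C * exp (L * c) * (4 - 4 * (1 + R) powr (-1/2))" using hi by (rule integral_unique)
    also have "\<dots> \<le> C * exp (L * c) * 4" using C by (intro mult_left_mono) auto
    finally show ?thesis unfolding eq by (simp add: norm_mult mult_ac)
  qed
  have "L * norm (contour_integral (vline c R) ?P) = norm (of_real L * contour_integral (vline c R) ?P)"
    using L by (simp add: norm_mult)
  also have "\<dots> \<le> norm (?P (Complex c R)) + norm (?P (Complex c (-R))) + norm (contour_integral (vline c R) (\<lambda>s. deriv pnt_kernel s * ?E s))"
    unfolding parts by (rule order_trans[OF norm_triangle_ineq4 add_right_mono[OF norm_triangle_ineq4]])
  also have "\<dots> \<le> 6 * C * exp (L * c)" using ends[of R] ends[of "-R"] int by linarith
  finally show ?thesis using L by (simp add: field_simps)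
qed

lemma mangoldt_smoothed_asymp:
  "\<exists>C>0. \<forall>\<^sub>F x in at_top. \<bar>(\<Sum>n\<le>nat \<lfloor>x\<rfloor>. mangoldt n * (1 - real n / x)) - x / 2\<bar> \<le> C * x / ln x"
proof -
  obtain C r where C: "C > 0" and r: "r > 0" "r \<le> 1" 
    and K: "\<And>s. 1 < Re s \<Longrightarrow> Re s \<le> 1 + r \<Longrightarrow> norm (pnt_kernel s) \<le> C * (1 + \<bar>Im s\<bar>) powr (-3/2)"
    and K': "\<And>s. 1 < Re s \<Longrightarrow> Re s \<le> 1 + r \<Longrightarrow> norm (deriv pnt_kernel s) \<le> C * (1 + \<bar>Im s\<bar>) powr (-3/2)"
    using pnt_kernel_bounds by blast
  have main: "\<bar>(\<Sum>n\<le>nat \<lfloor>x\<rfloor>. mangoldt n * (1 - real n / x)) - (x / 2 - 1 + 1 / (2 * x))\<bar> \<le> 3 * C * x / ln x"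
    if x: "ln x \<ge> 1 / r" "x > 0" for x
  proof -
    define \<Psi> where "\<Psi> = (\<Sum>n\<le>nat \<lfloor>x\<rfloor>. mangoldt n * (1 - real n / x))"
    define L where "L = ln x"
    have L: "L \<ge> 1" "L \<ge> 1 / r" using x r by (auto simp: L_def intro: order_trans[rotated])
    \<comment> \<open>This makes x^c equal to e x, and ln x \<ge> 1 / r keeps c in the range of the
      kernel bounds.\<close>
    define c where "c = 1 + 1 / L"
    have c: "1 < c" "c \<le> 1 + r" "c \<le> 2" using L r by (auto simp: c_def field_simps)
    have xc: "x powr c = exp (L * c)" "exp (L * c) = exp 1 * x" "exp L = x" "exp (-L) = 1 / x"
      using x L by (auto simp: c_def L_def powr_def exp_add exp_minus field_simps)
    define A where "A = 16 * x powr c * (\<Sum>n. \<bar>mangoldt n\<bar> * real n powr (-c)) + 16 * exp (L * c)"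
    let ?V = "x / 2 - 1 + 1 / (2 * x)"
    have bound: "2 * pi * \<bar>\<Psi> - ?V\<bar> \<le> A / R + 6 * C * exp (L * c) / L" if R: "R \<ge> 6" for R
    proof -
      have pi: "path_image (vline c R) = {s. Re s = c \<and> \<bar>Im s\<bar> \<le> R}" using R by (intro path_image_vline) auto
      let ?J = "contour_integral (vline c R) (\<lambda>s. mangoldt_series s * exp (of_real L * s) / (s * (s + 1)))"
      let ?J1 = "contour_integral (vline c R) (\<lambda>s. exp (of_real L * s) / ((s - 1) * s * (s + 1)))"
      let ?J2 = "contour_integral (vline c R) (\<lambda>s. pnt_kernel s * exp (of_real L * s))"
      have b0: "norm (?J - 2 * of_real pi * \<i> * of_real \<Psi>) \<le> 16 * x powr c * (\<Sum>n. \<bar>mangoldt n\<bar> * real n powr (-c)) / R"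
        using perron_mangoldt[OF c(1,3) R x(2)] by (simp add: \<Psi>_def L_def)
      have b1: "norm (?J1 - 2 * of_real pi * \<i> * of_real ?V) \<le> 16 * exp (L * c) / R"
        using pole_kernel_integral[OF c(1,3) R, of L] L xc by (simp add: mult.commute)
      have b2: "norm ?J2 \<le> 6 * C * exp (L * c) / L"
        using R L c by (intro pnt_kernel_vline_bound C K K') auto
      have nz: "s - 1 \<noteq> 0" "s \<noteq> 0" "s + 1 \<noteq> 0" if "Re s = c" for s
        using that c by (auto simp: complex_eq_iff)
      have sub: "closed_segment (Complex c (-R)) (Complex c R) \<subseteq> {s. Re s = c}" using pi by auto
      have G: "(1 / a - q) * E / P = E / (a * P) + (- q) / P * E" if "a \<noteq> 0" "P \<noteq> 0" for a P q E :: complex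
        using that by (simp add: left_diff_distrib diff_divide_distrib)
      have "?J = contour_integral (vline c R) (\<lambda>s. exp (of_real L * s) / ((s - 1) * s * (s + 1)) + pnt_kernel s * exp (of_real L * s))"
      proof (rule contour_integral_cong)
        fix s assume "s \<in> path_image (vline c R)"
        then have s: "Re s = c" using pi by auto
        then have "mangoldt_series s = 1 / (s - 1) - deriv zeta_reg s / zeta_reg s"
          using zeta_reg_log_deriv(2) c by simp
        then show "mangoldt_series s * exp (of_real L * s) / (s * (s + 1)) =
            exp (of_real L * s) / ((s - 1) * s * (s + 1)) + pnt_kernel s * exp (of_real L * s)"
          using G[of "s - 1" "s * (s + 1)" "deriv zeta_reg s / zeta_reg s"] nz[OF s]
          by (simp only: pnt_kernel_def mult.assoc) simp
      qed auto
      also have "\<dots> = ?J1 + ?J2"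
      proof (rule contour_integral_add)
        show "(\<lambda>s. exp (of_real L * s) / ((s - 1) * s * (s + 1))) contour_integrable_on (vline c R)"
          using sub nz by (intro contour_integrable_continuous_linepath continuous_intros) auto
        have "continuous_on {s. Re s = c} pnt_kernel"
          using holomorphic_on_imp_continuous_on[OF holomorphic_pnt_kernel] c by (auto elim: continuous_on_subset)
        then show "(\<lambda>s. pnt_kernel s * exp (of_real L * s)) contour_integrable_on (vline c R)"
          using sub by (intro contour_integrable_continuous_linepath continuous_intros) (auto elim: continuous_on_subset)
      qed
      finally have "2 * of_real pi * \<i> * of_real (\<Psi> - ?V) =
          (?J1 - 2 * of_real pi * \<i> * of_real ?V) - (?J - 2 * of_real pi * \<i> * of_real \<Psi>) + ?J2"
        by (simp add: algebra_simps)
      then have "norm (2 * of_real pi * \<i> * of_real (\<Psi> - ?V) :: complex) \<le>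
          norm (?J1 - 2 * of_real pi * \<i> * of_real ?V) + norm (?J - 2 * of_real pi * \<i> * of_real \<Psi>) + norm ?J2"
        by (simp only:) (rule order_trans[OF norm_triangle_ineq add_right_mono[OF norm_triangle_ineq4]])
      moreover have "norm (2 * of_real pi * \<i> * of_real (\<Psi> - ?V) :: complex) = 2 * pi * \<bar>\<Psi> - ?V\<bar>"
        unfolding norm_mult norm_of_real by simp
      ultimately show ?thesis using b0 b1 b2 by (simp add: A_def add_divide_distrib)
    qed
    \<comment> \<open>\<open>A\<close> may be large in terms of x, but x is fixed while R tends to
      infinity, so the truncation errors vanish.\<close>
    have "((\<lambda>R. A / R + 6 * C * exp (L * c) / L) \<longlongrightarrow> 0 + 6 * C * exp (L * c) / L) at_top"
      by (intro tendsto_intros tendsto_divide_0[OF tendsto_const] filterlim_at_top_imp_at_infinity filterlim_ident)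
    then have "2 * pi * \<bar>\<Psi> - ?V\<bar> \<le> 0 + 6 * C * exp (L * c) / L"
      by (rule tendsto_lowerbound)
         (use bound in \<open>auto intro: eventually_mono[OF eventually_ge_at_top[of "6::real"]]\<close>)
    also have "\<dots> = 6 * C * exp 1 * x / L" using xc by simp
    \<comment> \<open>By exp 1 \<le> 3 < pi the factor pi of the left-hand side can be
      cancelled.\<close>
    also have "\<dots> \<le> 6 * C * pi * x / L"
      using C x L exp_le pi_gt3 by (intro divide_right_mono mult_right_mono mult_left_mono) auto
    finally have "pi * (2 * \<bar>\<Psi> - ?V\<bar>) \<le> pi * (6 * C * x / L)" by (simp add: mult_ac)
    then have "2 * \<bar>\<Psi> - ?V\<bar> \<le> 6 * C * x / L" by (rule mult_left_le_imp_le[OF _ pi_gt_zero])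
    then show ?thesis by (simp add: \<Psi>_def L_def)
  qed
  have "\<forall>\<^sub>F x::real in at_top. ln x \<ge> 1 / r" by (rule eventually_compose_filterlim[OF eventually_ge_at_top ln_at_top])
  moreover have "\<forall>\<^sub>F x::real in at_top. x / ln x \<ge> 1" by real_asymp
  ultimately have "\<forall>\<^sub>F x in at_top. \<bar>(\<Sum>n\<le>nat \<lfloor>x\<rfloor>. mangoldt n * (1 - real n / x)) - x / 2\<bar> \<le> (3 * C + 1) * x / ln x"
    using eventually_ge_at_top[of "1::real"]
  proof eventually_elim
    case (elim x)
    have "\<bar>- 1 + 1 / (2 * x)\<bar> \<le> 1" using elim(3) by (auto simp: field_simps abs_le_iff)
    moreover have "(3 * C + 1) * x / ln x = 3 * C * x / ln x + x / ln x"
      by (simp add: algebra_simps add_divide_distrib)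
    ultimately show ?case using main[OF elim(1)] elim(2,3) by linarith
  qed
  then show ?thesis using C by (intro exI[of _ "3 * C + 1"]) auto
qed

section \<open>Sums of primes\<close>

definition primes_le :: "real \<Rightarrow> nat set" where
  "primes_le y = {p. prime p \<and> real p \<le> y}"

lemma finite_primes_le [simp]: "finite (primes_le y)"
proof (rule finite_subset)
  show "primes_le y \<subseteq> {..nat \<lfloor>y\<rfloor>}" by (auto simp: primes_le_def le_nat_floor)
qed auto

lemma real_le_nat_floor_iff: "n \<le> nat \<lfloor>x\<rfloor> \<longleftrightarrow> real n \<le> x" if "x \<ge> 0"
  using that by (auto simp: le_nat_floor) (simp add: le_nat_iff le_floor_iff)

lemma card_le_real: "real (card {n. 0 < n \<and> real n \<le> z}) \<le> z" if "z \<ge> 0"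
proof -
  have "{n. 0 < n \<and> real n \<le> z} = {1..nat \<lfloor>z\<rfloor>}"
    using that by (auto simp: real_le_nat_floor_iff)
  then show ?thesis using that by simp
qed

lemma card_primes_le_le: "real (card (primes_le z)) \<le> z" if "z \<ge> 0"
proof -
  have "card (primes_le z) \<le> card {n. 0 < n \<and> real n \<le> z}"
  proof (rule card_mono)
    have "{n. 0 < n \<and> real n \<le> z} \<subseteq> {..nat \<lfloor>z\<rfloor>}" using that by (auto simp: real_le_nat_floor_iff)
    then show "finite {n. 0 < n \<and> real n \<le> z}" by (rule finite_subset) auto
  qed (auto simp: primes_le_def prime_gt_0_nat)
  then show ?thesis using card_le_real[OF that] by linarith
qed

text \<open>If n = p^k \<le> x with k \<ge> 2, then p \<le> sqrt x, and k ln 2 \<le> ln x with ln 2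
  \<ge> 1/2 gives k \<le> 2 ln x.\<close>

lemma card_proper_prime_powers:
  assumes x: "x \<ge> 1"
  shows "real (card {n. primepow n \<and> \<not> prime n \<and> real n \<le> x}) \<le> sqrt x * (2 * ln x)"
proof -
  let ?A = "{n. primepow n \<and> \<not> prime n \<and> real n \<le> x}"
  let ?P = "{n. 0 < n \<and> real n \<le> sqrt x}" and ?K = "{n. 0 < n \<and> real n \<le> 2 * ln x}"
  have fin: "finite {n. 0 < n \<and> real n \<le> z}" if "z \<ge> 0" for z
    by (rule finite_subset[of _ "{..nat \<lfloor>z\<rfloor>}"]) (use that in \<open>auto simp: real_le_nat_floor_iff\<close>)
  have fP: "finite ?P" and fK: "finite ?K" using x by (auto intro!: fin)
  have "?A \<subseteq> (\<lambda>(p,k). p ^ k) ` (?P \<times> ?K)"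
  proof
    fix n assume n: "n \<in> ?A"
    then obtain p k where pk: "prime p" "k > 0" "n = p ^ k" by (auto simp: primepow_def)
    have p2: "p \<ge> 2" using pk(1) by (rule prime_ge_2_nat)
    have k2: "k \<ge> 2" using n pk by (cases "k = 1") auto
    have nx: "real p ^ k \<le> x" using n pk by simp
    have "real p ^ 2 \<le> real p ^ k" using k2 p2 by (intro power_increasing) auto
    then have "real p \<le> sqrt x" using nx by (intro real_le_rsqrt) auto
    moreover have "real k \<le> 2 * ln x"
    proof -
      have "(2::real) ^ k \<le> real p ^ k" using p2 by (intro power_mono) auto
      then have "ln ((2::real) ^ k) \<le> ln x" using nx by (subst ln_le_cancel_iff) (use x in auto)
      then have "real k * ln 2 \<le> ln x" by (simp add: ln_realpow)
      moreover have "real k * (1/2) \<le> real k * ln 2" using ln_le_minus_one[of "1/2::real"] by (intro mult_left_mono) (auto simp: ln_div)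
      ultimately show ?thesis by simp
    qed
    ultimately show "n \<in> (\<lambda>(p,k). p ^ k) ` (?P \<times> ?K)" using pk p2 by force
  qed
  then have "card ?A \<le> card ((\<lambda>(p,k). p ^ k) ` (?P \<times> ?K))" using fP fK by (intro card_mono) auto
  also have "\<dots> \<le> card (?P \<times> ?K)" using fP fK by (intro card_image_le) auto
  also have "\<dots> = card ?P * card ?K" by (rule card_cartesian_product)
  finally have "real (card ?A) \<le> real (card ?P) * real (card ?K)" by (simp only: of_nat_le_iff of_nat_mult[symmetric])
  also have "\<dots> \<le> sqrt x * (2 * ln x)" using x by (intro mult_mono card_le_real) auto
  finally show ?thesis .
qed

text \<open>Proper prime powers contribute at most their number times x ln x, of order x^(3/2) up to
  logarithms, well below the error term.\<close>

lemma theta_smoothed_asymp: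
  "\<exists>C>0. \<forall>\<^sub>F x in at_top. \<bar>(\<Sum>p\<in>primes_le x. ln (real p) * (x - real p)) - x\<^sup>2 / 2\<bar> \<le> C * x\<^sup>2 / ln x"
proof -
  obtain C where C: "C > 0" and
    ev: "\<forall>\<^sub>F x in at_top. \<bar>(\<Sum>n\<le>nat \<lfloor>x\<rfloor>. mangoldt n * (1 - real n / x)) - x / 2\<bar> \<le> C * x / ln x"
    using mangoldt_smoothed_asymp by blast
  have "\<forall>\<^sub>F x::real in at_top. sqrt x * (2 * ln x) * (ln x * x) \<le> x\<^sup>2 / ln x" by real_asymp
  with ev have "\<forall>\<^sub>F x in at_top. \<bar>(\<Sum>p\<in>primes_le x. ln (real p) * (x - real p)) - x\<^sup>2 / 2\<bar> \<le> (C + 1) * x\<^sup>2 / ln x"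
    using eventually_ge_at_top[of 2]
  proof eventually_elim
    case (elim x)
    have x: "x \<ge> 2" by fact
    let ?N = "{..nat \<lfloor>x\<rfloor>}" and ?Q = "{n. primepow n \<and> \<not> prime n \<and> real n \<le> x}"
    let ?S = "\<Sum>n\<in>?N. mangoldt n * (x - real n)" and ?T = "\<Sum>p\<in>primes_le x. ln (real p) * (x - real p)"
    let ?U = "\<Sum>n\<in>?Q. mangoldt n * (x - real n)"
    have sub: "primes_le x \<union> ?Q \<subseteq> ?N" using x by (auto simp: primes_le_def real_le_nat_floor_iff)
    then have finQ: "finite ?Q" using finite_subset by blast
    have "?S = (\<Sum>n\<in>primes_le x \<union> ?Q. mangoldt n * (x - real n))"
    proof (rule sum.mono_neutral_right[OF _ sub])
      show "\<forall>n\<in>?N - (primes_le x \<union> ?Q). mangoldt n * (x - real n) = 0"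
        using x by (auto simp: primes_le_def mangoldt_def real_le_nat_floor_iff)
    qed auto
    also have "\<dots> = (\<Sum>n\<in>primes_le x. mangoldt n * (x - real n)) + ?U"
      by (intro sum.union_disjoint[OF finite_primes_le finQ]) (auto simp: primes_le_def)
    also have "(\<Sum>n\<in>primes_le x. mangoldt n * (x - real n)) = ?T"
      by (intro sum.cong) (auto simp: primes_le_def)
    finally have ST: "?S = ?T + ?U" .
    have U: "0 \<le> ?U" "?U \<le> x\<^sup>2 / ln x"
    proof -
      show "0 \<le> ?U" by (intro sum_nonneg mult_nonneg_nonneg) (auto simp: mangoldt_nonneg)
      have "?U \<le> real (card ?Q) * (ln x * x)"
      proof (rule sum_bounded_above)
        fix n assume n: "n \<in> ?Q"
        then have "n > 0" by (auto intro!: Nat.gr0I)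
        have "mangoldt n \<le> ln (real n)" using \<open>n > 0\<close> by (rule mangoldt_le)
        also have "\<dots> \<le> ln x" using n \<open>n > 0\<close> x by (subst ln_le_cancel_iff) auto
        finally show "mangoldt n * (x - real n) \<le> ln x * x"
          using n x by (intro mult_mono) auto
      qed
      also have "\<dots> \<le> sqrt x * (2 * ln x) * (ln x * x)"
        using x by (intro mult_right_mono card_proper_prime_powers) auto
      finally show "?U \<le> x\<^sup>2 / ln x" using elim(2) by linarith
    qed
    have "?S - x\<^sup>2 / 2 = x * ((\<Sum>n\<in>?N. mangoldt n * (1 - real n / x)) - x / 2)"
      using x by (simp add: sum_distrib_left right_diff_distrib power2_eq_square algebra_simps)
    then have "\<bar>?S - x\<^sup>2 / 2\<bar> = x * \<bar>(\<Sum>n\<in>?N. mangoldt n * (1 - real n / x)) - x / 2\<bar>"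
      using x by (simp add: abs_mult)
    also have "\<dots> \<le> x * (C * x / ln x)" using elim(1) x by (intro mult_left_mono) auto
    also have "\<dots> = C * (x\<^sup>2 / ln x)" by (simp add: power2_eq_square)
    finally have "\<bar>?S - x\<^sup>2 / 2\<bar> \<le> C * (x\<^sup>2 / ln x)" .
    then have "\<bar>?T - x\<^sup>2 / 2\<bar> \<le> (C + 1) * (x\<^sup>2 / ln x)"
      using ST U unfolding distrib_right by linarith
    then show ?case by simp
  qed
  then show ?thesis using C by (intro exI[of _ "C + 1"]) auto
qed

text \<open>The function \<open>A\<close> of the overview; it is also the integral of the prime
  counting function from 0 to y.\<close>

definition prime_gap_sum :: "real \<Rightarrow> real" where
  "prime_gap_sum y = (\<Sum>p\<in>primes_le y. y - real p)"

text \<open>The weight ln p is traded for ln y. Downwards this is ln p \<le> ln y; upwards, primes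
  below y / (ln y)^2 are counted trivially and the others satisfy ln p \<ge> ln y - 2 ln ln y. The
  last loss is the origin of the relative error ln ln y / ln y.\<close>

lemma prime_gap_sum_asymp:
  "\<exists>C>0. \<forall>\<^sub>F y in at_top. \<bar>prime_gap_sum y - y\<^sup>2 / (2 * ln y)\<bar> \<le> C * (y\<^sup>2 * ln (ln y) / (ln y)\<^sup>2)"
proof -
  obtain C where C: "C > 0" and
    ev: "\<forall>\<^sub>F y in at_top. \<bar>(\<Sum>p\<in>primes_le y. ln (real p) * (y - real p)) - y\<^sup>2 / 2\<bar> \<le> C * y\<^sup>2 / ln y"
    using theta_smoothed_asymp by blast
  have ev2: "\<forall>\<^sub>F y::real in at_top. ln (ln y) \<ge> 1" "\<forall>\<^sub>F y::real in at_top. 4 * ln (ln y) \<le> ln y"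
     "\<forall>\<^sub>F y::real in at_top. y / (ln y)\<^sup>2 \<ge> 1" "\<forall>\<^sub>F y::real in at_top. ln y \<ge> 1" by real_asymp+
  have "\<forall>\<^sub>F y in at_top. \<bar>prime_gap_sum y - y\<^sup>2 / (2 * ln y)\<bar> \<le> (3 + 2 * C) * (y\<^sup>2 * ln (ln y) / (ln y)\<^sup>2)"
    using ev ev2 eventually_ge_at_top[of 2]
  proof eventually_elim
    case (elim y)
    define L M where "L = ln y" and "M = ln (ln y)"
    have y: "y \<ge> 2" and L: "L \<ge> 1" and M: "M \<ge> 1" "4 * M \<le> L" using elim by (auto simp: L_def M_def)
    let ?T = "\<Sum>p\<in>primes_le y. ln (real p) * (y - real p)"
    have T: "\<bar>?T - y\<^sup>2 / 2\<bar> \<le> C * y\<^sup>2 / L" using elim(1) by (simp add: L_def)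
    define B where "B = y\<^sup>2 * M / L\<^sup>2"
    have yB: "y\<^sup>2 / L\<^sup>2 \<le> B" unfolding B_def using M by (intro divide_right_mono) (auto simp: mult_le_cancel_left1)
    have B0: "B \<ge> 0" using M by (simp add: B_def)
    have lower: "prime_gap_sum y \<ge> y\<^sup>2 / (2 * L) - C * B"
    proof -
      have "?T \<le> (\<Sum>p\<in>primes_le y. L * (y - real p))"
      proof (intro sum_mono mult_right_mono)
        fix p assume p: "p \<in> primes_le y"
        then have "real p > 0" "real p \<le> y" by (auto simp: primes_le_def prime_gt_0_nat)
        then show "ln (real p) \<le> L" using y unfolding L_def by (subst ln_le_cancel_iff) auto
      qed (auto simp: primes_le_def)
      also have "\<dots> = L * prime_gap_sum y" by (simp add: prime_gap_sum_def sum_distrib_left)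
      finally have "y\<^sup>2 / 2 - C * y\<^sup>2 / L \<le> L * prime_gap_sum y" using T by linarith
      then have "(y\<^sup>2 / 2 - C * y\<^sup>2 / L) / L \<le> prime_gap_sum y" using L by (simp add: field_simps)
      moreover have "(y\<^sup>2 / 2 - C * y\<^sup>2 / L) / L = y\<^sup>2 / (2 * L) - C * (y\<^sup>2 / L\<^sup>2)"
        using L by (simp add: diff_divide_distrib power2_eq_square)
      moreover have "C * (y\<^sup>2 / L\<^sup>2) \<le> C * B" using yB C by (intro mult_left_mono) auto
      ultimately show ?thesis by linarith
    qed
    have upper: "prime_gap_sum y \<le> y\<^sup>2 / (2 * L) + (3 + 2 * C) * B"
    proof -
      \<comment> \<open>Small enough that the trivial count z y = (y / L)^2 is negligible, large
        enough that ln z = L - 2 M.\<close>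
      define z where "z = y / L\<^sup>2"
      have z: "z \<ge> 1" "z \<le> y" using elim(4) L y by (auto simp: z_def L_def divide_le_eq mult_le_cancel_left1)
      have lnz: "ln z = L - 2 * M" using y L by (simp add: z_def ln_div ln_realpow L_def M_def)
      have lz: "ln z \<ge> L / 2" "ln z > 0" using lnz M L by auto
      let ?P1 = "primes_le z" and ?P2 = "primes_le y - primes_le z"
      have "prime_gap_sum y = (\<Sum>p\<in>?P2. y - real p) + (\<Sum>p\<in>?P1. y - real p)"
        unfolding prime_gap_sum_def using z by (intro sum.subset_diff[OF _ finite_primes_le]) (auto simp: primes_le_def)
      moreover have "(\<Sum>p\<in>?P1. y - real p) \<le> y\<^sup>2 / L\<^sup>2"
      proof -
        have "(\<Sum>p\<in>?P1. y - real p) \<le> real (card ?P1) * y" by (rule sum_bounded_above) auto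
        also have "\<dots> \<le> z * y" using z y by (intro mult_right_mono card_primes_le_le) auto
        finally show ?thesis by (simp add: z_def power2_eq_square)
      qed
      moreover have "(\<Sum>p\<in>?P2. y - real p) \<le> ?T / ln z"
      proof -
        have "ln z * (\<Sum>p\<in>?P2. y - real p) = (\<Sum>p\<in>?P2. ln z * (y - real p))" by (rule sum_distrib_left)
        also have "\<dots> \<le> (\<Sum>p\<in>?P2. ln (real p) * (y - real p))"
          using z by (intro sum_mono mult_right_mono) (auto simp: primes_le_def)
        also have "\<dots> \<le> ?T"
        proof (rule sum_mono2)
          fix p assume "p \<in> primes_le y - ?P2"
          then show "0 \<le> ln (real p) * (y - real p)"
            by (intro mult_nonneg_nonneg ln_nat_nonneg) (auto simp: primes_le_def)
        qed auto
        finally show ?thesis using lz by (simp add: field_simps)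
      qed
      moreover have "?T / ln z \<le> (y\<^sup>2 / 2 + C * y\<^sup>2 / L) / ln z"
        using T lz by (intro divide_right_mono) auto
      moreover have "(y\<^sup>2 / 2 + C * y\<^sup>2 / L) / ln z = y\<^sup>2 / 2 * (1 / ln z) + C * y\<^sup>2 / L * (1 / ln z)"
        by (simp add: add_divide_distrib)
      moreover have "C * y\<^sup>2 / L * (1 / ln z) \<le> C * y\<^sup>2 / L * (1 / (L / 2))"
        using C L lz by (intro mult_left_mono divide_left_mono) auto
      moreover have "C * y\<^sup>2 / L * (1 / (L / 2)) = 2 * C * (y\<^sup>2 / L\<^sup>2)" by (simp add: power2_eq_square)
      moreover have "2 * C * (y\<^sup>2 / L\<^sup>2) \<le> 2 * C * B" using yB C by (intro mult_left_mono) auto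
      \<comment> \<open>The difference of 1 / (L - 2 M) and 1 / L is 2 M / (L (L - 2 M)), and 4 M
        \<le> L gives L - 2 M \<ge> L / 2.\<close>
      moreover have "1 / ln z \<le> 1 / L + 4 * M / L\<^sup>2"
      proof -
        have "1 \<le> (1 / L + 4 * M / L\<^sup>2) * (L - 2 * M)"
        proof -
          have "(1 / L + 4 * M / L\<^sup>2) * (L - 2 * M) - 1 = 2 * M * (L - 4 * M) / L\<^sup>2"
            using L by (simp add: field_simps power2_eq_square)
          also have "\<dots> \<ge> 0" using M by (intro divide_nonneg_nonneg mult_nonneg_nonneg) auto
          finally show ?thesis by simp
        qed
        then show ?thesis using lz lnz by (simp add: pos_divide_le_eq)
      qed
      then have "y\<^sup>2 / 2 * (1 / ln z) \<le> y\<^sup>2 / 2 * (1 / L + 4 * M / L\<^sup>2)" by (intro mult_left_mono) auto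
      moreover have "y\<^sup>2 / 2 * (1 / L + 4 * M / L\<^sup>2) = y\<^sup>2 / (2 * L) + 2 * B"
        by (simp add: B_def algebra_simps)
      ultimately have "prime_gap_sum y \<le> y\<^sup>2 / (2 * L) + 2 * B + 2 * C * B + B" using yB by linarith
      then show ?thesis by (simp add: algebra_simps)
    qed
    have "C * B \<le> (3 + 2 * C) * B" using C B0 by (intro mult_right_mono) auto
    with lower upper show ?case by (simp add: abs_le_iff B_def L_def M_def)
  qed
  then show ?thesis using C by (intro exI[of _ "3 + 2 * C"]) auto
qed

text \<open>In the sum of y - p over J, primes above y contribute negatively, and adding the missing
  primes up to y only increases it. The free parameter y is tuned to the size of J later.\<close>

lemma sum_primes_ge:
  assumes "finite J" "\<And>p. p \<in> J \<Longrightarrow> prime p"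
  shows "real (\<Sum>J) \<ge> real (card J) * y - prime_gap_sum y"
proof -
  have neg: "(\<Sum>p\<in>J - primes_le y. y - real p) \<le> 0"
    by (rule sum_nonpos) (use assms(2) in \<open>auto simp: primes_le_def not_le\<close>)
  have "real (card J) * y - real (\<Sum>J) = (\<Sum>p\<in>J. y - real p)"
    by (simp add: sum_subtractf)
  also have "\<dots> \<le> (\<Sum>p\<in>J \<inter> primes_le y. y - real p)"
    using neg assms(1) by (subst sum.Int_Diff[of J _ "primes_le y"]) auto
  also have "\<dots> \<le> prime_gap_sum y" unfolding prime_gap_sum_def
    by (intro sum_mono2[OF finite_primes_le]) (auto simp: primes_le_def)
  finally show ?thesis by linarith
qed

text \<open>The argument x ln x is roughly the x-th prime, hence nearly the best y in
  \<open>sum_primes_ge\<close> for a set of about x primes.\<close>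

lemma prime_gap_sum_x_ln_x:
  "\<exists>C>0. \<forall>\<^sub>F x in at_top. prime_gap_sum (x * ln x) \<le> x\<^sup>2 * ln x / 2 + C * (x\<^sup>2 * ln (ln x))"
proof -
  obtain C where C: "C > 0" and
    ev: "\<forall>\<^sub>F y in at_top. \<bar>prime_gap_sum y - y\<^sup>2 / (2 * ln y)\<bar> \<le> C * (y\<^sup>2 * ln (ln y) / (ln y)\<^sup>2)"
    using prime_gap_sum_asymp by blast
  have "filterlim (\<lambda>x::real. x * ln x) at_top at_top" by real_asymp
  from eventually_compose_filterlim[OF ev this]
  have ev1: "\<forall>\<^sub>F x in at_top. \<bar>prime_gap_sum (x * ln x) - (x * ln x)\<^sup>2 / (2 * ln (x * ln x))\<bar>
     \<le> C * ((x * ln x)\<^sup>2 * ln (ln (x * ln x)) / (ln (x * ln x))\<^sup>2)" .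
  have ev2: "\<forall>\<^sub>F x::real in at_top. (x * ln x)\<^sup>2 / (2 * ln (x * ln x)) \<le> x\<^sup>2 * ln x / 2"
    by real_asymp
  have ev3: "\<forall>\<^sub>F x::real in at_top. (x * ln x)\<^sup>2 * ln (ln (x * ln x)) / (ln (x * ln x))\<^sup>2
      \<le> 2 * (x\<^sup>2 * ln (ln x))" by real_asymp
  have "\<forall>\<^sub>F x in at_top. prime_gap_sum (x * ln x) \<le> x\<^sup>2 * ln x / 2 + (2 * C) * (x\<^sup>2 * ln (ln x))"
    using ev1 ev2 ev3
  proof eventually_elim
    case (elim x)
    have "C * ((x * ln x)\<^sup>2 * ln (ln (x * ln x)) / (ln (x * ln x))\<^sup>2) \<le> C * (2 * (x\<^sup>2 * ln (ln x)))"
      using elim(3) C by (intro mult_left_mono) auto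
    then show ?case using elim(1,2) by linarith
  qed
  then show ?thesis using C by (intro exI[of _ "2 * C"]) auto
qed

text \<open>With k primes up to y, their sum is exactly k y minus the gap sum. Completing a square
  eliminates y from the main term, so no asymptotic relation between k and y enters. The crude
  second conjunct follows from A(y) \<le> k y and controls y in the error term.\<close>

lemma primes_le_weighted_upper:
  "\<exists>C>0. \<forall>\<^sub>F y in at_top. ln y * real (\<Sum>(primes_le y)) \<le>
     (real (card (primes_le y)))\<^sup>2 * ((ln y)\<^sup>2 / 2 + C * (ln y * ln (ln y)))
     \<and> y \<le> 3 * ln y * real (card (primes_le y))"
proof -
  obtain C where C: "C > 0" and
    ev: "\<forall>\<^sub>F y in at_top. \<bar>prime_gap_sum y - y\<^sup>2 / (2 * ln y)\<bar> \<le> C * (y\<^sup>2 * ln (ln y) / (ln y)\<^sup>2)"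
    using prime_gap_sum_asymp by blast
  have ev1: "\<forall>\<^sub>F y::real in at_top. C * (y\<^sup>2 * ln (ln y) / (ln y)\<^sup>2) \<le> y\<^sup>2 / (6 * ln y)"
    using C by real_asymp
  have ev2: "\<forall>\<^sub>F y::real in at_top. ln (ln y) \<ge> 1" "\<forall>\<^sub>F y::real in at_top. ln y \<ge> 1" by real_asymp+
  have "\<forall>\<^sub>F y in at_top. ln y * real (\<Sum>(primes_le y)) \<le>
     (real (card (primes_le y)))\<^sup>2 * ((ln y)\<^sup>2 / 2 + (9 * C) * (ln y * ln (ln y)))
     \<and> y \<le> 3 * ln y * real (card (primes_le y))"
    using ev ev1 ev2 eventually_gt_at_top[of 0]
  proof eventually_elim
    case (elim y)
    define k where "k = real (card (primes_le y))"
    define L M where "L = ln y" and "M = ln (ln y)"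
    have L: "L \<ge> 1" and M: "M \<ge> 1" and y: "y > 0" using elim by (auto simp: L_def M_def)
    have A: "prime_gap_sum y \<ge> y\<^sup>2 / (2 * L) - C * (y\<^sup>2 * M / L\<^sup>2)"
      using elim(1) by (simp add: L_def M_def)
    have "prime_gap_sum y \<le> k * y"
      unfolding prime_gap_sum_def k_def by (rule sum_bounded_above) auto
    moreover have "C * (y\<^sup>2 * M / L\<^sup>2) \<le> y\<^sup>2 / (6 * L)" using elim(2) by (simp add: L_def M_def)
    moreover have "y\<^sup>2 / (2 * L) - y\<^sup>2 / (6 * L) = y * (y / (3 * L))" using L by (simp add: field_simps power2_eq_square)
    moreover have "k * y = y * k" by (rule mult.commute)
    ultimately have "y * (y / (3 * L)) \<le> y * k" using A by linarith
    then have yk: "y \<le> 3 * L * k" using y L by (simp add: field_simps)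
    have "real (\<Sum>(primes_le y)) = k * y - prime_gap_sum y"
      by (simp add: prime_gap_sum_def sum_subtractf k_def)
    also have "\<dots> \<le> k * y - y\<^sup>2 / (2 * L) + C * (y\<^sup>2 * M / L\<^sup>2)" using A by linarith
    finally have "L * real (\<Sum>(primes_le y)) \<le> L * (k * y - y\<^sup>2 / (2 * L) + C * (y\<^sup>2 * M / L\<^sup>2))"
      using L by (intro mult_left_mono) auto
    also have "\<dots> = k * y * L - y\<^sup>2 / 2 + C * M * (y\<^sup>2 / L)"
      using L by (simp add: field_simps power2_eq_square)
    \<comment> \<open>This is (k L - y)^2 \<ge> 0.\<close>
    also have "k * y * L - y\<^sup>2 / 2 \<le> k\<^sup>2 * (L\<^sup>2 / 2)"
      using sum_squares_ge_zero[of "k * L - y" 0] by (simp add: power2_eq_square algebra_simps)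
    also have "C * M * (y\<^sup>2 / L) \<le> C * M * ((3 * L * k)\<^sup>2 / L)"
      using C M L y yk by (intro mult_left_mono divide_right_mono power_mono) auto
    also have "k\<^sup>2 * (L\<^sup>2 / 2) + C * M * ((3 * L * k)\<^sup>2 / L) = k\<^sup>2 * (L\<^sup>2 / 2 + (9 * C) * (L * M))"
      using L by (simp add: field_simps power2_eq_square)
    finally show ?case using yk by (simp add: k_def L_def M_def)
  qed
  then show ?thesis using C by (intro exI[of _ "9 * C"]) auto
qed

section \<open>Prime divisors of the number of divisors\<close>

lemma ndiv_pos: "n > 0 \<Longrightarrow> ndiv n > 0"
  by (auto simp: ndiv_def card_gt_0_iff finite_divisors_nat)

lemma ndiv_coprime_mult:
  assumes "coprime a b"
  shows "ndiv (a * b) = ndiv a * ndiv b"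
proof -
  have "bij_betw (\<lambda>(d, e). d * e) ({d. d dvd a} \<times> {e. e dvd b}) {k. k dvd a * b}"
  proof (rule bij_betw_imageI)
    show "inj_on (\<lambda>(d, e). d * e) ({d. d dvd a} \<times> {e. e dvd b})"
    proof (rule inj_onI, clarify)
      fix d e d' e' assume h: "d dvd a" "e dvd b" "d' dvd a" "e' dvd b" "d * e = d' * e'"
      have c: "coprime d e'" "coprime d' e" using assms h coprime_divisors by blast+
      have "d dvd d'" using h(5) c(1) by (metis coprime_dvd_mult_left_iff dvd_triv_left)
      moreover have "d' dvd d" using h(5) c(2) by (metis coprime_dvd_mult_left_iff dvd_triv_left)
      ultimately have "d = d'" by (rule dvd_antisym)
      moreover have "coprime e d'" "coprime e' d" using c by (auto simp: coprime_commute)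
      then have "e dvd e'" "e' dvd e" using h(5) by (metis coprime_dvd_mult_right_iff dvd_triv_right)+
      then have "e = e'" by (rule dvd_antisym)
      ultimately show "d = d' \<and> e = e'" by simp
    qed
    show "(\<lambda>(d, e). d * e) ` ({d. d dvd a} \<times> {e. e dvd b}) = {k. k dvd a * b}"
      using division_decomp by (force intro: mult_dvd_mono)
  qed
  then show ?thesis
    unfolding ndiv_def by (simp flip: bij_betw_same_card add: card_cartesian_product)
qed

lemma ndiv_prime_power:
  assumes "prime p"
  shows "ndiv (p ^ k) = k + 1"
proof -
  have "{d. d dvd p ^ k} = (\<lambda>i. p ^ i) ` {..k}"
    using divides_primepow_nat[OF assms] by auto
  moreover have "inj_on (\<lambda>i. p ^ i) {..k}"
    using prime_gt_1_nat[OF assms] by (auto simp: inj_on_def)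
  ultimately show ?thesis by (simp add: ndiv_def card_image)
qed

lemma ndiv_prod_prime_powers:
  assumes "finite P" "\<And>p. p \<in> P \<Longrightarrow> prime p"
  shows "ndiv (\<Prod>p\<in>P. p ^ a p) = (\<Prod>p\<in>P. a p + 1)"
  using assms
proof (induction P rule: finite_induct)
  case empty
  then show ?case by (simp add: ndiv_def)
next
  case (insert q P)
  have "coprime (q ^ a q) (\<Prod>p\<in>P. p ^ a p)"
  proof (rule prod_coprime_right)
    fix p assume "p \<in> P"
    then have "coprime q p" using insert.prems insert.hyps by (intro primes_coprime) auto
    then show "coprime (q ^ a q) (p ^ a p)" by simp
  qed
  then show ?case using insert by (simp add: ndiv_coprime_mult ndiv_prime_power)
qed

lemma prime_dvd_ndivE:
  assumes "prime q" "q dvd ndiv n" "n > 0"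
  obtains p where "p \<in> prime_factors n" "q dvd multiplicity p n + 1"
proof -
  have "ndiv n = (\<Prod>p\<in>prime_factors n. multiplicity p n + 1)"
    using ndiv_prod_prime_powers[of "prime_factors n" "\<lambda>p. multiplicity p n"]
      prime_factorization_nat[of n] assms(3) by auto
  then show ?thesis using assms that by (auto simp: prime_dvd_prod_iff)
qed

text \<open>The count is unbounded and grows by at most 1 from m - 1 to m, so the least m where it
  reaches k has exactly k.\<close>

lemma exists_primes_le_card: "\<exists>m::nat. card (primes_le (real m)) = k"
proof -
  define P where "P = (\<lambda>m::nat. card (primes_le (real m)) \<ge> k)"
  have "\<exists>m. P m"
  proof -
    obtain S where S: "S \<subseteq> {p::nat. prime p}" "finite S" "card S = k"
      using infinite_arbitrarily_large[OF primes_infinite] by metis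
    have "S \<subseteq> primes_le (real (Max (insert 0 S)))" using S by (auto simp: primes_le_def)
    then have "card S \<le> card (primes_le (real (Max (insert 0 S))))" by (intro card_mono) auto
    then show ?thesis using S(3) unfolding P_def by auto
  qed
  then have m: "P (LEAST m. P m)" by (rule LeastI_ex)
  define m0 where "m0 = (LEAST m. P m)"
  show ?thesis
  proof (cases "m0 = 0")
    case True
    have "primes_le 0 = {}" by (auto simp: primes_le_def prime_gt_0_nat)
    then have "card (primes_le (real m0)) = 0" using True by simp
    then show ?thesis using m by (intro exI[of _ m0]) (auto simp: P_def m0_def)
  next
    case False
    have "\<not> P (m0 - 1)" using not_less_Least[of "m0 - 1" P] False by (simp add: m0_def)
    then have lt: "card (primes_le (real (m0 - 1))) < k" by (simp add: P_def)
    have "primes_le (real m0) \<subseteq> insert m0 (primes_le (real (m0 - 1)))"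
      by (auto simp: primes_le_def)
    then have "card (primes_le (real m0)) \<le> card (insert m0 (primes_le (real (m0 - 1))))"
      by (intro card_mono) auto
    also have "\<dots> \<le> Suc (card (primes_le (real (m0 - 1))))" by (simp add: card_insert_if)
    finally have "card (primes_le (real m0)) \<le> k" using lt by linarith
    then show ?thesis using m by (intro exI[of _ m0]) (auto simp: P_def m0_def)
  qed
qed

text \<open>The witness is the product of p^(p - 1) over the primes p \<le> y: the same primes serve
  as bases and as exponents plus one, so the divisor count is the product of all p. Each base then
  costs at most ln y per unit of exponent.\<close>

lemma many_divisor_primes_construction:
  assumes y: "y \<ge> 1"
  shows "\<exists>n>0. omega (ndiv n) \<ge> card (primes_le y) \<and> ln (real n) \<le> ln y * real (\<Sum>(primes_le y))"
proof -
  let ?P = "primes_le y"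
  have prime: "prime p" if "p \<in> ?P" for p using that by (simp add: primes_le_def)
  define n where "n = (\<Prod>p\<in>?P. p ^ (p - 1))"
  have n0: "n > 0" unfolding n_def using prime by (auto intro!: prod_pos simp: prime_gt_0_nat)
  have "ndiv n = (\<Prod>p\<in>?P. p - 1 + 1)"
    unfolding n_def by (rule ndiv_prod_prime_powers) (auto simp: prime)
  also have "\<dots> = (\<Prod>p\<in>?P. p)" using prime by (intro prod.cong) (auto simp: prime_gt_0_nat)
  finally have nd: "ndiv n = (\<Prod>p\<in>?P. p)" .
  have "?P \<subseteq> prime_factors (ndiv n)"
  proof
    fix p assume p: "p \<in> ?P"
    then have "p dvd ndiv n" unfolding nd using dvd_prodI[of ?P p "\<lambda>p. p"] by simp
    then show "p \<in> prime_factors (ndiv n)"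
      using prime[OF p] ndiv_pos[OF n0] by (intro prime_factorsI) auto
  qed
  then have "card ?P \<le> omega (ndiv n)" unfolding omega_def by (intro card_mono) auto
  moreover have "ln (real n) \<le> ln y * real (\<Sum>?P)"
  proof -
    have "ln (real n) = (\<Sum>p\<in>?P. ln (real p ^ (p - 1)))"
      unfolding n_def of_nat_prod of_nat_power using prime
      by (intro ln_prod) (auto simp: prime_gt_0_nat)
    also have "\<dots> \<le> (\<Sum>p\<in>?P. ln y * real p)"
    proof (rule sum_mono)
      fix p assume p: "p \<in> ?P"
      then have p': "p > 0" "real p \<le> y" by (auto simp: primes_le_def prime_gt_0_nat)
      have "ln (real p ^ (p - 1)) = real (p - 1) * ln (real p)" using p' by (simp add: ln_realpow)
      also have "\<dots> \<le> real p * ln y" using p' y by (intro mult_mono) auto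
      finally show "ln (real p ^ (p - 1)) \<le> ln y * real p" by (simp add: mult.commute)
    qed
    also have "\<dots> = ln y * real (\<Sum>?P)" by (simp add: sum_distrib_left)
    finally show ?thesis .
  qed
  ultimately show ?thesis using n0 by blast
qed

text \<open>The construction is run with exactly the integer part of t many primes, hence the loss
  of 1. What remains is to express ln y through ln t with an error of order ln ln t.\<close>

lemma omega_ndiv_lower:
  "\<exists>C>0. \<forall>\<^sub>F t in at_top. \<exists>n>0. real (omega (ndiv n)) \<ge> t - 1 \<and>
     ln (real n) \<le> t\<^sup>2 * ((ln t)\<^sup>2 / 2 + C * (ln t * ln (ln t)))"
proof -
  obtain C where C: "C > 0" and
    ev: "\<forall>\<^sub>F y in at_top. ln y * real (\<Sum>(primes_le y)) \<le>
     (real (card (primes_le y)))\<^sup>2 * ((ln y)\<^sup>2 / 2 + C * (ln y * ln (ln y)))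
     \<and> y \<le> 3 * ln y * real (card (primes_le y))"
    using primes_le_weighted_upper by blast
  have ev1: "\<forall>\<^sub>F y::real in at_top. 3 * ln y \<le> sqrt y" "\<forall>\<^sub>F y::real in at_top. ln y \<ge> 1" by real_asymp+
  have "\<forall>\<^sub>F y::real in at_top. 3 * ln y \<le> sqrt y \<and> ln y \<ge> 1 \<and> y \<ge> 1 \<and> ln y * real (\<Sum>(primes_le y)) \<le>
     (real (card (primes_le y)))\<^sup>2 * ((ln y)\<^sup>2 / 2 + C * (ln y * ln (ln y)))
     \<and> y \<le> 3 * ln y * real (card (primes_le y))"
    using ev ev1 eventually_ge_at_top[of 1] by eventually_elim auto
  then obtain Y where Y: "\<And>y::real. y \<ge> Y \<Longrightarrow> 3 * ln y \<le> sqrt y \<and> ln y \<ge> 1 \<and> y \<ge> 1 \<and> ln y * real (\<Sum>(primes_le y)) \<le>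
     (real (card (primes_le y)))\<^sup>2 * ((ln y)\<^sup>2 / 2 + C * (ln y * ln (ln y)))
     \<and> y \<le> 3 * ln y * real (card (primes_le y))"
    unfolding eventually_at_top_linorder by blast
  have ev2: "\<forall>\<^sub>F t::real in at_top. ln (ln t) \<ge> ln 6" "\<forall>\<^sub>F t::real in at_top. ln (ln t) \<le> ln t"
    "\<forall>\<^sub>F t::real in at_top. ln t \<ge> 1" by real_asymp+
  have "\<forall>\<^sub>F t in at_top. \<exists>n>0. real (omega (ndiv n)) \<ge> t - 1 \<and>
     ln (real n) \<le> t\<^sup>2 * ((ln t)\<^sup>2 / 2 + (4 + 4 * C) * (ln t * ln (ln t)))"
    using ev2 eventually_ge_at_top[of "Y + 1"] eventually_ge_at_top[of 1]
  proof eventually_elim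
    case (elim t)
    define l la where "l = ln t" and "la = ln (ln t)"
    have l: "l \<ge> 1" "la \<ge> ln 6" "la \<le> l" using elim by (auto simp: l_def la_def)
    have la0: "la \<ge> ln 2" "la \<ge> 0"
    proof -
      have "ln (2::real) \<le> ln 6" "0 \<le> ln (2::real)" by simp_all
      then show "la \<ge> ln 2" "la \<ge> 0" using l(2) by linarith+
    qed
    define k where "k = nat \<lfloor>t\<rfloor>"
    have k: "real k \<le> t" "real k \<ge> t - 1" using elim unfolding k_def by linarith+
    obtain m :: nat where m: "card (primes_le (real m)) = k" using exists_primes_le_card by blast
    have "real k \<le> real m" using card_primes_le_le[of "real m"] m by simp
    then have mY: "real m \<ge> Y" using k elim by linarith
    define y where "y = real m"
    note Yy = Y[OF mY, folded y_def]
    have y: "3 * ln y \<le> sqrt y" "ln y \<ge> 1" "y \<ge> 1" using Yy by auto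
    have w: "ln y * real (\<Sum>(primes_le y)) \<le> (real k)\<^sup>2 * ((ln y)\<^sup>2 / 2 + C * (ln y * ln (ln y)))"
      and yk: "y \<le> 3 * ln y * real k" using Yy m by (auto simp: y_def)
    have yt: "y \<le> 3 * ln y * t" using yk k(1) y by (intro order_trans[OF yk] mult_left_mono) auto
    have t0: "t \<ge> 1" by fact
    \<comment> \<open>A bootstrap: \<open>3 * ln y \<le> sqrt y\<close> gives y \<le> t^2 and so
      \<open>ln y \<le> 2 * l\<close>. Reinserted, this gives y \<le> 6 t ln t, and
      \<open>ln 6 \<le> la\<close> turns it into \<open>ln y \<le> l + 2 * la\<close>.\<close>
    have "3 * ln y * t \<le> sqrt y * t" using y(1) t0 by (intro mult_right_mono) auto
    moreover have "sqrt y * sqrt y = y" using y by simp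
    ultimately have "sqrt y * sqrt y \<le> sqrt y * t" using yt by linarith
    then have "sqrt y \<le> t" by (rule mult_left_le_imp_le) (use y in auto)
    then have "y \<le> t\<^sup>2" using y t0 by (simp add: real_sqrt_le_iff sqrt_le_D)
    then have "ln y \<le> ln (t\<^sup>2)" using y t0 by (subst ln_le_cancel_iff) auto
    then have ly2: "ln y \<le> 2 * l" using t0 by (simp add: ln_realpow l_def)
    have "y \<le> 3 * (2 * l) * t" using yt ly2 t0 by (intro order_trans[OF yt] mult_right_mono) auto
    then have "ln y \<le> ln (6 * l * t)" using y by (subst ln_le_cancel_iff) auto
    also have "\<dots> = ln 6 + ln l + ln t" using l t0 by (simp add: ln_mult)
    also have "\<dots> = ln 6 + la + l" by (simp add: l_def la_def)
    finally have ly: "ln y \<le> l + 2 * la" using l by linarith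
    have "ln (ln y) \<le> ln (2 * l)" by (intro ln_mono) (use ly2 y(2) l(1) in linarith)+
    also have "\<dots> = ln 2 + ln l" using l by (simp add: ln_mult)
    also have "\<dots> = ln 2 + la" by (simp add: l_def la_def)
    finally have lly: "ln (ln y) \<le> 2 * la" using la0 by linarith
    obtain n where n: "n > 0" "omega (ndiv n) \<ge> k" "ln (real n) \<le> ln y * real (\<Sum>(primes_le y))"
      using many_divisor_primes_construction[OF y(3)] m by (auto simp: y_def)
    have lly0: "ln (ln y) \<ge> 0" using y by simp
    have "ln (real n) \<le> (real k)\<^sup>2 * ((ln y)\<^sup>2 / 2 + C * (ln y * ln (ln y)))" using n w by linarith
    also have "\<dots> \<le> t\<^sup>2 * ((l + 2 * la)\<^sup>2 / 2 + C * ((2 * l) * (2 * la)))"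
      using k C y ly ly2 lly lly0 l la0
      by (intro mult_mono add_mono divide_right_mono power_mono mult_left_mono add_nonneg_nonneg mult_nonneg_nonneg) auto
    also have "\<dots> \<le> t\<^sup>2 * (l\<^sup>2 / 2 + (4 + 4 * C) * (l * la))"
    proof (rule mult_left_mono)
      have "la * la \<le> l * la" using l la0 by (intro mult_right_mono) auto
      then show "(l + 2 * la)\<^sup>2 / 2 + C * ((2 * l) * (2 * la)) \<le> l\<^sup>2 / 2 + (4 + 4 * C) * (l * la)"
        by (simp add: power2_eq_square algebra_simps)
    qed auto
    finally show ?case using n k by (intro exI[of _ n]) (auto simp: l_def la_def)
  qed
  then show ?thesis using C by (intro exI[of _ "4 + 4 * C"]) auto
qed

section \<open>The cost of many prime factors in the divisor count\<close>

text \<open>A Bernoulli inequality. It says that an exponent shared by several primes q is at least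
  as large as the separate exponents q - 1 together.\<close>

lemma one_plus_sum_le_prod:
  assumes "finite M" "\<And>q. q \<in> M \<Longrightarrow> q \<ge> (1::nat)"
  shows "1 + (\<Sum>q\<in>M. real q - 1) \<le> real (\<Prod>M)"
  using assms
proof (induction M rule: finite_induct)
  case (insert q M)
  have s: "(\<Sum>q\<in>M. real q - 1) \<ge> 0" using insert.prems by (intro sum_nonneg) auto
  have "1 + (\<Sum>q\<in>insert q M. real q - 1) = real q + (\<Sum>q\<in>M. real q - 1)" using insert by simp
  also have "\<dots> \<le> real q * (1 + (\<Sum>q\<in>M. real q - 1))"
    using s insert.prems[of q] mult_right_mono[of 1 "real q" "\<Sum>q\<in>M. real q - 1"] by (simp add: algebra_simps)
  also have "\<dots> \<le> real q * real (\<Prod>M)" using insert by (intro mult_left_mono) auto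
  finally show ?case using insert by simp
qed simp

lemma prod_primes_dvd:
  assumes "finite M" "\<And>q. q \<in> M \<Longrightarrow> prime q \<and> q dvd N"
  shows "\<Prod>M dvd (N::nat)"
  using assms
proof (induction M rule: finite_induct)
  case (insert q M)
  have "coprime q (\<Prod>M)"
  proof (rule prod_coprime_right)
    fix p assume "p \<in> M"
    then show "coprime q p" using insert.prems insert.hyps by (intro primes_coprime) auto
  qed
  then have "q * \<Prod>M dvd N" using insert by (intro divides_mult) auto
  then show ?case using insert by simp
qed simp

text \<open>Each prime divisor \<open>q\<close> of \<open>ndiv n\<close> divides \<open>a\<^sub>p + 1\<close> for some \<open>p\<close>. Sharing one \<open>p\<close> among
  several large \<open>q\<close> is wasteful, since it costs their product; hence only primes \<open>q\<close> that are
  small, or that are the single one attached to a small \<open>p\<close>, have to be discarded.\<close>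

lemma ln_ge_of_prime_divisors_of_ndiv:
  assumes n: "n > 0" and S: "S \<subseteq> prime_factors (ndiv n)" and z: "1 \<le> z" and T: "T \<ge> 2 * ln z" "T \<ge> 0"
  shows "\<exists>J. J \<subseteq> S \<and> real (card S) \<le> real (card J) + T + z \<and>
     ln (real n) \<ge> ln z * (\<Sum>q\<in>J. real q - 1)"
proof -
  have prime: "prime q" if "q \<in> S" for q using that S by auto
  have finS: "finite S" using S finite_subset by blast
  have "\<exists>p. p \<in> prime_factors n \<and> q dvd multiplicity p n + 1" if "q \<in> S" for q
    using prime_dvd_ndivE[of q n] that S n by (metis in_prime_factors_iff subsetD)
  then obtain f where f: "\<And>q. q \<in> S \<Longrightarrow> f q \<in> prime_factors n" "\<And>q. q \<in> S \<Longrightarrow> q dvd multiplicity (f q) n + 1"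
    by metis
  \<comment> \<open>At most \<open>T\<close> primes are lost here, and each survivor exceeds
    \<open>2 * ln z\<close>.\<close>
  define S1 where "S1 = {q \<in> S. real q > T}"
  define M where "M = (\<lambda>p. {q \<in> S1. f q = p})"
  \<comment> \<open>Only for these base primes can ln p fall below ln z. There are at most
    \<open>z\<close> of them, so one attached prime can be sacrificed for each.\<close>
  define bad where "bad = {p \<in> prime_factors n. real p \<le> z \<and> M p \<noteq> {}}"
  define g where "g = (\<lambda>p. SOME q. q \<in> M p)"
  have g: "g p \<in> M p" if "p \<in> bad" for p
    using that unfolding bad_def g_def by (auto intro: someI)
  define J where "J = S1 - g ` bad"
  have finS1: "finite S1" and finJ: "finite J" and finM: "finite (M p)" for p
    using finS by (auto simp: S1_def J_def M_def)
  have JS: "J \<subseteq> S" by (auto simp: J_def S1_def)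
  have "real (card S) \<le> real (card J) + T + z"
  proof -
    have "S \<subseteq> J \<union> g ` bad \<union> primes_le T" using prime by (auto simp: J_def S1_def primes_le_def)
    then have "card S \<le> card (J \<union> g ` bad \<union> primes_le T)"
      using finJ by (intro card_mono) (auto simp: bad_def)
    also have "\<dots> \<le> card (J \<union> g ` bad) + card (primes_le T)" by (rule card_Un_le)
    also have "\<dots> \<le> card J + card (g ` bad) + card (primes_le T)" using card_Un_le[of J "g ` bad"] by linarith
    also have "card (g ` bad) \<le> card bad" by (intro card_image_le) (auto simp: bad_def)
    also have "card bad \<le> card (primes_le z)" by (intro card_mono[OF finite_primes_le]) (auto simp: bad_def primes_le_def)
    finally have "real (card S) \<le> real (card J) + real (card (primes_le z)) + real (card (primes_le T))"
      by (simp add: of_nat_mono flip: of_nat_add)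
    then show ?thesis using card_primes_le_le[of z] card_primes_le_le[of T] z T by linarith
  qed
  moreover have "ln (real n) \<ge> ln z * (\<Sum>q\<in>J. real q - 1)"
  proof -
    have main: "ln z * (\<Sum>q\<in>J \<inter> M p. real q - 1) \<le> real (multiplicity p n) * ln (real p)"
      if p: "p \<in> prime_factors n" for p
    proof (cases "M p = {}")
      case True
      then show ?thesis by (simp add: ln_nat_nonneg)
    next
      case False
      have p2: "p \<ge> 2" using prime_ge_2_nat[OF in_prime_factors_imp_prime[OF p]] .
      have Mp: "prime q \<and> q dvd multiplicity p n + 1 \<and> real q > T" if "q \<in> M p" for q
        using that f(2) prime by (auto simp: M_def S1_def)
      have "\<Prod>(M p) dvd multiplicity p n + 1" using finM Mp by (intro prod_primes_dvd) auto
      then have "\<Prod>(M p) \<le> multiplicity p n + 1" by (intro dvd_imp_le) auto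
      then have mult: "real (\<Prod>(M p)) - 1 \<le> real (multiplicity p n)" by linarith
      have q1: "q \<ge> 1" if "q \<in> M p" for q using Mp[OF that] prime_ge_1_nat by auto
      have lnz: "ln z \<ge> 0" using z by simp
      show ?thesis
      proof (cases "real p \<le> z")
        \<comment> \<open>Here p > z, so each unit of the exponent costs at least ln z and the
          Bernoulli inequality alone suffices.\<close>
        case good: False
        have "(\<Sum>q\<in>J \<inter> M p. real q - 1) \<le> (\<Sum>q\<in>M p. real q - 1)"
          using finM q1 by (intro sum_mono2) auto
        also have "1 + (\<Sum>q\<in>M p. real q - 1) \<le> real (\<Prod>(M p))"
          by (rule one_plus_sum_le_prod[OF finM q1])
        then have "(\<Sum>q\<in>M p. real q - 1) \<le> real (\<Prod>(M p)) - 1" by linarith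
        finally have "(\<Sum>q\<in>J \<inter> M p. real q - 1) \<le> real (multiplicity p n)" using mult by linarith
        moreover have "ln z \<le> ln (real p)" using good z by (subst ln_le_cancel_iff) auto
        moreover have "(\<Sum>q\<in>J \<inter> M p. real q - 1) \<ge> 0" using q1 by (intro sum_nonneg) auto
        ultimately show ?thesis using lnz
          by (subst mult.commute) (intro mult_mono, auto)
      next
        case True
        then have bad: "p \<in> bad" using p False by (auto simp: bad_def)
        define M' where "M' = M p - {g p}"
        let ?s = "\<Sum>q\<in>M'. real q - 1"
        have s0: "?s \<ge> 0" using q1 by (intro sum_nonneg) (auto simp: M'_def)
        have "(\<Sum>q\<in>J \<inter> M p. real q - 1) \<le> ?s"
          using finM q1 bad by (intro sum_mono2) (auto simp: M'_def J_def)
        then have "ln z * (\<Sum>q\<in>J \<inter> M p. real q - 1) \<le> ln z * ?s" using lnz by (intro mult_left_mono) auto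
        also have "\<dots> \<le> (T / 2) * ?s" using T s0 by (intro mult_right_mono) auto
        also have "\<dots> \<le> real (multiplicity p n) * (1 / 2)"
        proof -
          \<comment> \<open>The sacrificed prime \<open>g p\<close> still divides the exponent plus
            one and multiplies the product of the others by more than \<open>T\<close>. This factor,
            at least \<open>2 * ln z\<close>, makes up for ln p, of which only
            \<open>ln p \<ge> 1/2\<close> is used.\<close>
          have "T * ?s \<le> real (g p) * (1 + ?s) - 1"
          proof -
            have gp: "real (g p) > T" "real (g p) \<ge> 1" using Mp[OF g[OF bad]] q1[OF g[OF bad]] by auto
            have "T * ?s \<le> real (g p) * ?s" using gp s0 by (intro mult_right_mono) auto
            then show ?thesis using gp by (simp add: algebra_simps)
          qed
          also have "real (g p) * (1 + ?s) \<le> real (g p) * real (\<Prod>M')"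
            using finM q1 by (intro mult_left_mono one_plus_sum_le_prod) (auto simp: M'_def)
          also have "real (g p) * real (\<Prod>M') = real (\<Prod>(M p))"
            using prod.remove[OF finM g[OF bad], of "\<lambda>x. x"] by (simp add: M'_def)
          finally show ?thesis using mult by simp
        qed
        also have "\<dots> \<le> real (multiplicity p n) * ln (real p)"
        proof (rule mult_left_mono)
          have "1 / 2 \<le> ln (2::real)" using ln_le_minus_one[of "1/2::real"] by (simp add: ln_div)
          also have "\<dots> \<le> ln (real p)" using p2 by (subst ln_le_cancel_iff) auto
          finally show "1 / 2 \<le> ln (real p)" .
        qed auto
        finally show ?thesis .
      qed
    qed
    have "(\<Sum>q\<in>J. real q - 1) = (\<Sum>p\<in>prime_factors n. \<Sum>q\<in>J \<inter> M p. real q - 1)"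
    proof -
      have "(\<Sum>p\<in>prime_factors n. \<Sum>q\<in>{q \<in> J. f q = p}. real q - 1) = (\<Sum>q\<in>J. real q - 1)"
        using finJ f(1) JS by (intro sum.group) auto
      moreover have "{q \<in> J. f q = p} = J \<inter> M p" for p by (auto simp: J_def M_def)
      ultimately show ?thesis by simp
    qed
    then have "ln z * (\<Sum>q\<in>J. real q - 1) = (\<Sum>p\<in>prime_factors n. ln z * (\<Sum>q\<in>J \<inter> M p. real q - 1))"
      by (simp add: sum_distrib_left)
    also have "\<dots> \<le> (\<Sum>p\<in>prime_factors n. real (multiplicity p n) * ln (real p))"
      by (intro sum_mono main)
    also have "\<dots> = (\<Sum>p\<in>prime_factors n. ln (real p ^ multiplicity p n))"
      by (intro sum.cong) (auto simp: ln_realpow prime_gt_0_nat dest: in_prime_factors_imp_prime)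
    also have "\<dots> = ln (\<Prod>p\<in>prime_factors n. real p ^ multiplicity p n)"
      by (intro ln_prod[symmetric]) (auto simp: prime_gt_0_nat dest: in_prime_factors_imp_prime)
    also have "(\<Prod>p\<in>prime_factors n. real p ^ multiplicity p n) = real n"
      using arg_cong[OF prime_factorization_nat[OF n], of real] by simp
    finally show ?thesis .
  qed
  ultimately show ?thesis using JS by blast
qed

text \<open>Duality is applied with y = t ln t to the primes that survive the discarding. Both the
  discarded primes and the replacement of ln t by ln z affect only the secondary term t^2 ln t ln ln
  t.\<close>

lemma omega_ndiv_upper:
  "\<exists>C>0. \<forall>\<^sub>F t in at_top. \<forall>n>0. real (omega (ndiv n)) \<ge> t \<longrightarrow>
     ln (real n) \<ge> t\<^sup>2 * ((ln t)\<^sup>2 / 2 - C * (ln t * ln (ln t)))"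
proof -
  obtain C where C: "C > 0" and
    ev: "\<forall>\<^sub>F x in at_top. prime_gap_sum (x * ln x) \<le> x\<^sup>2 * ln x / 2 + C * (x\<^sup>2 * ln (ln x))"
    using prime_gap_sum_x_ln_x by blast
  have ev1: "\<forall>\<^sub>F t::real in at_top. ln t \<ge> 1" "\<forall>\<^sub>F t::real in at_top. ln (ln t) \<ge> 0"
    "\<forall>\<^sub>F t::real in at_top. t / (ln t)\<^sup>2 \<ge> 1" "\<forall>\<^sub>F t::real in at_top. t * ln t \<ge> 1"
    "\<forall>\<^sub>F t::real in at_top. (t - 2 * ln t - t / (ln t)\<^sup>2) * (t * ln t - 1) - t\<^sup>2 * ln t / 2 \<ge> t\<^sup>2 * ln t / 2 - t\<^sup>2 * ln (ln t)"
    by real_asymp+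
  have "\<forall>\<^sub>F t in at_top. \<forall>n>0. real (omega (ndiv n)) \<ge> t \<longrightarrow>
     ln (real n) \<ge> t\<^sup>2 * ((ln t)\<^sup>2 / 2 - (C + 2) * (ln t * ln (ln t)))"
    using ev ev1 eventually_gt_at_top[of 0]
  proof eventually_elim
    case (elim t)
    define l la where "l = ln t" and "la = ln (ln t)"
    have l: "l \<ge> 1" "la \<ge> 0" using elim by (auto simp: l_def la_def)
    have t0: "t > 0" by fact
    \<comment> \<open>Losing z primes of size about t l costs t^2 / l in the sum, below the error
      t^2 la, while ln z differs from l only by 2 la.\<close>
    define z where "z = t / l\<^sup>2"
    have z: "z \<ge> 1" using elim(4) by (simp add: z_def l_def)
    have lnz: "ln z = l - 2 * la" using t0 l by (simp add: z_def ln_div ln_realpow l_def la_def)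
    show ?case
    proof (intro allI impI)
      fix n :: nat assume n: "n > 0" and om: "t \<le> real (omega (ndiv n))"
      obtain J where J: "J \<subseteq> prime_factors (ndiv n)"
        "real (card (prime_factors (ndiv n))) \<le> real (card J) + 2 * l + z"
        "ln (real n) \<ge> ln z * (\<Sum>q\<in>J. real q - 1)"
        using ln_ge_of_prime_divisors_of_ndiv[OF n subset_refl z, of "2 * l"] lnz l by auto
      have finJ: "finite J" using J(1) finite_subset by blast
      have card: "real (card J) \<ge> t - 2 * l - z" using J(2) om by (simp add: omega_def)
      \<comment> \<open>The parameter of the duality is t l, although J may have slightly fewer than
        t elements; the resulting loss is still of lower order.\<close>
      have "real (\<Sum>J) \<ge> real (card J) * (t * l) - prime_gap_sum (t * l)"
        using J(1) by (intro sum_primes_ge finJ) auto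
      moreover have "(\<Sum>q\<in>J. real q - 1) = real (\<Sum>J) - real (card J)" by (simp add: sum_subtractf)
      ultimately have "(\<Sum>q\<in>J. real q - 1) \<ge> real (card J) * (t * l - 1) - prime_gap_sum (t * l)"
        by (simp add: algebra_simps)
      moreover have "real (card J) * (t * l - 1) \<ge> (t - 2 * l - z) * (t * l - 1)"
        using card elim(5) by (intro mult_right_mono) (auto simp: l_def)
      ultimately have sumJ: "(\<Sum>q\<in>J. real q - 1) \<ge> t\<^sup>2 * l / 2 - (C + 1) * (t\<^sup>2 * la)"
        using elim(1,6) by (simp add: l_def la_def z_def algebra_simps)
      have "t\<^sup>2 * (l\<^sup>2 / 2 - (C + 2) * (l * la)) \<le> ln z * (t\<^sup>2 * l / 2 - (C + 1) * (t\<^sup>2 * la))"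
      proof -
        have "ln z * (t\<^sup>2 * l / 2 - (C + 1) * (t\<^sup>2 * la)) = t\<^sup>2 * (l\<^sup>2 / 2 - (C + 2) * (l * la)) + 2 * (C + 1) * (t\<^sup>2 * la\<^sup>2)"
          unfolding lnz by (simp add: field_simps power2_eq_square)
        moreover have "2 * (C + 1) * (t\<^sup>2 * la\<^sup>2) \<ge> 0" using C by simp
        ultimately show ?thesis by linarith
      qed
      also have "\<dots> \<le> ln z * (\<Sum>q\<in>J. real q - 1)" using sumJ z by (intro mult_left_mono) auto
      also have "\<dots> \<le> ln (real n)" by (rule J(3))
      finally show "t\<^sup>2 * ((ln t)\<^sup>2 / 2 - (C + 2) * (ln t * ln (ln t))) \<le> ln (real n)"
        by (simp add: l_def la_def)
    qed
  qed
  then show ?thesis using C by (intro exI[of _ "C + 2"]) auto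
qed

section \<open>The maximal order\<close>

lemma w_attained:
  assumes "x \<ge> 1"
  shows "\<exists>n>0. real n \<le> x \<and> omega (ndiv n) = w x"
proof -
  have "w x \<in> (\<lambda>n. omega (ndiv n)) ` {1..nat \<lfloor>x\<rfloor>}"
    unfolding w_def using assms by (intro Max_in) (auto simp: le_nat_iff)
  then show ?thesis using assms by (auto simp: real_le_nat_floor_iff Suc_le_eq)
qed

lemma omega_ndiv_le_w:
  assumes "n > 0" "real n \<le> x"
  shows "omega (ndiv n) \<le> w x"
  unfolding w_def using assms by (intro Max_ge) (auto simp: real_le_nat_floor_iff Suc_le_eq)

text \<open>Write l = ln X and e = D ln l / l; the scale a has ln a between l / 2 - ln l and l / 2.
  In D, the 4 pays for the lower end and 4 C for the second-order term, so that the bracket is at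
  least l^2 (1 - e) / 8. The right-hand side is then at least X (1 + e)^2 (1 - e), which exceeds X
  for 0 < e < 1/2.\<close>

lemma scale_exceeds_above_main_term:
  assumes C: "C > 0" and D: "D = 4 + 4 * C"
  shows "\<forall>\<^sub>F X in at_top. X < (sqrt 8 * sqrt X / ln X * (1 + D * (ln (ln X) / ln X)))\<^sup>2 *
     ((ln (sqrt 8 * sqrt X / ln X * (1 + D * (ln (ln X) / ln X))))\<^sup>2 / 2
       - C * (ln (sqrt 8 * sqrt X / ln X * (1 + D * (ln (ln X) / ln X))) *
              ln (ln (sqrt 8 * sqrt X / ln X * (1 + D * (ln (ln X) / ln X))))))"
proof -
  have D0: "D > 0" using C D by simp
  have ev: "\<forall>\<^sub>F X::real in at_top. ln X \<ge> 1" "\<forall>\<^sub>F X::real in at_top. ln (ln X) > 0"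
    "\<forall>\<^sub>F X::real in at_top. sqrt 8 * (1 + D * (ln (ln X) / ln X)) \<le> ln X"
    "\<forall>\<^sub>F X::real in at_top. 4 * ln (ln X) \<le> ln X"
    "\<forall>\<^sub>F X::real in at_top. D * (ln (ln X) / ln X) < 1 / 2"
    "\<forall>\<^sub>F X::real in at_top. ln X / 2 - ln (ln X) > 1"
    by real_asymp+
  show ?thesis using ev eventually_gt_at_top[of 0]
  proof eventually_elim
    case (elim X)
    define l la \<epsilon> where "l = ln X" and "la = ln (ln X)" and "\<epsilon> = ln (ln X) / ln X"
    define a where "a = sqrt 8 * sqrt X / l * (1 + D * \<epsilon>)"
    have l: "l \<ge> 1" "la > 0" "4 * la \<le> l" and X: "X > 0"
      using elim by (auto simp: l_def la_def)
    have \<epsilon>_eq: "\<epsilon> = la / l" by (simp add: \<epsilon>_def l_def la_def)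
    have \<epsilon>: "\<epsilon> > 0" "la = \<epsilon> * l" using l by (auto simp: \<epsilon>_eq)
    have \<epsilon>': "D * \<epsilon> < 1 / 2" using elim(5) by (simp add: \<epsilon>_def)
    note \<epsilon> = \<epsilon>(1) \<epsilon>' \<epsilon>(2)
    have a2: "a\<^sup>2 = 8 * X / l\<^sup>2 * (1 + D * \<epsilon>)\<^sup>2"
      using X by (simp add: a_def power_mult_distrib power_divide)
    have a_lower: "sqrt X / l \<le> a"
    proof -
      have "1 * 1 \<le> sqrt 8 * (1 + D * \<epsilon>)" using D0 \<epsilon> by (intro mult_mono) auto
      then have "sqrt X / l * 1 \<le> sqrt X / l * (sqrt 8 * (1 + D * \<epsilon>))" using X l by (intro mult_left_mono) auto
      then show ?thesis by (simp add: a_def mult_ac)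
    qed
    have el: "sqrt 8 * (1 + D * \<epsilon>) \<le> l" using elim(3) by (simp add: l_def \<epsilon>_def)
    have a_upper: "a \<le> sqrt X"
    proof -
      have "sqrt X / l * (sqrt 8 * (1 + D * \<epsilon>)) \<le> sqrt X / l * l"
        using el X l by (intro mult_left_mono) auto
      then show ?thesis using l by (simp add: a_def mult_ac)
    qed
    have sl: "sqrt X / l > 0" using X l by simp
    have "ln (sqrt X / l) \<le> ln a" using a_lower sl by (subst ln_le_cancel_iff) auto
    moreover have "ln (sqrt X / l) = ln X / 2 - ln l" using X l by (simp add: ln_div ln_sqrt)
    ultimately have lna_lower: "ln a \<ge> l / 2 - la" by (simp add: l_def la_def)
    have "ln a \<le> ln (sqrt X)" using a_upper a_lower sl X by (subst ln_le_cancel_iff) auto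
    then have lna_upper: "ln a \<le> l / 2" using X by (simp add: ln_sqrt l_def)
    have lna1: "ln a > 1" using elim(6) lna_lower by (simp add: l_def la_def)
    have "ln (ln a) \<le> ln l" using lna1 lna_upper l by (subst ln_le_cancel_iff) auto
    then have llna: "ln (ln a) \<le> la" by (simp add: l_def la_def)
    have "X < X * ((1 + D * \<epsilon>)\<^sup>2 * (1 - D * \<epsilon>))"
    proof -
      define e where "e = D * \<epsilon>"
      have e: "e > 0" "e < 1 / 2" using D0 \<epsilon> by (auto simp: e_def)
      have "e * e < e * (1 / 2)" using e by (intro mult_strict_left_mono) auto
      moreover have "e * (e * e) < e * (e * 1)" using e by (intro mult_strict_left_mono) auto
      ultimately have "1 < (1 + e)\<^sup>2 * (1 - e)" by (simp add: power2_eq_square algebra_simps)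
      then show ?thesis using X by (simp add: e_def)
    qed
    also have "\<dots> = a\<^sup>2 * (l\<^sup>2 / 8 * (1 - D * \<epsilon>))" using l by (simp add: a2)
    also have "\<dots> \<le> a\<^sup>2 * ((ln a)\<^sup>2 / 2 - C * (ln a * ln (ln a)))"
    proof (rule mult_left_mono)
      have "(l / 2 - la)\<^sup>2 \<le> (ln a)\<^sup>2" using lna_lower l by (intro power_mono) auto
      moreover have "C * (ln a * ln (ln a)) \<le> C * (l / 2 * la)"
        using C lna_upper llna l lna1 by (intro mult_left_mono mult_mono) auto
      moreover have "l\<^sup>2 / 8 * (1 - D * \<epsilon>) \<le> (l / 2 - la)\<^sup>2 / 2 - C * (l / 2 * la)"
      proof -
        have "(l / 2 - la)\<^sup>2 / 2 - C * (l / 2 * la) - l\<^sup>2 / 8 * (1 - D * \<epsilon>) = la\<^sup>2 / 2"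
          unfolding D \<epsilon>(3) by (simp add: power2_eq_square field_simps)
        then show ?thesis using zero_le_power2[of la] by linarith
      qed
      ultimately show "l\<^sup>2 / 8 * (1 - D * \<epsilon>) \<le> (ln a)\<^sup>2 / 2 - C * (ln a * ln (ln a))" by linarith
    qed auto
    finally show ?case unfolding a_def l_def \<epsilon>_def .
  qed
qed

text \<open>Dually, ln a \<le> l / 2 and D \<ge> 4 C bound the bracket by l^2 (1 + e) / 8, and (1 -
  e)^2 (1 + e) = (1 - e) (1 - e^2) \<le> 1.\<close>

lemma scale_admissible_below_main_term:
  assumes C: "C > 0" and D: "D = 4 + 4 * C"
  shows "\<forall>\<^sub>F X in at_top. (sqrt 8 * sqrt X / ln X * (1 - D * (ln (ln X) / ln X)))\<^sup>2 *
     ((ln (sqrt 8 * sqrt X / ln X * (1 - D * (ln (ln X) / ln X))))\<^sup>2 / 2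
       + C * (ln (sqrt 8 * sqrt X / ln X * (1 - D * (ln (ln X) / ln X))) *
              ln (ln (sqrt 8 * sqrt X / ln X * (1 - D * (ln (ln X) / ln X)))))) \<le> X"
proof -
  have D0: "D > 0" using C D by simp
  have ev: "\<forall>\<^sub>F X::real in at_top. ln X \<ge> sqrt 8" "\<forall>\<^sub>F X::real in at_top. ln (ln X) > 0"
    "\<forall>\<^sub>F X::real in at_top. D * (ln (ln X) / ln X) < 1 / 2"
    "\<forall>\<^sub>F X::real in at_top. ln X / 2 - ln (ln X) > 1"
    by real_asymp+
  show ?thesis using ev eventually_gt_at_top[of 0]
  proof eventually_elim
    case (elim X)
    define l la \<epsilon> where "l = ln X" and "la = ln (ln X)" and "\<epsilon> = ln (ln X) / ln X"
    define a where "a = sqrt 8 * sqrt X / l * (1 - D * \<epsilon>)"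
    have s8: "sqrt 8 \<ge> (2::real)" by (rule real_le_rsqrt) simp
    have l: "l \<ge> 1" "la > 0" "l \<ge> sqrt 8" and X: "X > 0"
      using elim s8 by (auto simp: l_def la_def)
    have \<epsilon>_eq: "\<epsilon> = la / l" by (simp add: \<epsilon>_def l_def la_def)
    have \<epsilon>: "\<epsilon> > 0" "la = \<epsilon> * l" using l by (auto simp: \<epsilon>_eq)
    have \<epsilon>': "D * \<epsilon> < 1 / 2" using elim(3) by (simp add: \<epsilon>_def)
    note \<epsilon> = \<epsilon>(1) \<epsilon>' \<epsilon>(2)
    have a2: "a\<^sup>2 = 8 * X / l\<^sup>2 * (1 - D * \<epsilon>)\<^sup>2"
      using X by (simp add: a_def power_mult_distrib power_divide)
    have a_lower: "sqrt X / l \<le> a"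
    proof -
      have "2 * (1 / 2) \<le> sqrt 8 * (1 - D * \<epsilon>)" using D0 \<epsilon> s8 by (intro mult_mono) auto
      then have "sqrt X / l * 1 \<le> sqrt X / l * (sqrt 8 * (1 - D * \<epsilon>))" using X l by (intro mult_left_mono) auto
      then show ?thesis by (simp add: a_def mult_ac)
    qed
    have a_upper: "a \<le> sqrt X"
    proof -
      have "sqrt 8 * (1 - D * \<epsilon>) \<le> l * 1" using l D0 \<epsilon> by (intro mult_mono) auto
      then have "sqrt X / l * (sqrt 8 * (1 - D * \<epsilon>)) \<le> sqrt X / l * (l * 1)"
        using X l by (intro mult_left_mono) auto
      then show ?thesis using l by (simp add: a_def mult_ac)
    qed
    have sl: "sqrt X / l > 0" using X l by simp
    have "ln (sqrt X / l) \<le> ln a" using a_lower sl by (subst ln_le_cancel_iff) auto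
    moreover have "ln (sqrt X / l) = ln X / 2 - ln l" using X l by (simp add: ln_div ln_sqrt)
    ultimately have lna_lower: "ln a \<ge> l / 2 - la" by (simp add: l_def la_def)
    have "ln a \<le> ln (sqrt X)" using a_upper a_lower sl X by (subst ln_le_cancel_iff) auto
    then have lna_upper: "ln a \<le> l / 2" using X by (simp add: ln_sqrt l_def)
    have lna1: "ln a > 1" using elim(4) lna_lower by (simp add: l_def la_def)
    have "ln (ln a) \<le> ln l" using lna1 lna_upper l by (subst ln_le_cancel_iff) auto
    then have llna: "ln (ln a) \<le> la" by (simp add: l_def la_def)
    have "a\<^sup>2 * ((ln a)\<^sup>2 / 2 + C * (ln a * ln (ln a))) \<le> a\<^sup>2 * (l\<^sup>2 / 8 * (1 + D * \<epsilon>))"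
    proof (rule mult_left_mono)
      have "(ln a)\<^sup>2 \<le> (l / 2)\<^sup>2" using lna_upper lna1 by (intro power_mono) auto
      moreover have "C * (ln a * ln (ln a)) \<le> C * (l / 2 * la)"
        using C lna_upper llna l lna1 by (intro mult_left_mono mult_mono) auto
      moreover have "(l / 2)\<^sup>2 / 2 + C * (l / 2 * la) \<le> l\<^sup>2 / 8 * (1 + D * \<epsilon>)"
      proof -
        have "l\<^sup>2 / 8 * (1 + D * \<epsilon>) - ((l / 2)\<^sup>2 / 2 + C * (l / 2 * la)) = l\<^sup>2 * \<epsilon> / 2"
          unfolding D \<epsilon>(3) by (simp add: power2_eq_square field_simps)
        moreover have "l\<^sup>2 * \<epsilon> / 2 \<ge> 0" using \<epsilon> by simp
        ultimately show ?thesis by linarith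
      qed
      ultimately show "(ln a)\<^sup>2 / 2 + C * (ln a * ln (ln a)) \<le> l\<^sup>2 / 8 * (1 + D * \<epsilon>)" by linarith
    qed auto
    also have "\<dots> = X * ((1 - D * \<epsilon>) * (1 - (D * \<epsilon>)\<^sup>2))"
      using l by (simp add: a2) (simp add: power2_eq_square algebra_simps)
    also have "\<dots> \<le> X * (1 * 1)"
    proof -
      have "(D * \<epsilon>)\<^sup>2 \<le> 1\<^sup>2" using D0 \<epsilon> by (intro power_mono) auto
      then have "(1 - D * \<epsilon>) * (1 - (D * \<epsilon>)\<^sup>2) \<le> 1 * 1"
        using D0 \<epsilon> by (intro mult_mono) auto
      then show ?thesis using X by (intro mult_left_mono) auto
    qed
    finally show ?case unfolding a_def l_def \<epsilon>_def by simp
  qed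
qed

theorem theorem2:
  "(\<lambda>x::real. real (w x) - sqrt 8 * sqrt (ln x) / ln (ln x))
     \<in> O[at_top](\<lambda>x. (sqrt (ln x) / ln (ln x)) * (ln (ln (ln x)) / ln (ln x)))"
proof -
  obtain C1 where C1: "C1 > 0" and U: "\<forall>\<^sub>F t in at_top. \<forall>n>0. real (omega (ndiv n)) \<ge> t \<longrightarrow>
     ln (real n) \<ge> t\<^sup>2 * ((ln t)\<^sup>2 / 2 - C1 * (ln t * ln (ln t)))"
    using omega_ndiv_upper by blast
  obtain C2 where C2: "C2 > 0" and L: "\<forall>\<^sub>F t in at_top. \<exists>n>0. real (omega (ndiv n)) \<ge> t - 1 \<and>
     ln (real n) \<le> t\<^sup>2 * ((ln t)\<^sup>2 / 2 + C2 * (ln t * ln (ln t)))"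
    using omega_ndiv_lower by blast
  define D1 D2 where "D1 = 4 + 4 * C1" and "D2 = 4 + 4 * C2"
  have D: "D1 > 0" "D2 > 0" using C1 C2 by (auto simp: D1_def D2_def)
  define a where "a = (\<lambda>X::real. sqrt 8 * sqrt X / ln X * (1 + D1 * (ln (ln X) / ln X)))"
  define b where "b = (\<lambda>X::real. sqrt 8 * sqrt X / ln X * (1 - D2 * (ln (ln X) / ln X)))"
  have fa: "filterlim a at_top at_top" unfolding a_def by real_asymp
  have fb: "filterlim b at_top at_top" unfolding b_def by real_asymp
  note U' = eventually_compose_filterlim[OF U fa] and L' = eventually_compose_filterlim[OF L fb]
  have A: "\<forall>\<^sub>F X in at_top. X < (a X)\<^sup>2 * ((ln (a X))\<^sup>2 / 2 - C1 * (ln (a X) * ln (ln (a X))))"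
    unfolding a_def by (rule scale_exceeds_above_main_term[OF C1 D1_def])
  have B: "\<forall>\<^sub>F X in at_top. (b X)\<^sup>2 * ((ln (b X))\<^sup>2 / 2 + C2 * (ln (b X) * ln (ln (b X)))) \<le> X"
    unfolding b_def by (rule scale_admissible_below_main_term[OF C2 D2_def])
  \<comment> \<open>This lets the error term absorb the 1 lost to rounding in
    \<open>omega_ndiv_lower\<close>.\<close>
  have one: "\<forall>\<^sub>F X::real in at_top. 1 \<le> sqrt X / ln X * (ln (ln X) / ln X)" by real_asymp
  \<comment> \<open>The estimate is stated in terms of X = ln x, the variable in which the scales
    \<open>a\<close> and \<open>b\<close> are defined, and pulled back along \<open>ln\<close> at
    the end.\<close>
  have main: "\<forall>\<^sub>F X in at_top. \<forall>x>0. ln x = X \<longrightarrow>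
     \<bar>real (w x) - sqrt 8 * sqrt X / ln X\<bar> \<le> (sqrt 8 * (D1 + D2) + 1) * \<bar>sqrt X / ln X * (ln (ln X) / ln X)\<bar>"
    using U' L' A B one eventually_ge_at_top[of 0]
  proof eventually_elim
    case (elim X)
    show ?case
    proof (intro allI impI)
      fix x :: real assume x: "x > 0" "ln x = X"
      have x1: "x \<ge> 1" using x elim(6) by (intro ln_ge_zero_imp_ge_one) auto
      define e where "e = sqrt X / ln X * (ln (ln X) / ln X)"
      have e: "e \<ge> 1" using elim(5) by (simp add: e_def)
      have aX: "a X = sqrt 8 * sqrt X / ln X + sqrt 8 * D1 * e"
        and bX: "b X = sqrt 8 * sqrt X / ln X - sqrt 8 * D2 * e"
        by (simp_all add: a_def b_def e_def algebra_simps add_divide_distrib diff_divide_distrib)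
      \<comment> \<open>Otherwise an n \<le> x attaining the maximum would satisfy ln n > X = ln
        x.\<close>
      have "real (w x) < a X"
      proof (rule ccontr)
        assume ge: "\<not> real (w x) < a X"
        obtain n where n: "n > 0" "real n \<le> x" "omega (ndiv n) = w x"
          using w_attained[OF x1] by blast
        have "a X \<le> real (omega (ndiv n))" using ge n(3) by simp
        then have "(a X)\<^sup>2 * ((ln (a X))\<^sup>2 / 2 - C1 * (ln (a X) * ln (ln (a X)))) \<le> ln (real n)"
          using elim(1) n(1) by blast
        then have "ln (real n) > X" using elim(3) by linarith
        moreover have "ln (real n) \<le> ln x" using n x by (subst ln_le_cancel_iff) auto
        ultimately show False using x by simp
      qed
      moreover have "real (w x) \<ge> b X - 1"
      proof -
        obtain n where n: "n > 0" "real (omega (ndiv n)) \<ge> b X - 1"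
            "ln (real n) \<le> (b X)\<^sup>2 * ((ln (b X))\<^sup>2 / 2 + C2 * (ln (b X) * ln (ln (b X))))"
          using elim(2) by blast
        then have "ln (real n) \<le> ln x" using elim(4) x(2) by linarith
        then have "real n \<le> x" using n(1) x(1) by (subst (asm) ln_le_cancel_iff) auto
        then have "omega (ndiv n) \<le> w x" using n by (intro omega_ndiv_le_w) auto
        then show ?thesis using n(2) by linarith
      qed
      moreover have "sqrt 8 * D1 * e \<ge> 0" "sqrt 8 * D2 * e \<ge> 0" using D e by auto
      moreover have "(sqrt 8 * (D1 + D2) + 1) * \<bar>e\<bar> = sqrt 8 * D1 * e + sqrt 8 * D2 * e + e"
        using e by (simp add: algebra_simps)
      ultimately show "\<bar>real (w x) - sqrt 8 * sqrt X / ln X\<bar> \<le> (sqrt 8 * (D1 + D2) + 1) * \<bar>sqrt X / ln X * (ln (ln X) / ln X)\<bar>"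
        using e unfolding aX bX e_def[symmetric] by linarith
    qed
  qed
  have "\<forall>\<^sub>F x in at_top. norm (real (w x) - sqrt 8 * sqrt (ln x) / ln (ln x))
      \<le> (sqrt 8 * (D1 + D2) + 1) * norm ((sqrt (ln x) / ln (ln x)) * (ln (ln (ln x)) / ln (ln x)))"
    using eventually_compose_filterlim[OF main ln_at_top] eventually_gt_at_top[of 0]
    by eventually_elim auto
  then show ?thesis by (rule bigoI)
qed

end
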